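(* Let $\mathbf{x}=x_1,\ldots,x_n$ be differential indeterminates over $\mathbb{C}$, $e\ge1$, and $\mathbf{f}=f_1,\ldots,f_s$ differential polynomials in $\mathbb{C}[\mathbf{x},\dot{\mathbf{x}},\ldots,\mathbf{x}^{(e)}]$. Let $V\subset\mathbb{C}^{n(e+1)}$ be the algebraic variety defined by $\{\mathbf{f}=0\}$ (viewing $\mathbf{f}$ as ordinary polynomials in the $n(e+1)$ variables $x_i^{(j)}$, $0\le j\le e$), and let $\nu:=\max\{1,\dim(V)\}$ and $D:=\max\{\deg(\mathbf{f}),\deg(V)\}$. Then $$1\in[\mathbf{f}]\quad\Longleftrightarrow\quad 1\in(\mathbf{f},\ldots,\mathbf{f}^{(L)}),$$ where $L\le(n(e+1)D)^{2^{c\nu^2n(e+1)}}$ for a universal constant $c>0$.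
   Context: $\mathbb{C}\{\mathbf{x}\}$ is the differential polynomial ring $\mathbb{C}[x_i^{(p)}:p\in\mathbb{N}_0]$ with derivation $x_i^{(p)}\mapsto x_i^{(p+1)}$ and $\mathbb{C}$ as constants; $\mathbf{f}^{(p)}$ is the family of $p$-th total derivatives; $[\mathbf{f}]$ is the differential ideal generated by $\mathbf{f}$, and $(\cdot)$ is the ordinary polynomial ideal in the polynomial ring in the finitely many variables involved. Degree of a variety: sum over irreducible components of the number of intersection points with a generic affine linear subspace of complementary dimension; the empty set has dimension $-1$. *)

theory Defs
  imports Complex_Main "HOL-Library.Poly_Mapping"
begin

type_synonym 'v mpoly = "('v \<Rightarrow>\<^sub>0 nat) \<Rightarrow>\<^sub>0 complex"

definition mvar :: "'v \<Rightarrow> 'v mpoly" where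
  "mvar v = Poly_Mapping.single (Poly_Mapping.single v 1) 1"

definition mconst :: "complex \<Rightarrow> 'v mpoly" where
  "mconst c = Poly_Mapping.single 0 c"

definition mmonom :: "('v \<Rightarrow>\<^sub>0 nat) \<Rightarrow> complex \<Rightarrow> 'v mpoly" where
  "mmonom m c = Poly_Mapping.single m c"

definition vars :: "'v mpoly \<Rightarrow> 'v set" where
  "vars p = (\<Union>m\<in>Poly_Mapping.keys p. Poly_Mapping.keys m)"

definition eval :: "'v mpoly \<Rightarrow> ('v \<Rightarrow> complex) \<Rightarrow> complex" where
  "eval p a = (\<Sum>m\<in>Poly_Mapping.keys p. Poly_Mapping.lookup p m * (\<Prod>v\<in>Poly_Mapping.keys m. a v ^ Poly_Mapping.lookup m v))"

definition total_degree :: "'v mpoly \<Rightarrow> nat" where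
  "total_degree p = (if p = 0 then 0 else Max ((\<lambda>m. \<Sum>v\<in>Poly_Mapping.keys m. Poly_Mapping.lookup m v) ` Poly_Mapping.keys p))"

definition ideal_in :: "'v set \<Rightarrow> 'v mpoly set \<Rightarrow> 'v mpoly set" where
  "ideal_in Y S = {p. \<exists>T g. finite T \<and> T \<subseteq> S \<and> (\<forall>t\<in>T. vars (g t) \<subseteq> Y) \<and>
                       p = (\<Sum>t\<in>T. g t * t)}"

definition ideal_gen :: "'v mpoly set \<Rightarrow> 'v mpoly set" where
  "ideal_gen S = ideal_in UNIV S"

text \<open>The differential indeterminate x_i^(p) is the variable (i, p).
The derivation maps x_i^(p) to x_i^(p+1) and is extended by Leibniz rule,
with the complex numbers as constants.\<close>

definition dshift :: "nat \<times> nat \<Rightarrow> nat \<times> nat" where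
  "dshift v = (fst v, Suc (snd v))"

definition deriv_monom :: "(nat \<times> nat \<Rightarrow>\<^sub>0 nat) \<Rightarrow> (nat \<times> nat) mpoly" where
  "deriv_monom m = (\<Sum>v\<in>Poly_Mapping.keys m. mmonom (m - Poly_Mapping.single v 1 + Poly_Mapping.single (dshift v) 1)
                                        (of_nat (Poly_Mapping.lookup m v)))"

definition dderiv :: "(nat \<times> nat) mpoly \<Rightarrow> (nat \<times> nat) mpoly" where
  "dderiv p = (\<Sum>m\<in>Poly_Mapping.keys p. mconst (Poly_Mapping.lookup p m) * deriv_monom m)"

definition dderivs :: "nat \<Rightarrow> (nat \<times> nat) mpoly \<Rightarrow> (nat \<times> nat) mpoly" where
  "dderivs k p = (dderiv ^^ k) p"

definition diff_ideal :: "nat \<Rightarrow> (nat \<Rightarrow> (nat \<times> nat) mpoly) \<Rightarrow> (nat \<times> nat) mpoly set" where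
  "diff_ideal s f = ideal_gen {dderivs k (f i) | i k. i < s}"

definition dvars :: "nat \<Rightarrow> nat \<Rightarrow> (nat \<times> nat) set" where
  "dvars n N = {(i, j). i < n \<and> j \<le> N}"

text \<open>Ordinary ideal (f, f', ..., f^(L)) in the polynomial ring in the finitely
many variables involved, namely x^(j), j <= e + L, where f involves x up to order e.\<close>
definition trunc_ideal :: "nat \<Rightarrow> nat \<Rightarrow> nat \<Rightarrow> (nat \<Rightarrow> (nat \<times> nat) mpoly) \<Rightarrow> nat \<Rightarrow> (nat \<times> nat) mpoly set" where
  "trunc_ideal n e s f L = ideal_in (dvars n (e + L)) {dderivs k (f i) | i k. i < s \<and> k \<le> L}"

definition aspace :: "'v set \<Rightarrow> ('v \<Rightarrow> complex) set" where
  "aspace X = {a. \<forall>v. v \<notin> X \<longrightarrow> a v = 0}"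

definition zero_set :: "'v set \<Rightarrow> 'v mpoly set \<Rightarrow> ('v \<Rightarrow> complex) set" where
  "zero_set X F = {a \<in> aspace X. \<forall>p\<in>F. eval p a = 0}"

definition zclosed :: "'v set \<Rightarrow> ('v \<Rightarrow> complex) set \<Rightarrow> bool" where
  "zclosed X V \<longleftrightarrow> (\<exists>F. (\<forall>p\<in>F. vars p \<subseteq> X) \<and> V = zero_set X F)"

definition zirreducible :: "'v set \<Rightarrow> ('v \<Rightarrow> complex) set \<Rightarrow> bool" where
  "zirreducible X V \<longleftrightarrow> zclosed X V \<and> V \<noteq> {} \<and>
     (\<forall>A B. zclosed X A \<and> zclosed X B \<and> V = A \<union> B \<longrightarrow> V = A \<or> V = B)"

definition irr_components :: "'v set \<Rightarrow> ('v \<Rightarrow> complex) set \<Rightarrow> ('v \<Rightarrow> complex) set set" where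
  "irr_components X V = {C. C \<subseteq> V \<and> zirreducible X C \<and>
        (\<forall>C'. zirreducible X C' \<and> C \<subseteq> C' \<and> C' \<subseteq> V \<longrightarrow> C' = C)}"

definition zdim :: "'v set \<Rightarrow> ('v \<Rightarrow> complex) set \<Rightarrow> int" where
  "zdim X V = (if V = {} then -1 else
     int (Sup {k. \<exists>C :: nat \<Rightarrow> ('v \<Rightarrow> complex) set.
            (\<forall>i\<le>k. zirreducible X (C i) \<and> C i \<subseteq> V) \<and> (\<forall>i<k. C i \<subset> C (Suc i))}))"

definition affine_sub :: "'v set \<Rightarrow> nat \<Rightarrow> (nat \<Rightarrow> 'v \<Rightarrow> complex) \<Rightarrow> ('v \<Rightarrow> complex) set" where
  "affine_sub X m par = {a. \<exists>t :: nat \<Rightarrow> complex.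
        a = (\<lambda>v. if v \<in> X then par 0 v + (\<Sum>l\<in>{1..m}. t l * par l v) else 0)}"

text \<open>A property of the parameters (par l v), l <= m, v in X, holds generically if it
holds on a nonempty Zariski open subset of the parameter space, i.e. outside the zero set
of some nonzero polynomial in the parameter coordinates.\<close>
definition generic_param :: "'v set \<Rightarrow> nat \<Rightarrow> ((nat \<Rightarrow> 'v \<Rightarrow> complex) \<Rightarrow> bool) \<Rightarrow> bool" where
  "generic_param X m P \<longleftrightarrow> (\<exists>h :: (nat \<times> 'v) mpoly. h \<noteq> 0 \<and> vars h \<subseteq> {0..m} \<times> X \<and>
      (\<forall>par. (\<forall>l\<le>m. par l \<in> aspace X) \<and> eval h (\<lambda>(l, v). par l v) \<noteq> 0 \<longrightarrow> P par))"

definition irr_degree :: "'v set \<Rightarrow> ('v \<Rightarrow> complex) set \<Rightarrow> nat" where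
  "irr_degree X C = (THE k. generic_param X (card X - nat (zdim X C))
        (\<lambda>par. finite (C \<inter> affine_sub X (card X - nat (zdim X C)) par) \<and>
               card (C \<inter> affine_sub X (card X - nat (zdim X C)) par) = k))"

definition zdegree :: "'v set \<Rightarrow> ('v \<Rightarrow> complex) set \<Rightarrow> nat" where
  "zdegree X V = (\<Sum>C\<in>irr_components X V. irr_degree X C)"

end

theory Submission
  imports "Jordan_Normal_Form.Char_Poly" "HOL-Algebra.Algebraic_Closure_Type"
    "HOL-Library.Product_Lexorder" "HOL-Analysis.Continuum_Not_Denumerable"
    "HOL-Computational_Algebra.Computational_Algebra" Defs
begin

text \<open>
  If \<open>1\<close> does not lie in the truncated ideal, the Nullstellensatz yields a point, that is, a power
  series \<open>u(t)\<close> with \<open>f(u) = O(t\<^sup>L)\<close> in the \<open>N = n(e+1)\<close> coordinates \<open>x\<^sub>i\<^sup>(\<^sup>j\<^sup>)\<close>.  One follows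
  this approximate solution through varieties of decreasing dimension.  Let
  \<open>Y\<^sub>i = u\<^sub>i + \<Sum>c>i. \<lambda>\<^sub>i\<^sub>c u\<^sub>c\<close> be generic linear forms.  A relation \<open>Q(Y\<^sub>0, \<dots>, Y\<^sub>r) = O(t\<^sup>M)\<close>
  may be taken squarefree in \<open>Y\<^sub>r\<close>; differentiating it with respect to the parameters \<open>\<lambda>\<^sub>r\<^sub>c\<close>
  expresses every coordinate as a rational function on the hypersurface \<open>Q = 0\<close>.  The derivative of
  the highest-order coordinates is then governed by a linear system over the function field of this
  hypersurface.  If no relation of bounded degree in \<open>Y\<^sub>0, \<dots>, Y\<^bsub>r-1\<^esub>\<close> alone vanishes to high order
  along \<open>u\<close>, then every polynomial of bounded degree that vanishes to high order vanishes at some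
  point of the generic fibre; at this point the linear system is solvable and the equations \<open>f\<close> hold,
  which gives a differential field with a solution of \<open>f\<close>, contradicting \<open>1 \<in> [f]\<close>.  Hence there is a
  relation with one variable less, whose degree is polynomial in the previous one.  After \<open>N\<close> such
  steps no variable is left, which bounds \<open>L\<close> by \<open>(N d)\<close> raised to a power \<open>2\<^sup>O\<^sup>(\<^sup>N\<^sup>)\<close>, where \<open>d\<close> is the
  degree of \<open>f\<close>.
\<close>

text \<open>The obstacle is that "zero along \<open>u\<close>" only means "of high order in t". This
  is not a prime ideal condition: cancelling a factor costs its order, and taking a root divides the
  order by the exponent. Hence each algebraic step is an explicit polynomial identity with a degree
  bound: resultants for elimination, Hankel determinants for squarefree parts and for discarding
  roots, pseudo-division for divisibility. Assuming that no relation of bounded degree exists in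
  fewer forms bounds the orders of leading coefficients, and so makes cancellation possible.

  The coefficients \<lambda> are indeterminates rather than chosen numbers: they can then be
  differentiated, and their degree is never counted.

  One step takes degree \<delta> to a constant times 3^(6N) \<delta>^24. Written as exponents of a
  fixed base, degrees grow by a factor of at most 72 per step, which accounts for the 72^N in the
  final exponent.\<close>

no_notation Polynomials.var (\<open>X\<index>\<close>)
hide_const (open) up_ring.coeff up_ring.monom Polynomials.degree Polynomials.lead_coeff Module.smult Coset.order

abbreviation keys :: "('a \<Rightarrow>\<^sub>0 'b::zero) \<Rightarrow> 'a set" where "keys \<equiv> Poly_Mapping.keys"
abbreviation lookup :: "('a \<Rightarrow>\<^sub>0 'b::zero) \<Rightarrow> 'a \<Rightarrow> 'b" where "lookup \<equiv> Poly_Mapping.lookup"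
abbreviation single :: "'a \<Rightarrow> 'b \<Rightarrow> ('a \<Rightarrow>\<^sub>0 'b::zero)" where "single \<equiv> Poly_Mapping.single"

subsection \<open>Substitution homomorphisms and derivations\<close>

definition mon_val :: "('v \<Rightarrow> 'b::comm_ring_1) \<Rightarrow> ('v \<Rightarrow>\<^sub>0 nat) \<Rightarrow> 'b" where
  "mon_val \<phi> m = (\<Prod>v\<in>keys m. \<phi> v ^ lookup m v)"

text \<open>The universal homomorphism out of the polynomial ring. With \<open>\<kappa>\<close> left
  free, one set of rules serves values in polynomials, power series and fields.\<close>

definition msubst :: "(complex \<Rightarrow> 'b) \<Rightarrow> ('v \<Rightarrow> 'b) \<Rightarrow> 'v mpoly \<Rightarrow> 'b::comm_ring_1" where
  "msubst \<kappa> \<phi> p = (\<Sum>m\<in>keys p. \<kappa> (lookup p m) * mon_val \<phi> m)"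

lemma mon_val_superset:
  assumes "finite S" "keys m \<subseteq> S"
  shows "mon_val \<phi> m = (\<Prod>v\<in>S. \<phi> v ^ lookup m v)"
  unfolding mon_val_def using assms
  by (intro prod.mono_neutral_left) (auto simp: in_keys_iff)

lemma mon_val_0 [simp]: "mon_val \<phi> 0 = 1"
  by (simp add: mon_val_def)

lemma mon_val_add: "mon_val \<phi> (m + m') = mon_val \<phi> m * mon_val \<phi> m'"
proof -
  let ?S = "keys m \<union> keys m'"
  have "keys (m + m') \<subseteq> ?S" by (rule Poly_Mapping.keys_add)
  then show ?thesis
    by (simp add: mon_val_superset[of ?S] lookup_add power_add prod.distrib)
qed

lemma mon_val_single [simp]: "mon_val \<phi> (single v k) = \<phi> v ^ k"
  by (cases "k = 0") (auto simp: mon_val_def)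

lemma poly_mapping_sum_singles:
  "p = (\<Sum>m\<in>keys p. single m (lookup p m))"
proof (rule poly_mapping_eqI)
  fix k
  show "lookup p k =
    lookup (\<Sum>m\<in>keys p. single m (lookup p m)) k"
    by (simp add: lookup_sum lookup_single when_def in_keys_iff)
qed

lemma mconst_0 [simp]: "mconst 0 = 0"
  by (simp add: mconst_def)

lemma mconst_1 [simp]: "mconst 1 = 1"
  by (simp add: mconst_def)

lemma mconst_add: "mconst (a + b) = mconst a + mconst b"
  by (simp add: mconst_def single_add)

lemma mconst_mult: "mconst (a * b) = mconst a * mconst b"
  by (simp add: mconst_def mult_single)

lemma mconst_uminus: "mconst (- a) = - mconst a"
  by (simp add: mconst_def single_uminus)

lemma mconst_of_nat: "mconst (of_nat k) = of_nat k"
  by (simp add: mconst_def)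

lemma mconst_eq_0_iff [simp]: "mconst c = 0 \<longleftrightarrow> c = 0"
  by (metis mconst_0 mconst_def lookup_single_eq)

lemma comm_ring_hom_mconst: "comm_ring_hom mconst"
  by unfold_locales (auto simp: mconst_add mconst_mult)

lemma single_eq_const_mult: "single m c = mconst c * single m 1"
  by (simp add: mconst_def mult_single)

lemma single_sum_1: "finite A \<Longrightarrow> single (\<Sum>v\<in>A. g v) (1::complex) = (\<Prod>v\<in>A. single (g v) 1)"
proof (induction A rule: finite_induct)
  case (insert x A)
  then show ?case
    using mult_single[of "g x" "1::complex" "sum g A" 1] by simp
qed simp

lemma mvar_power: "mvar v ^ k = single (single v k) 1"
  by (induction k) (simp_all add: mvar_def mult_single flip: single_add)

lemma single_eq_mon_val: "single m (1::complex) = mon_val mvar m"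
proof -
  have "single m (1::complex) =
      single (\<Sum>v\<in>keys m. single v (lookup m v)) 1"
    by (simp flip: poly_mapping_sum_singles)
  then show ?thesis
    by (simp add: single_sum_1 mon_val_def mvar_power)
qed

text \<open>Constants and variables generate the ring, so identities between homomorphisms or
  derivations need checking only there.\<close>

lemma mpoly_induct [case_names const var add mult]:
  assumes "\<And>c. P (mconst c)" "\<And>v. P (mvar v)"
    and "\<And>p q. P p \<Longrightarrow> P q \<Longrightarrow> P (p + q)" "\<And>p q. P p \<Longrightarrow> P q \<Longrightarrow> P (p * q)"
  shows "P p"
proof -
  have P0: "P 0" and P1: "P 1" using assms(1)[of 0] assms(1)[of 1] by auto
  have Psum: "P (\<Sum>x\<in>A. g x)" if "\<And>x. x \<in> A \<Longrightarrow> P (g x)" for A and g :: "'c \<Rightarrow> 'a mpoly"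
    using that by (induction A rule: infinite_finite_induct) (auto simp: P0 assms)
  have Pprod: "P (\<Prod>x\<in>A. g x)" if "\<And>x. x \<in> A \<Longrightarrow> P (g x)" for A and g :: "'c \<Rightarrow> 'a mpoly"
    using that by (induction A rule: infinite_finite_induct) (auto simp: P1 assms)
  have Ppow: "P (mvar v ^ k)" for v k
    by (induction k) (auto simp: P1 assms)
  have "P (\<Sum>m\<in>keys p. single m (lookup p m))"
    by (rule Psum, subst single_eq_const_mult, unfold single_eq_mon_val mon_val_def)
      (intro assms Pprod Ppow)
  then show ?thesis by (simp flip: poly_mapping_sum_singles)
qed

context
  fixes \<kappa> :: "complex \<Rightarrow> 'b::comm_ring_1"
  assumes \<kappa>: "comm_ring_hom \<kappa>"
begin

interpretation \<kappa>: comm_ring_hom \<kappa> by (rule \<kappa>)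

lemma msubst_superset:
  assumes "finite S" "keys p \<subseteq> S"
  shows "msubst \<kappa> \<phi> p = (\<Sum>m\<in>S. \<kappa> (lookup p m) * mon_val \<phi> m)"
  unfolding msubst_def using assms
  by (intro sum.mono_neutral_left) (auto simp: in_keys_iff)

lemma msubst_add: "msubst \<kappa> \<phi> (p + q) = msubst \<kappa> \<phi> p + msubst \<kappa> \<phi> q"
proof -
  let ?S = "keys p \<union> keys q"
  have "keys (p + q) \<subseteq> ?S" by (rule Poly_Mapping.keys_add)
  then show ?thesis
    by (simp add: msubst_superset[of ?S] lookup_add \<kappa>.hom_add ring_distribs sum.distrib)
qed

lemma msubst_single: "msubst \<kappa> \<phi> (single m c) = \<kappa> c * mon_val \<phi> m"
  by (simp add: msubst_superset[of "{m}"])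

lemma msubst_0: "msubst \<kappa> \<phi> 0 = 0"
  by (simp add: msubst_def)

lemma msubst_sum: "msubst \<kappa> \<phi> (\<Sum>x\<in>A. g x) = (\<Sum>x\<in>A. msubst \<kappa> \<phi> (g x))"
  by (induction A rule: infinite_finite_induct) (auto simp: msubst_0 msubst_add)

lemma msubst_mult: "msubst \<kappa> \<phi> (p * q) = msubst \<kappa> \<phi> p * msubst \<kappa> \<phi> q"
proof -
  have "p * q = (\<Sum>m\<in>keys p. single m (lookup p m)) *
      (\<Sum>m\<in>keys q. single m (lookup q m))"
    by (simp flip: poly_mapping_sum_singles)
  also have "\<dots> = (\<Sum>m\<in>keys p. \<Sum>m'\<in>keys q.
      single (m + m') (lookup p m * lookup q m'))"
    by (simp add: sum_product mult_single)
  finally have "msubst \<kappa> \<phi> (p * q) = (\<Sum>m\<in>keys p. \<Sum>m'\<in>keys q.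
      \<kappa> (lookup p m) * mon_val \<phi> m * (\<kappa> (lookup q m') * mon_val \<phi> m'))"
    by (simp add: msubst_sum msubst_single mon_val_add \<kappa>.hom_mult ac_simps)
  then show ?thesis
    by (simp add: msubst_def sum_product)
qed

lemma msubst_mconst: "msubst \<kappa> \<phi> (mconst c) = \<kappa> c"
  by (simp add: mconst_def msubst_single)

lemma msubst_mvar: "msubst \<kappa> \<phi> (mvar v) = \<phi> v"
  by (simp add: mvar_def msubst_single)

lemma comm_ring_hom_msubst: "comm_ring_hom (msubst \<kappa> \<phi>)"
  by unfold_locales (auto simp: msubst_add msubst_mult msubst_0 msubst_mconst simp flip: mconst_1)

end

lemma hom_msubst:
  assumes "comm_ring_hom \<kappa>" "comm_ring_hom h"
  shows "h (msubst \<kappa> \<phi> p) = msubst (h \<circ> \<kappa>) (h \<circ> \<phi>) p"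
proof -
  interpret h: comm_ring_hom h by (rule assms)
  have *: "comm_ring_hom (h \<circ> \<kappa>)"
  proof -
    interpret \<kappa>: comm_ring_hom \<kappa> by (rule assms)
    show ?thesis by unfold_locales (auto simp: \<kappa>.hom_add \<kappa>.hom_mult h.hom_add h.hom_mult)
  qed
  note * = *[unfolded comp_def]
  show ?thesis
    unfolding comp_def
    by (induction p rule: mpoly_induct)
      (simp_all add: msubst_add msubst_mult msubst_mconst msubst_mvar assms * h.hom_add h.hom_mult)
qed

lemma msubst_mconst_mvar: "msubst mconst mvar p = p"
  by (induction p rule: mpoly_induct)
    (simp_all add: msubst_add msubst_mult msubst_mconst msubst_mvar comm_ring_hom_mconst)

lemma eval_eq_msubst: "Defs.eval p a = msubst (\<lambda>c. c) a p"
  by (simp add: Defs.eval_def msubst_def mon_val_def)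

lemma comm_ring_hom_ident: "comm_ring_hom (\<lambda>c::complex. c)"
  by unfold_locales auto

lemma mon_val_cong: "(\<And>v. v \<in> keys m \<Longrightarrow> \<phi> v = \<psi> v) \<Longrightarrow> mon_val \<phi> m = mon_val \<psi> m"
  unfolding mon_val_def by (intro prod.cong) auto

lemma msubst_cong:
  assumes "\<And>v. v \<in> vars p \<Longrightarrow> \<phi> v = \<psi> v"
  shows "msubst \<kappa> \<phi> p = msubst \<kappa> \<psi> p"
  unfolding msubst_def using assms
  by (intro sum.cong refl arg_cong2[of _ _ _ _ "(*)"] mon_val_cong) (auto simp: vars_def)

lemma vars_add: "vars (p + q) \<subseteq> vars p \<union> vars q"
  using Poly_Mapping.keys_add[of p q] by (auto simp: vars_def)

lemma vars_mult: "vars (p * q) \<subseteq> vars p \<union> vars q"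
proof
  fix v assume "v \<in> vars (p * q)"
  then obtain m where m: "m \<in> keys (p * q)" "v \<in> keys m" by (auto simp: vars_def)
  then obtain a b where "m = a + b" "a \<in> keys p" "b \<in> keys q"
    using keys_mult[of p q] by auto
  then show "v \<in> vars p \<union> vars q"
    using m(2) Poly_Mapping.keys_add[of a b] by (auto simp: vars_def)
qed

lemma vars_mconst [simp]: "vars (mconst c) = {}"
  by (auto simp: vars_def mconst_def split: if_splits)

lemma vars_0 [simp]: "vars 0 = {}" and vars_1 [simp]: "vars 1 = {}"
  by (auto simp: vars_def)

lemma vars_mvar [simp]: "vars (mvar v) = {v}"
  by (auto simp: vars_def mvar_def)

lemma vars_sum_subset: "(\<And>x. x \<in> A \<Longrightarrow> vars (g x) \<subseteq> X) \<Longrightarrow> vars (\<Sum>x\<in>A. g x) \<subseteq> X"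
  by (induction A rule: infinite_finite_induct) (auto dest!: subsetD[OF vars_add])

text \<open>A derivation along a substitution is the coefficient of \<open>\<epsilon>\<close> of the substitution
  \<open>v \<mapsto> \<phi> v + \<epsilon> a v\<close>, so that the Leibniz rule is multiplicativity.\<close>

definition mderiv :: "(complex \<Rightarrow> 'b) \<Rightarrow> ('v \<Rightarrow> 'b) \<Rightarrow> ('v \<Rightarrow> 'b) \<Rightarrow> 'v mpoly \<Rightarrow> 'b::comm_ring_1" where
  "mderiv \<kappa> \<phi> a p = coeff (msubst (\<lambda>c. [:\<kappa> c:]) (\<lambda>v. [:\<phi> v, a v:]) p) 1"

lemma coeff_mult_1: "coeff (p * q) 1 = coeff p 0 * coeff q 1 + coeff p 1 * coeff q 0"
  for p q :: "'b::comm_ring_1 poly"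
  by (simp add: coeff_mult atMost_Suc)

context
  fixes \<kappa> :: "complex \<Rightarrow> 'b::comm_ring_1"
  assumes \<kappa>: "comm_ring_hom \<kappa>"
begin

interpretation \<kappa>: comm_ring_hom \<kappa> by (rule \<kappa>)

lemma comm_ring_hom_pCons: "comm_ring_hom (\<lambda>c. [:\<kappa> c:])"
  by unfold_locales (auto simp: \<kappa>.hom_add \<kappa>.hom_mult one_pCons)

lemma mderiv_coeff_0: "coeff (msubst (\<lambda>c. [:\<kappa> c:]) (\<lambda>v. [:\<phi> v, a v:]) p) 0 = msubst \<kappa> \<phi> p"
  by (induction p rule: mpoly_induct)
    (simp_all add: msubst_add msubst_mult msubst_mconst msubst_mvar \<kappa> comm_ring_hom_pCons coeff_mult)

lemma mderiv_add: "mderiv \<kappa> \<phi> a (p + q) = mderiv \<kappa> \<phi> a p + mderiv \<kappa> \<phi> a q"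
  by (simp add: mderiv_def msubst_add comm_ring_hom_pCons)

lemma mderiv_mult: "mderiv \<kappa> \<phi> a (p * q) = msubst \<kappa> \<phi> p * mderiv \<kappa> \<phi> a q + mderiv \<kappa> \<phi> a p * msubst \<kappa> \<phi> q"
  by (simp only: mderiv_def msubst_mult comm_ring_hom_pCons coeff_mult_1 mderiv_coeff_0)

lemma mderiv_mconst [simp]: "mderiv \<kappa> \<phi> a (mconst c) = 0"
  by (simp add: mderiv_def msubst_mconst comm_ring_hom_pCons)

lemma mderiv_mvar [simp]: "mderiv \<kappa> \<phi> a (mvar v) = a v"
  by (simp add: mderiv_def msubst_mvar comm_ring_hom_pCons)

lemma mderiv_0 [simp]: "mderiv \<kappa> \<phi> a 0 = 0"
  using mderiv_mconst[of \<phi> a 0] by simp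

end

section \<open>The total derivative of differential polynomials\<close>

lemma dderiv_superset:
  assumes "finite S" "keys p \<subseteq> S"
  shows "dderiv p = (\<Sum>m\<in>S. mconst (lookup p m) * deriv_monom m)"
  unfolding dderiv_def using assms
  by (intro sum.mono_neutral_left) (auto simp: in_keys_iff)

lemma dderiv_add: "dderiv (p + q) = dderiv p + dderiv q"
proof -
  let ?S = "keys p \<union> keys q"
  have "keys (p + q) \<subseteq> ?S" by (rule Poly_Mapping.keys_add)
  then show ?thesis
    by (simp add: dderiv_superset[of ?S] lookup_add mconst_add ring_distribs sum.distrib)
qed

lemma dderiv_single: "dderiv (single m c) = mconst c * deriv_monom m"
  by (simp add: dderiv_superset[of "{m}"])

lemma dderiv_sum: "dderiv (\<Sum>x\<in>A. g x) = (\<Sum>x\<in>A. dderiv (g x))"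
  by (induction A rule: infinite_finite_induct) (auto simp: dderiv_add dderiv_def[of 0])

lemma deriv_monom_superset:
  assumes "finite S" "keys m \<subseteq> S"
  shows "deriv_monom m = (\<Sum>v\<in>S. mmonom (m - single v 1 + single (dshift v) 1)
                                        (of_nat (lookup m v)))"
  unfolding deriv_monom_def using assms
  by (intro sum.mono_neutral_left) (auto simp: in_keys_iff mmonom_def)

text \<open>The Leibniz rule on monomials. Subtraction of \<open>single v 1\<close> is truncated, so
  the exponents match only where \<open>v\<close> occurs; elsewhere the coefficient
  \<open>lookup m v\<close> is zero.\<close>

lemma deriv_monom_add:
  "deriv_monom (m + m') = single m 1 * deriv_monom m' + deriv_monom m * single m' 1"
proof -
  let ?S = "keys m \<union> keys m'"
  have *: "keys (m + m') \<subseteq> ?S" by (rule Poly_Mapping.keys_add)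
  have cancel: "m + m' - single v 1 = m - single v 1 + m'"
    if "lookup m v > 0" for v and m m' :: "nat \<times> nat \<Rightarrow>\<^sub>0 nat"
    using that by (intro poly_mapping_eqI) (auto simp: lookup_add lookup_minus lookup_single when_def)
  have "mmonom (m + m' - single v 1 + single (dshift v) 1)
          (of_nat (lookup (m + m') v)) =
      single m 1 * mmonom (m' - single v 1 + single (dshift v) 1)
          (of_nat (lookup m' v)) +
      mmonom (m - single v 1 + single (dshift v) 1)
          (of_nat (lookup m v)) * single m' 1" for v
  proof -
    have 1: "mmonom (m + m' - single v 1 + d) (of_nat (lookup m v)) =
        mmonom (m - single v 1 + d) (of_nat (lookup m v)) * single m' 1"
      for m m' d :: "nat \<times> nat \<Rightarrow>\<^sub>0 nat"
    proof (cases "lookup m v = 0")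
      case False
      then have "m + m' - single v 1 + d = m - single v 1 + d + m'"
        using cancel[of m v m'] by (simp add: ac_simps)
      then show ?thesis by (simp add: mmonom_def mult_single del: One_nat_def)
    qed (simp add: mmonom_def)
    show ?thesis
      using 1[of m m' "single (dshift v) 1"] 1[of m' m "single (dshift v) 1"]
      by (simp add: lookup_add mmonom_def single_add ac_simps)
  qed
  then show ?thesis
    using * by (simp add: deriv_monom_superset[of ?S] sum_distrib_left sum_distrib_right sum.distrib)
qed

lemma dderiv_mult: "dderiv (p * q) = p * dderiv q + dderiv p * q"
proof -
  let ?s = "\<lambda>p m. single m (lookup p m)"
  have 1: "dderiv (single m a * single m' b) =
     single m a * dderiv (single m' b) +
     dderiv (single m a) * single m' b" for m m' a b
    unfolding mult_single dderiv_single deriv_monom_add mconst_mult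
    unfolding single_eq_const_mult[of m a] single_eq_const_mult[of m' b] by (simp add: algebra_simps)
  have "dderiv ((\<Sum>m\<in>keys p. ?s p m) * (\<Sum>m\<in>keys q. ?s q m)) =
     (\<Sum>m\<in>keys p. ?s p m) * dderiv (\<Sum>m\<in>keys q. ?s q m) +
     dderiv (\<Sum>m\<in>keys p. ?s p m) * (\<Sum>m\<in>keys q. ?s q m)"
    by (simp add: sum_product dderiv_sum 1 sum.distrib)
  then show ?thesis by (simp flip: poly_mapping_sum_singles)
qed

lemma dderiv_mconst [simp]: "dderiv (mconst c) = 0"
  unfolding mconst_def dderiv_single by (simp add: deriv_monom_def)

lemma dderiv_mvar [simp]: "dderiv (mvar v) = mvar (dshift v)"
  unfolding mvar_def dderiv_single by (simp add: deriv_monom_def mmonom_def)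

lemma dderivs_Suc: "dderivs (Suc k) p = dderivs k (dderiv p)"
  by (simp add: dderivs_def funpow_swap1)

lemma dderivs_0 [simp]: "dderivs 0 p = p"
  by (simp add: dderivs_def)

lemma vars_dderiv: "vars (dderiv p) \<subseteq> vars p \<union> dshift ` vars p"
proof -
  have "vars (mmonom (m - single v 1 + single (dshift v) 1) c) \<subseteq> vars p \<union> dshift ` vars p"
    if m: "m \<in> keys p" "v \<in> keys m" for m v c
  proof -
    have "keys (m - single v 1 + single (dshift v) 1)
        \<subseteq> keys m \<union> {dshift v}"
      by (auto simp: in_keys_iff lookup_add lookup_minus lookup_single when_def split: if_splits)
    then show ?thesis using m by (auto simp: vars_def mmonom_def split: if_splits)
  qed
  then show ?thesis
    unfolding dderiv_def deriv_monom_def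
    by (intro vars_sum_subset order_trans[OF vars_mult] Un_least) auto
qed

lemma vars_dderivs: "vars p \<subseteq> dvars n e \<Longrightarrow> vars (dderivs k p) \<subseteq> dvars n (e + k)"
proof (induction k arbitrary: p e)
  case (Suc k)
  have "dvars n e \<subseteq> dvars n (Suc e)" "dshift ` dvars n e \<subseteq> dvars n (Suc e)"
    by (auto simp: dvars_def dshift_def)
  then have "vars (dderiv p) \<subseteq> dvars n (Suc e)"
    using vars_dderiv[of p] Suc.prems by blast
  from Suc.IH[OF this] show ?case by (simp add: dderivs_Suc)
qed auto

subsection \<open>The Nullstellensatz over the complex numbers\<close>

text \<open>Gaussian elimination, one coordinate of \<open>B\<close> at a time: a vector
  \<open>a0\<close> with nonzero entry at \<open>b\<close> clears that entry in all others and is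
  given up.\<close>

lemma more_vectors_dependent:
  fixes w :: "'s \<Rightarrow> 'b \<Rightarrow> 'k::field"
  assumes "finite B" "finite S" "card S > card B"
  shows "\<exists>c. (\<exists>a\<in>S. c a \<noteq> 0) \<and> (\<forall>b\<in>B. (\<Sum>a\<in>S. c a * w a b) = 0)"
  using assms
proof (induction B arbitrary: S w rule: finite_induct)
  case empty
  then show ?case by (intro exI[of _ "\<lambda>_. 1"]) (auto simp: card_gt_0_iff)
next
  case (insert b B)
  show ?case
  proof (cases "\<forall>a\<in>S. w a b = 0")
    case True
    with insert.IH[of S w] insert show ?thesis by auto
  next
    case False
    then obtain a0 where a0: "a0 \<in> S" "w a0 b \<noteq> 0" by auto
    define w' where "w' a b' = w a b' - w a b / w a0 b * w a0 b'" for a b'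
    have "card (S - {a0}) > card B" using insert a0 by simp
    from insert.IH[OF _ this, of w'] insert obtain c where
      c: "\<exists>a\<in>S - {a0}. c a \<noteq> 0" "\<forall>b'\<in>B. (\<Sum>a\<in>S - {a0}. c a * w' a b') = 0" by auto
    define c' where "c' = c(a0 := - (\<Sum>a\<in>S - {a0}. c a * w a b) / w a0 b)"
    have split: "(\<Sum>a\<in>S. c' a * w a b') = c' a0 * w a0 b' + (\<Sum>a\<in>S - {a0}. c a * w a b')" for b'
      using a0 insert by (subst sum.remove[of _ a0]) (auto simp: c'_def intro!: sum.cong)
    have "(\<Sum>a\<in>S. c' a * w a b') = 0" if "b' \<in> B" for b'
    proof -
      have "(\<Sum>a\<in>S - {a0}. c a * w' a b') =
          (\<Sum>a\<in>S - {a0}. c a * w a b') - (\<Sum>a\<in>S - {a0}. c a * w a b) / w a0 b * w a0 b'"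
        by (simp add: w'_def right_diff_distrib sum_subtractf sum_divide_distrib sum_distrib_right mult.assoc)
      then show ?thesis using c(2) that unfolding split by (simp add: c'_def)
    qed
    moreover have "(\<Sum>a\<in>S. c' a * w a b) = 0"
      unfolding split using a0 by (simp add: c'_def)
    moreover have "\<exists>a\<in>S. c' a \<noteq> 0" using c(1) by (auto simp: c'_def)
    ultimately show ?thesis by (intro exI[of _ c']) auto
  qed
qed

section \<open>Ideals in the polynomials over a fixed set of variables\<close>

definition ideal_of :: "'v set \<Rightarrow> 'v mpoly set \<Rightarrow> bool" where
  "ideal_of V M \<longleftrightarrow> (\<forall>p\<in>M. vars p \<subseteq> V) \<and> 0 \<in> M \<and> (\<forall>p\<in>M. \<forall>q\<in>M. p + q \<in> M) \<and>
     (\<forall>p q. vars p \<subseteq> V \<longrightarrow> q \<in> M \<longrightarrow> p * q \<in> M)"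

lemma vars_mult_subset: "vars p \<subseteq> V \<Longrightarrow> vars q \<subseteq> V \<Longrightarrow> vars (p * q) \<subseteq> V"
  by (rule order_trans[OF vars_mult]) simp

lemma vars_add_subset: "vars p \<subseteq> V \<Longrightarrow> vars q \<subseteq> V \<Longrightarrow> vars (p + q) \<subseteq> V"
  by (rule order_trans[OF vars_add]) simp

lemma ideal_of_ideal_in:
  assumes "\<And>p. p \<in> S \<Longrightarrow> vars p \<subseteq> V"
  shows "ideal_of V (ideal_in V S)"
  unfolding ideal_of_def
proof (intro conjI ballI allI impI)
  fix p assume "p \<in> ideal_in V S"
  then obtain T g where "T \<subseteq> S" "\<forall>t\<in>T. vars (g t) \<subseteq> V" "p = (\<Sum>t\<in>T. g t * t)"
    by (auto simp: ideal_in_def)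
  then show "vars p \<subseteq> V"
    using assms by (simp add: subsetD vars_sum_subset vars_mult_subset)
next
  show "0 \<in> ideal_in V S" by (auto simp: ideal_in_def intro!: exI[of _ "{}"])
next
  fix p q assume "p \<in> ideal_in V S" "q \<in> ideal_in V S"
  then obtain T g T' g' where 1: "finite T" "T \<subseteq> S" "\<forall>t\<in>T. vars (g t) \<subseteq> V" "p = (\<Sum>t\<in>T. g t * t)"
    and 2: "finite T'" "T' \<subseteq> S" "\<forall>t\<in>T'. vars (g' t) \<subseteq> V" "q = (\<Sum>t\<in>T'. g' t * t)"
    by (auto simp: ideal_in_def)
  define h where "h t = (if t \<in> T then g t else 0) + (if t \<in> T' then g' t else 0)" for t
  have "p = (\<Sum>t\<in>T \<union> T'. (if t \<in> T then g t else 0) * t)"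
    unfolding 1(4) using 1 2 by (intro sum.mono_neutral_cong_left) auto
  moreover have "q = (\<Sum>t\<in>T \<union> T'. (if t \<in> T' then g' t else 0) * t)"
    unfolding 2(4) using 1 2 by (intro sum.mono_neutral_cong_left) auto
  ultimately have "p + q = (\<Sum>t\<in>T \<union> T'. h t * t)"
    by (simp add: h_def ring_distribs sum.distrib)
  moreover have "vars (h t) \<subseteq> V" if "t \<in> T \<union> T'" for t
    unfolding h_def using 1 2 by (intro vars_add_subset) auto
  ultimately show "p + q \<in> ideal_in V S"
    using 1 2 unfolding ideal_in_def mem_Collect_eq by (intro exI[of _ "T \<union> T'"] exI[of _ h]) simp
next
  fix p q assume p: "vars p \<subseteq> V" and "q \<in> ideal_in V S"
  then obtain T g where 1: "finite T" "T \<subseteq> S" "\<forall>t\<in>T. vars (g t) \<subseteq> V" "q = (\<Sum>t\<in>T. g t * t)"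
    by (auto simp: ideal_in_def)
  then show "p * q \<in> ideal_in V S"
    using p unfolding ideal_in_def mem_Collect_eq
    by (intro exI[of _ T] exI[of _ "\<lambda>t. p * g t"]) (simp add: sum_distrib_left mult.assoc vars_mult_subset)
qed

lemma generators_in_ideal_in: "p \<in> S \<Longrightarrow> p \<in> ideal_in V S"
  by (auto simp: ideal_in_def intro!: exI[of _ "{p}"] exI[of _ "\<lambda>_. 1"])

lemma ideal_of_sum:
  "ideal_of V M \<Longrightarrow> (\<And>x. x \<in> A \<Longrightarrow> g x \<in> M) \<Longrightarrow> (\<Sum>x\<in>A. g x) \<in> M"
  by (induction A rule: infinite_finite_induct) (auto simp: ideal_of_def)

lemma ideal_of_diff: "ideal_of V M \<Longrightarrow> p \<in> M \<Longrightarrow> q \<in> M \<Longrightarrow> p - q \<in> M"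
proof -
  assume *: "ideal_of V M" "p \<in> M" "q \<in> M"
  then have "mconst (-1) * q \<in> M" by (simp add: ideal_of_def)
  moreover have "mconst (-1) * q = - q" by (simp add: mconst_uminus)
  ultimately show ?thesis using * unfolding ideal_of_def by (metis diff_conv_add_uminus)
qed

lemma exists_maximal_ideal:
  assumes "ideal_of V J" "1 \<notin> J"
  obtains M where "ideal_of V M" "1 \<notin> M" "J \<subseteq> M"
    "\<And>I. ideal_of V I \<Longrightarrow> M \<subseteq> I \<Longrightarrow> 1 \<notin> I \<Longrightarrow> I = M"
proof -
  let ?A = "{I. ideal_of V I \<and> 1 \<notin> I \<and> J \<subseteq> I}"
  have "\<exists>M\<in>?A. \<forall>I\<in>?A. M \<subseteq> I \<longrightarrow> I = M"
  proof (rule subset_Zorn)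
    fix C assume C: "subset.chain ?A C"
    show "\<exists>U\<in>?A. \<forall>I\<in>C. I \<subseteq> U"
    proof (cases "C = {}")
      case True
      then show ?thesis using assms by auto
    next
      case False
      have CA: "I \<in> ?A" if "I \<in> C" for I using C that by (auto simp: subset.chain_def)
      have tot: "I \<subseteq> I' \<or> I' \<subseteq> I" if "I \<in> C" "I' \<in> C" for I I'
        using C that by (auto simp: subset.chain_def)
      have "ideal_of V (\<Union>C)"
        unfolding ideal_of_def
      proof (intro conjI ballI allI impI)
        fix p q assume "p \<in> \<Union>C" "q \<in> \<Union>C"
        then obtain I I' where "I \<in> C" "I' \<in> C" "p \<in> I" "q \<in> I'" by auto
        with tot[of I I'] obtain K where "K \<in> C" "p \<in> K" "q \<in> K" by auto
        with CA[of K] show "p + q \<in> \<Union>C" unfolding ideal_of_def by blast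
      qed (use CA False in \<open>fastforce simp: ideal_of_def\<close>)+
      then show ?thesis using CA False by (intro bexI[of _ "\<Union>C"]) auto
    qed
  qed
  then show ?thesis using that by auto
qed

text \<open>Maximality forces 1 into the ideal generated by \<open>M\<close> and
  \<open>p\<close>.\<close>

lemma maximal_ideal_inverse:
  assumes M: "ideal_of V M" "1 \<notin> M" "\<And>I. ideal_of V I \<Longrightarrow> M \<subseteq> I \<Longrightarrow> 1 \<notin> I \<Longrightarrow> I = M"
    and p: "vars p \<subseteq> V" "p \<notin> M"
  obtains u where "vars u \<subseteq> V" "u * p - 1 \<in> M"
proof -
  let ?I = "{u * p + m | u m. vars u \<subseteq> V \<and> m \<in> M}"
  have "ideal_of V ?I"
    unfolding ideal_of_def
  proof (intro conjI ballI allI impI)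
    fix q assume "q \<in> ?I"
    then obtain u m where "q = u * p + m" "vars u \<subseteq> V" "m \<in> M" by auto
    then show "vars q \<subseteq> V" using p M(1)
      by (simp add: ideal_of_def vars_add_subset vars_mult_subset)
  next
    show "0 \<in> ?I" using M(1) unfolding mem_Collect_eq ideal_of_def by (intro exI[of _ 0]) simp
  next
    fix q q' assume "q \<in> ?I" "q' \<in> ?I"
    then obtain u m u' m' where *: "q = u * p + m" "q' = u' * p + m'" "vars u \<subseteq> V" "vars u' \<subseteq> V"
      "m \<in> M" "m' \<in> M" by auto
    then have "q + q' = (u + u') * p + (m + m')" by (simp add: algebra_simps)
    moreover have "vars (u + u') \<subseteq> V" "m + m' \<in> M"
      using * M(1) by (simp_all add: ideal_of_def vars_add_subset)
    ultimately show "q + q' \<in> ?I" by blast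
  next
    fix r q assume r: "vars r \<subseteq> V" and "q \<in> ?I"
    then obtain u m where *: "q = u * p + m" "vars u \<subseteq> V" "m \<in> M" by auto
    then have "r * q = (r * u) * p + r * m" by (simp add: algebra_simps)
    moreover have "vars (r * u) \<subseteq> V" "r * m \<in> M"
      using * r M(1) by (simp_all add: ideal_of_def vars_mult_subset)
    ultimately show "r * q \<in> ?I" by blast
  qed
  moreover have "m \<in> ?I" if "m \<in> M" for m
    using that unfolding mem_Collect_eq by (intro exI[of _ 0] exI[of _ m]) simp
  then have "M \<subseteq> ?I" by blast
  moreover have "p \<in> ?I"
    using M(1) unfolding mem_Collect_eq ideal_of_def by (intro exI[of _ 1] exI[of _ 0]) simp
  ultimately have "1 \<in> ?I" using M(3)[of ?I] p(2) by blast
  then obtain u m where *: "1 = u * p + m" "vars u \<subseteq> V" "m \<in> M" by auto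
  then have "u * p - 1 = 0 - m" by (simp add: algebra_simps)
  with * M(1) ideal_of_diff[of V M 0 m] have "u * p - 1 \<in> M" by (auto simp: ideal_of_def)
  with * that show ?thesis by blast
qed

lemma finite_bounded_monomials:
  assumes "finite V"
  shows "finite {m :: 'v \<Rightarrow>\<^sub>0 nat. keys m \<subseteq> V \<and> (\<forall>v. lookup m v \<le> k)}"
proof (rule finite_imageD)
  show "finite (lookup ` {m :: 'v \<Rightarrow>\<^sub>0 nat. keys m \<subseteq> V \<and> (\<forall>v. lookup m v \<le> k)})"
    by (rule finite_subset[OF _ finite_set_of_finite_funs[of V "{..k}" 0]])
      (use assms in \<open>auto simp: in_keys_iff\<close>)
qed (auto simp: inj_on_def intro: poly_mapping_eqI)

definition cpoly :: "'v \<Rightarrow> complex poly \<Rightarrow> 'v mpoly" where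
  "cpoly v q = poly (map_poly mconst q) (mvar v)"

lemma comm_ring_hom_cpoly: "comm_ring_hom (cpoly v)"
proof -
  interpret comm_ring_hom "mconst :: complex \<Rightarrow> 'a mpoly" by (rule comm_ring_hom_mconst)
  interpret mp: map_poly_comm_ring_hom "mconst :: complex \<Rightarrow> 'a mpoly" ..
  show ?thesis by unfold_locales (auto simp: cpoly_def mp.hom_add mp.hom_mult)
qed

lemma cpoly_pCons: "cpoly v (pCons a q) = mconst a + mvar v * cpoly v q"
proof -
  interpret comm_ring_hom "mconst :: complex \<Rightarrow> 'a mpoly" by (rule comm_ring_hom_mconst)
  show ?thesis by (simp add: cpoly_def hom_distribs)
qed

lemma cpoly_0 [simp]: "cpoly v 0 = 0" by (simp add: cpoly_def)

lemma vars_cpoly: "vars (cpoly v q) \<subseteq> {v}"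
  by (induction q) (auto simp: cpoly_pCons dest!: subsetD[OF vars_add] subsetD[OF vars_mult])

text \<open>The cardinality proof of the Nullstellensatz. If no \<open>v - a\<close> lay in
  \<open>M\<close>, each would have an inverse \<open>U a\<close> modulo \<open>M\<close>. The
  polynomials in \<open>V\<close> are a countable union of finite-dimensional spaces, while there
  are uncountably many \<open>a\<close>, so some of these inverses are linearly dependent. Clearing
  denominators puts a nonzero univariate polynomial in \<open>v\<close> into \<open>M\<close>, which
  contradicts its splitting into invertible linear factors.\<close>

lemma maximal_ideal_linear_factor:
  assumes V: "finite V" "v \<in> V"
    and M: "ideal_of V M" "1 \<notin> M" "\<And>I. ideal_of V I \<Longrightarrow> M \<subseteq> I \<Longrightarrow> 1 \<notin> I \<Longrightarrow> I = M"
  shows "\<exists>a. mvar v - mconst a \<in> M"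
proof (rule ccontr)
  assume contra: "\<not> (\<exists>a. mvar v - mconst a \<in> M)"
  interpret cp: comm_ring_hom "cpoly v" by (rule comm_ring_hom_cpoly)
  have lin: "cpoly v [:- a, 1:] = mvar v - mconst a" for a
    by (simp add: cpoly_pCons mconst_uminus)
  have vlin: "vars (cpoly v q) \<subseteq> V" for q using vars_cpoly[of v q] V by auto
  have notM: "cpoly v q \<notin> M" if "q \<noteq> 0" for q
    using that
  proof (induction "degree q" arbitrary: q rule: less_induct)
    case less
    show ?case
    proof (cases "degree q = 0")
      case True
      then obtain c where c: "q = [:c:]" "c \<noteq> 0" using less.prems by (metis degree_eq_zeroE pCons_0_0)
      show ?thesis
      proof
        assume "cpoly v q \<in> M"
        then have "mconst (1 / c) * cpoly v q \<in> M" using M(1) by (simp add: ideal_of_def)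
        then show False using c M(2) by (simp add: cpoly_pCons flip: mconst_mult)
      qed
    next
      case False
      then obtain a where a: "poly q a = 0" using alg_closed_imp_poly_has_root[of q] by auto
      then obtain r where r: "q = [:- a, 1:] * r" by (metis dvdE poly_eq_0_iff_dvd)
      then have r0: "r \<noteq> 0" using less.prems by auto
      then have "degree q = degree [:- a, 1:] + degree r" unfolding r by (intro degree_mult_eq) auto
      then have "degree r < degree q" by simp
      then have IH: "cpoly v r \<notin> M" using less.hyps r0 by blast
      obtain u where u: "vars u \<subseteq> V" "u * cpoly v [:- a, 1:] - 1 \<in> M"
        using maximal_ideal_inverse[OF M vlin, of "[:- a, 1:]"] contra unfolding lin by metis
      show ?thesis
      proof
        assume "cpoly v q \<in> M"
        then have "u * cpoly v q \<in> M" using u M(1) by (simp add: ideal_of_def)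
        moreover have "cpoly v r * (u * cpoly v [:- a, 1:] - 1) \<in> M"
          using u(2) M(1) vlin by (simp add: ideal_of_def)
        ultimately have "u * cpoly v q - cpoly v r * (u * cpoly v [:- a, 1:] - 1) \<in> M"
          by (rule ideal_of_diff[OF M(1)])
        then have "cpoly v r \<in> M" unfolding r cp.hom_mult by (simp add: algebra_simps)
        with IH show False ..
      qed
    qed
  qed
  have "\<forall>a. \<exists>u. vars u \<subseteq> V \<and> u * cpoly v [:- a, 1:] - 1 \<in> M"
    using maximal_ideal_inverse[OF M vlin] notM by (metis one_neq_zero pCons_eq_0_iff)
  then obtain U where U: "\<And>a. vars (U a) \<subseteq> V" "\<And>a. U a * cpoly v [:- a, 1:] - 1 \<in> M" by metis
  define K where "K k = {m :: 'a \<Rightarrow>\<^sub>0 nat. keys m \<subseteq> V \<and> (\<forall>v. lookup m v \<le> k)}" for k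
  have finK: "finite (K k)" for k unfolding K_def by (rule finite_bounded_monomials[OF V(1)])
  have "\<exists>k. keys (U a) \<subseteq> K k" for a
  proof -
    have "\<exists>k. \<forall>v. lookup m v \<le> k" for m :: "'a \<Rightarrow>\<^sub>0 nat"
    proof -
      have "lookup m v \<le> Max (insert 0 (lookup m ` keys m))" for v
        by (cases "v \<in> keys m") (auto intro!: Max_ge simp: in_keys_iff)
      then show ?thesis by blast
    qed
    then obtain e where e: "\<And>(m :: 'a \<Rightarrow>\<^sub>0 nat) v. lookup m v \<le> (e m :: nat)" by metis
    let ?k = "Max (insert 0 (e ` keys (U a)))"
    have "lookup m v \<le> ?k" if "m \<in> keys (U a)" for m v
      using that by (intro order.trans[OF e] Max_ge) auto
    then show ?thesis using U(1)[of a] by (intro exI[of _ ?k]) (auto simp: K_def vars_def)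
  qed
  then have "(\<Union>k. {x::real. keys (U (of_real x)) \<subseteq> K k}) = UNIV" by auto
  then have cover: "(\<Union>k. {x::real. keys (U (of_real x)) \<subseteq> K k}) = UNIV" .
  have "\<exists>k. infinite {x::real. keys (U (of_real x)) \<subseteq> K k}"
  proof (rule ccontr)
    assume "\<not> ?thesis"
    then have fin: "finite {x::real. keys (U (of_real x)) \<subseteq> K k}" for k by simp
    have "countable (\<Union>k::nat. {x::real. keys (U (of_real x)) \<subseteq> K k})"
      by (rule countable_UN) (simp_all add: countable_finite[OF fin])
    then show False using uncountable_UNIV_real unfolding cover by blast
  qed
  then obtain k where inf: "infinite {x::real. keys (U (of_real x)) \<subseteq> K k}" by blast
  obtain S0 where S0: "S0 \<subseteq> {x::real. keys (U (of_real x)) \<subseteq> K k}" "finite S0" "card S0 = Suc (card (K k))"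
    using infinite_arbitrarily_large[OF inf] by blast
  define S where "S = complex_of_real ` S0"
  have S: "finite S" "card S > card (K k)" "\<And>a. a \<in> S \<Longrightarrow> keys (U a) \<subseteq> K k"
    using S0 by (auto simp: S_def card_image inj_on_def)
  obtain c where c: "\<exists>a\<in>S. c a \<noteq> 0" "\<forall>m\<in>K k. (\<Sum>a\<in>S. c a * lookup (U a) m) = 0"
    using more_vectors_dependent[OF finK S(1,2), of "\<lambda>a. lookup (U a)"] by blast
  have lookup_cm: "lookup (mconst c * p) m = c * lookup p m" for c p and m :: "'a \<Rightarrow>\<^sub>0 nat"
    by (simp add: mconst_def flip: mult_map_scale_conv_mult) (simp add: Poly_Mapping.map.rep_eq when_def)
  have zero: "(\<Sum>a\<in>S. mconst (c a) * U a) = 0"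
  proof (rule poly_mapping_eqI)
    fix m
    show "lookup (\<Sum>a\<in>S. mconst (c a) * U a) m = lookup 0 m"
    proof (cases "m \<in> K k")
      case True
      then show ?thesis using c(2) by (simp add: lookup_sum lookup_cm)
    next
      case False
      then have "\<And>a. a \<in> S \<Longrightarrow> lookup (U a) m = 0" using S(3) by (meson in_keys_iff subsetD)
      then show ?thesis by (simp add: lookup_sum lookup_cm)
    qed
  qed
  \<comment> \<open>The numerator of the sum of \<open>c a / (v - a)\<close>; at \<open>a0\<close>
    all summands but one vanish, so it is nonzero.\<close>
  define q where "q = (\<Sum>a\<in>S. smult (c a) (\<Prod>b\<in>S - {a}. [:- b, 1:]))"
  obtain a0 where a0: "a0 \<in> S" "c a0 \<noteq> 0" using c(1) by auto
  have "poly q a0 = c a0 * (\<Prod>b\<in>S - {a0}. a0 - b)"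
  proof -
    have "poly q a0 = (\<Sum>a\<in>S. c a * (\<Prod>b\<in>S - {a}. a0 - b))"
      by (simp add: q_def poly_sum poly_prod)
    also have "\<dots> = (\<Sum>a\<in>S. if a = a0 then c a0 * (\<Prod>b\<in>S - {a0}. a0 - b) else 0)"
      using a0 S(1) by (intro sum.cong) auto
    finally show ?thesis using a0 S(1) by simp
  qed
  then have "q \<noteq> 0" using a0 S(1) by auto
  then have "cpoly v q \<notin> M" by (rule notM)
  moreover have "cpoly v q \<in> M"
  proof -
    have sm: "smult x p = [:x:] * p" for x and p :: "complex poly" by simp
    have "cpoly v q = (\<Sum>a\<in>S. mconst (c a) * cpoly v (\<Prod>b\<in>S - {a}. [:- b, 1:]))"
      unfolding q_def cp.hom_sum by (simp only: sm cp.hom_mult) (simp add: cpoly_pCons)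
    \<comment> \<open>Subtracting the vanishing combination of the \<open>U a\<close> turns each
      summand into a multiple of \<open>U a * (v - a) - 1\<close>, an element of
      \<open>M\<close>.\<close>
    also have "\<dots> = (\<Sum>a\<in>S. mconst (c a) * cpoly v (\<Prod>b\<in>S - {a}. [:- b, 1:]))
        - (\<Sum>a\<in>S. mconst (c a) * U a) * cpoly v (\<Prod>b\<in>S. [:- b, 1:])" by (simp add: zero)
    also have "\<dots> = 0 - (\<Sum>a\<in>S. mconst (c a) * cpoly v (\<Prod>b\<in>S - {a}. [:- b, 1:]) * (U a * cpoly v [:- a, 1:] - 1))"
    proof -
      have "cpoly v (\<Prod>b\<in>S. [:- b, 1:]) = cpoly v [:- a, 1:] * cpoly v (\<Prod>b\<in>S - {a}. [:- b, 1:])" if "a \<in> S" for a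
        using prod.remove[OF S(1) that, of "\<lambda>b. [:- b, 1:]"] by (simp only: cp.hom_mult)
      then have "(\<Sum>a\<in>S. mconst (c a) * U a) * cpoly v (\<Prod>b\<in>S. [:- b, 1:]) =
         (\<Sum>a\<in>S. mconst (c a) * U a * (cpoly v [:- a, 1:] * cpoly v (\<Prod>b\<in>S - {a}. [:- b, 1:])))"
        unfolding sum_distrib_right by (intro sum.cong) auto
      then show ?thesis by (simp add: sum_subtractf algebra_simps)
    qed
    also have "\<dots> \<in> M"
    proof (intro ideal_of_diff[OF M(1)] ideal_of_sum[OF M(1)])
      show "0 \<in> M" using M(1) by (simp add: ideal_of_def)
      fix a
      have "vars (mconst (c a) * cpoly v (\<Prod>b\<in>S - {a}. [:- b, 1:])) \<subseteq> V"
        by (rule vars_mult_subset) (simp_all only: vars_mconst empty_subsetI vlin)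
      then show "mconst (c a) * cpoly v (\<Prod>b\<in>S - {a}. [:- b, 1:]) * (U a * cpoly v [:- a, 1:] - 1) \<in> M"
        using M(1) U(2)[of a] unfolding ideal_of_def by blast
    qed
    finally show ?thesis .
  qed
  ultimately show False by contradiction
qed

text \<open>Modulo a maximal ideal above \<open>S\<close> each variable is congruent to a constant,
  hence each polynomial to its value at the point \<open>a\<close>; a constant lying in a proper
  ideal is zero.\<close>

theorem weak_nullstellensatz:
  fixes S :: "'v mpoly set"
  assumes V: "finite V" and S: "\<And>p. p \<in> S \<Longrightarrow> vars p \<subseteq> V" and 1: "1 \<notin> ideal_in V S"
  obtains a where "\<And>p. p \<in> S \<Longrightarrow> Defs.eval p a = 0"
proof -
  obtain M where M: "ideal_of V M" "1 \<notin> M" "ideal_in V S \<subseteq> M"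
    "\<And>I. ideal_of V I \<Longrightarrow> M \<subseteq> I \<Longrightarrow> 1 \<notin> I \<Longrightarrow> I = M"
    using exists_maximal_ideal[OF ideal_of_ideal_in[OF S] 1] by blast
  have "\<forall>v\<in>V. \<exists>a. mvar v - mconst a \<in> M"
    using maximal_ideal_linear_factor[OF V _ M(1,2,4)] by blast
  then obtain a where a: "\<And>v. v \<in> V \<Longrightarrow> mvar v - mconst (a v) \<in> M" by metis
  interpret cm: comm_ring_hom "mconst :: complex \<Rightarrow> 'v mpoly" by (rule comm_ring_hom_mconst)
  have mon: "mon_val mvar m - mconst (mon_val a m) \<in> M" if "keys m \<subseteq> V" for m
  proof -
    have pow: "mvar v ^ k - mconst (a v ^ k) \<in> M" if v: "v \<in> V" for v k
    proof (induction k)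
      case 0
      then show ?case using M(1) by (simp add: ideal_of_def)
    next
      case (Suc k)
      have "mvar v ^ Suc k - mconst (a v ^ Suc k) =
          mvar v * (mvar v ^ k - mconst (a v ^ k)) + mconst (a v ^ k) * (mvar v - mconst (a v))"
        by (simp add: mconst_mult algebra_simps)
      moreover have "\<dots> \<in> M" using M(1) Suc.IH a[OF v] v by (simp add: ideal_of_def)
      ultimately show ?case by simp
    qed
    have "(\<Prod>v\<in>W. mvar v ^ lookup m v) - mconst (\<Prod>v\<in>W. a v ^ lookup m v) \<in> M"
      if "finite W" "W \<subseteq> V" for W
      using that
    proof (induction W rule: finite_induct)
      case empty
      then show ?case using M(1) by (simp add: ideal_of_def)
    next
      case (insert v W)
      let ?p = "\<Prod>v\<in>W. mvar v ^ lookup m v" and ?q = "\<Prod>v\<in>W. a v ^ lookup m v"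
      let ?k = "lookup m v"
      have "vars (mvar v ^ ?k) \<subseteq> V"
        using insert.prems by (induction ?k) (auto simp: mvar_power vars_def split: if_splits)
      then have "mvar v ^ ?k * (?p - mconst ?q) + mconst ?q * (mvar v ^ ?k - mconst (a v ^ ?k)) \<in> M"
        using M(1) insert pow[of v ?k] by (simp add: ideal_of_def)
      moreover have "mvar v ^ ?k * (?p - mconst ?q) + mconst ?q * (mvar v ^ ?k - mconst (a v ^ ?k)) =
          mvar v ^ ?k * ?p - mconst (a v ^ ?k * ?q)"
        by (simp add: mconst_mult algebra_simps)
      ultimately show ?case using insert by simp
    qed
    then show ?thesis using that by (simp add: mon_val_def)
  qed
  have eval_M: "p - mconst (Defs.eval p a) \<in> M" if p: "vars p \<subseteq> V" for p
  proof -
    have "p = (\<Sum>m\<in>keys p. mconst (lookup p m) * mon_val mvar m)"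
      by (subst poly_mapping_sum_singles[of p]) (simp add: single_eq_const_mult[of _ "lookup p _"] single_eq_mon_val)
    moreover have "(mconst (Defs.eval p a) :: 'v mpoly) =
        (\<Sum>m\<in>keys p. mconst (lookup p m) * mconst (mon_val a m))"
      by (simp add: eval_eq_msubst msubst_def cm.hom_sum mconst_mult)
    ultimately have "p - mconst (Defs.eval p a) =
        (\<Sum>m\<in>keys p. mconst (lookup p m) * (mon_val mvar m - mconst (mon_val a m)))"
      by (simp add: right_diff_distrib sum_subtractf)
    moreover have "\<dots> \<in> M"
    proof (rule ideal_of_sum[OF M(1)])
      fix m assume "m \<in> keys p"
      then have "mon_val mvar m - mconst (mon_val a m) \<in> M" using p by (intro mon) (auto simp: vars_def)
      then show "mconst (lookup p m) * (mon_val mvar m - mconst (mon_val a m)) \<in> M"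
        using M(1) by (simp add: ideal_of_def)
    qed
    ultimately show ?thesis by simp
  qed
  show ?thesis
  proof (rule that)
    fix p assume p: "p \<in> S"
    then have "p \<in> M" using M(3) generators_in_ideal_in by blast
    then have "p - (p - mconst (Defs.eval p a)) \<in> M" using eval_M S[OF p] ideal_of_diff[OF M(1)] by blast
    then have "mconst (1 / Defs.eval p a) * mconst (Defs.eval p a) \<in> M"
      using M(1) by (simp add: ideal_of_def)
    then show "Defs.eval p a = 0" using M(2) by (cases "Defs.eval p a = 0") (auto simp flip: mconst_mult)
  qed
qed

subsection \<open>Univariate elimination with degree bounds\<close>

text \<open>Linear factors of \<open>p\<close> are split off one at a time; absence of common roots
  takes the place of coprimality.\<close>

lemma dvd_cancel_no_common_root:
  fixes p z b :: "'o::alg_closed_field poly"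
  assumes "p \<noteq> 0" "\<And>x. poly p x = 0 \<Longrightarrow> poly z x \<noteq> 0" "p dvd b * z"
  shows "p dvd b"
  using assms
proof (induction "degree p" arbitrary: p b rule: less_induct)
  case less
  show ?case
  proof (cases "degree p = 0")
    case True
    then show ?thesis using less.prems(1) by (metis is_unit_iff_degree unit_imp_dvd)
  next
    case False
    then obtain x where x: "poly p x = 0" using alg_closed_imp_poly_has_root[of p] by auto
    then obtain p' where p': "p = [:- x, 1:] * p'" by (metis dvdE poly_eq_0_iff_dvd)
    then have p'0: "p' \<noteq> 0" using less.prems by auto
    then have "degree p = degree [:- x, 1:] + degree p'" unfolding p' by (intro degree_mult_eq) auto
    then have deg: "degree p' < degree p" by simp
    have "poly (b * z) x = 0" using less.prems(3) x by (metis dvdE mult_eq_0_iff poly_mult)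
    then have "poly b x = 0" using less.prems(2)[OF x] by simp
    then obtain b' where b': "b = [:- x, 1:] * b'" by (metis dvdE poly_eq_0_iff_dvd)
    have "[:- x, 1:] * p' dvd [:- x, 1:] * (b' * z)"
      using less.prems(3) by (simp only: p' b' mult.assoc)
    then have "p' dvd b' * z" by (subst (asm) dvd_mult_cancel_left) auto
    moreover have "poly z y \<noteq> 0" if "poly p' y = 0" for y
      using that less.prems(2)[of y] by (simp add: p')
    ultimately have "p' dvd b'" using less.hyps[OF deg p'0] by blast
    then show ?thesis unfolding p' b' by (rule mult_dvd_mono[OF dvd_refl])
  qed
qed

text \<open>Each linear factor of \<open>p\<close> divides \<open>w\<close>, and there are
  \<open>degree p\<close> of them. This turns an inclusion of root sets into an identity along which
  orders of vanishing can be transferred.\<close>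

lemma dvd_power_if_roots_subset:
  fixes p w :: "'o::alg_closed_field poly"
  assumes "p \<noteq> 0" "\<And>x. poly p x = 0 \<Longrightarrow> poly w x = 0"
  shows "p dvd w ^ degree p"
  using assms
proof (induction "degree p" arbitrary: p rule: less_induct)
  case less
  show ?case
  proof (cases "degree p = 0")
    case True
    then show ?thesis using less.prems(1) by (metis is_unit_iff_degree unit_imp_dvd)
  next
    case False
    then obtain x where x: "poly p x = 0" using alg_closed_imp_poly_has_root[of p] by auto
    then obtain p' where p': "p = [:- x, 1:] * p'" by (metis dvdE poly_eq_0_iff_dvd)
    then have p'0: "p' \<noteq> 0" using less.prems by auto
    then have "degree p = degree [:- x, 1:] + degree p'" unfolding p' by (intro degree_mult_eq) auto
    then have deg: "degree p = Suc (degree p')" by simp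
    have "p' dvd w ^ degree p'"
      using less.hyps[of p'] less.prems(2) p'0 deg by (simp add: p')
    moreover have "[:- x, 1:] dvd w" using less.prems(2)[OF x] by (simp add: poly_eq_0_iff_dvd)
    ultimately have "[:- x, 1:] * p' dvd w * w ^ degree p'" by (intro mult_dvd_mono)
    then have "p dvd w * w ^ degree p'" by (simp only: p')
    then show ?thesis by (simp only: deg power_Suc)
  qed
qed

section \<open>Newton identities and Vandermonde determinants\<close>

lemma poly_eq_0_if_many_roots:
  fixes p :: "'o::idom poly"
  assumes "finite S" "\<And>x. x \<in> S \<Longrightarrow> poly p x = 0" "degree p < card S"
  shows "p = 0"
proof (rule ccontr)
  assume p: "p \<noteq> 0"
  have "card S \<le> card {x. poly p x = 0}"
    using assms p by (intro card_mono poly_roots_finite) auto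
  also have "\<dots> \<le> degree p" using p by (rule card_poly_roots_bound)
  finally show False using assms by simp
qed

text \<open>Horner's rule: dividing by T - x produces the tails of \<open>P\<close> evaluated at
  \<open>x\<close>.\<close>

lemma coeff_linear_factor:
  fixes B :: "'o::comm_ring_1 poly"
  assumes P: "P = [:- x, 1:] * B" and D: "degree B < D"
  shows "coeff B m = (\<Sum>j = Suc m..D. coeff P j * x ^ (j - Suc m))"
proof -
  have c: "coeff P (Suc j) = coeff B j - x * coeff B (Suc j)" for j
    unfolding P by simp
  have "(\<Sum>j = Suc m..D'. coeff P j * x ^ (j - Suc m)) = coeff B m - x ^ (D' - m) * coeff B D'" if "m \<le> D'" for D'
    using that
  proof (induction D' rule: dec_induct)
    case (step k)
    have "(\<Sum>j = Suc m..Suc k. coeff P j * x ^ (j - Suc m)) =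
        (\<Sum>j = Suc m..k. coeff P j * x ^ (j - Suc m)) + coeff P (Suc k) * x ^ (Suc k - Suc m)"
      using step by (simp add: sum.cl_ivl_Suc)
    with step show ?case by (simp add: c algebra_simps Suc_diff_le)
  qed simp
  moreover have "coeff B D = 0" using D by (rule coeff_eq_0)
  moreover have "coeff B m = 0" if "\<not> m \<le> D" using that D by (intro coeff_eq_0) simp
  ultimately show ?thesis by (cases "m \<le> D") auto
qed

text \<open>The derivative of the product is the sum of its quotients by the linear factors, and
  \<open>coeff_linear_factor\<close> expands each quotient in powers of its root. These are Newton's
  identities in division-free form.\<close>

lemma newton_identity:
  fixes \<alpha> :: "nat \<Rightarrow> 'o::idom"
  assumes q: "q = smult c (\<Prod>i<t. [:- \<alpha> i, 1:])"
  shows "of_nat (Suc m) * coeff q (Suc m) = (\<Sum>j = Suc m..t. coeff q j * (\<Sum>i<t. \<alpha> i ^ (j - Suc m)))"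
proof -
  let ?P = "\<Prod>i<t. [:- \<alpha> i, 1:]"
  have deg: "degree (\<Prod>i\<in>I. [:- \<alpha> i, 1:]) \<le> card I" if "finite I" for I
    using that
  proof (induction I rule: finite_induct)
    case (insert i I)
    have "degree ([:- \<alpha> i, 1:] * (\<Prod>i\<in>I. [:- \<alpha> i, 1:])) \<le> degree [:- \<alpha> i, 1:] + degree (\<Prod>i\<in>I. [:- \<alpha> i, 1:])"
      by (rule degree_mult_le)
    then show ?case using insert by simp
  qed simp
  have "of_nat (Suc m) * coeff ?P (Suc m) = coeff (pderiv ?P) m" by (simp add: coeff_pderiv)
  also have "\<dots> = (\<Sum>i<t. coeff (\<Prod>j\<in>{..<t} - {i}. [:- \<alpha> j, 1:]) m)"
    by (simp add: pderiv_prod coeff_sum pderiv_pCons)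
  also have "\<dots> = (\<Sum>i<t. \<Sum>j = Suc m..t. coeff ?P j * \<alpha> i ^ (j - Suc m))"
  proof (rule sum.cong[OF refl])
    fix i assume i: "i \<in> {..<t}"
    have "degree (\<Prod>j\<in>{..<t} - {i}. [:- \<alpha> j, 1:]) < t"
      using deg[of "{..<t} - {i}"] i by auto
    moreover have "?P = [:- \<alpha> i, 1:] * (\<Prod>j\<in>{..<t} - {i}. [:- \<alpha> j, 1:])"
      using i by (intro prod.remove) auto
    ultimately show "coeff (\<Prod>j\<in>{..<t} - {i}. [:- \<alpha> j, 1:]) m = (\<Sum>j = Suc m..t. coeff ?P j * \<alpha> i ^ (j - Suc m))"
      by (intro coeff_linear_factor)
  qed
  also have "\<dots> = (\<Sum>j = Suc m..t. coeff ?P j * (\<Sum>i<t. \<alpha> i ^ (j - Suc m)))"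
    by (subst sum.swap) (simp add: sum_distrib_left)
  finally show ?thesis unfolding q by (simp add: sum_distrib_left mult.assoc mult.left_commute)
qed

lemma alg_closed_factorization:
  fixes q :: "'o::alg_closed_field poly"
  assumes "q \<noteq> 0"
  obtains \<alpha> where "q = smult (lead_coeff q) (\<Prod>i<degree q. [:- \<alpha> i, 1:])"
proof -
  obtain A where A: "size A = degree q" "q = smult (lead_coeff q) (\<Prod>x\<in>#A. [:- x, 1:])"
    using alg_closed_imp_factorization[OF assms] by blast
  obtain xs where xs: "A = mset xs" by (metis ex_mset)
  have "(\<Prod>x\<in>#A. [:- x, 1:]) = prod_list (map (\<lambda>x. [:- x, 1:]) xs)"
    unfolding xs by (simp flip: prod_mset_prod_list)
  also have "\<dots> = (\<Prod>i<length xs. [:- (xs ! i), 1:])"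
    by (subst prod.list_conv_set_nth) (simp add: atLeast0LessThan)
  finally show ?thesis using that[of "\<lambda>i. xs ! i"] A xs by simp
qed

text \<open>A kernel vector is the coefficient list of a polynomial of degree below \<open>n\<close>
  with \<open>n\<close> distinct roots.\<close>

lemma det_vandermonde_nonzero:
  fixes x :: "nat \<Rightarrow> 'o::idom"
  assumes "inj_on x {..<n}"
  shows "det (mat n n (\<lambda>(l, j). x l ^ j)) \<noteq> 0"
proof
  let ?A = "mat n n (\<lambda>(l, j). x l ^ j)"
  assume "det ?A = 0"
  then obtain v where v: "v \<in> carrier_vec n" "v \<noteq> 0\<^sub>v n" "?A *\<^sub>v v = 0\<^sub>v n"
    using det_0_iff_vec_prod_zero[of ?A n] by auto
  define f where "f = (\<Sum>j<n. monom (v $ j) j)"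
  have "poly f (x l) = 0" if l: "l < n" for l
  proof -
    have "0 = (?A *\<^sub>v v) $ l" using v l by simp
    also have "\<dots> = (\<Sum>j<n. x l ^ j * v $ j)"
      using l v(1) by (simp add: scalar_prod_def atLeast0LessThan)
    finally show ?thesis by (simp add: f_def poly_sum poly_monom mult.commute)
  qed
  moreover have "degree f < n" if "n > 0"
    using that unfolding f_def
    by (intro le_less_trans[OF degree_sum_le[where n = "n - 1"]]) (auto intro: order.trans[OF degree_monom_le])
  moreover have "card (x ` {..<n}) = n" using assms by (simp add: card_image)
  ultimately have "f = 0 \<or> n = 0"
    using poly_eq_0_if_many_roots[of "x ` {..<n}" f] by fastforce
  moreover have "coeff f j = v $ j" if "j < n" for j
    using that by (simp add: f_def coeff_sum)
  ultimately have "v $ j = 0" if "j < n" for j using that by auto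
  then have "v = 0\<^sub>v n" using v(1) by (intro eq_vecI) auto
  with v show False by simp
qed

section \<open>Filtered rings and elimination with degree bounds\<close>

locale filtration =
  fixes dg :: "nat \<Rightarrow> 'a::comm_ring_1 \<Rightarrow> bool"
  assumes dg_zero: "dg k 0" and dg_one: "dg 0 1"
    and dg_add: "dg k a \<Longrightarrow> dg k b \<Longrightarrow> dg k (a + b)"
    and dg_uminus: "dg k a \<Longrightarrow> dg k (- a)"
    and dg_mult: "dg k a \<Longrightarrow> dg l b \<Longrightarrow> dg (k + l) (a * b)"
    and dg_mono: "dg k a \<Longrightarrow> k \<le> l \<Longrightarrow> dg l a"
begin

lemma dg_diff: "dg k a \<Longrightarrow> dg k b \<Longrightarrow> dg k (a - b)"
  using dg_add[of k a "- b"] dg_uminus by simp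

lemma dg_sum: "(\<And>x. x \<in> A \<Longrightarrow> dg k (g x)) \<Longrightarrow> dg k (\<Sum>x\<in>A. g x)"
  by (induction A rule: infinite_finite_induct) (auto simp: dg_zero dg_add)

lemma dg_prod: "(\<And>x. x \<in> A \<Longrightarrow> dg (d x) (g x)) \<Longrightarrow> dg (\<Sum>x\<in>A. d x) (\<Prod>x\<in>A. g x)"
  by (induction A rule: infinite_finite_induct) (auto simp: dg_one dg_mult)

lemma dg_power: "dg k a \<Longrightarrow> dg (n * k) (a ^ n)"
  by (induction n) (auto simp: dg_one dg_mult)

lemma dg_of_nat: "dg 0 (of_nat n)"
  by (induction n) (auto simp: dg_zero dg_one dg_add)

lemma dg_mult_0: "dg 0 a \<Longrightarrow> dg k b \<Longrightarrow> dg k (a * b)"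
  using dg_mult[of 0 a k b] by simp

lemma dg_det:
  assumes A: "A \<in> carrier_mat n n" and "\<And>i j. i < n \<Longrightarrow> j < n \<Longrightarrow> dg k (A $$ (i, j))"
  shows "dg (n * k) (det A)"
  unfolding det_def'[OF A]
proof (rule dg_sum)
  fix p assume "p \<in> {p. p permutes {0..<n}}"
  then have "dg (\<Sum>i = 0..<n. k) (\<Prod>i = 0..<n. A $$ (i, p i))"
    using assms(2) by (intro dg_prod) (auto simp: permutes_in_image)
  then show "dg (n * k) (signof p * (\<Prod>i = 0..<n. A $$ (i, p i)))"
    by (intro dg_mult_0) (auto simp: sign_def dg_one intro: dg_uminus)
qed

text \<open>The degree in the main variable and the degrees of the coefficients share one bound, so
  that each elimination has a single number as its size.\<close>

definition dgp :: "nat \<Rightarrow> 'a poly \<Rightarrow> bool" where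
  "dgp k q \<longleftrightarrow> degree q \<le> k \<and> (\<forall>i. dg k (coeff q i))"

end

text \<open>Roots live in \<open>'o\<close>, while degrees are measured in \<open>'a\<close>, to
  which symmetric functions of the roots return. \<open>char_0\<close> keeps the multiplicities of
  roots from vanishing as elements of \<open>'o\<close>.\<close>

locale graded_embedding = filtration dg + h: inj_comm_ring_hom h
  for dg :: "nat \<Rightarrow> 'a::idom \<Rightarrow> bool" and h :: "'a \<Rightarrow> 'o::alg_closed_field" +
  assumes char_0: "k > 0 \<Longrightarrow> of_nat k \<noteq> (0 :: 'o)"
begin

abbreviation hp :: "'a poly \<Rightarrow> 'o poly" where "hp \<equiv> map_poly h"

lemma infinite_closure: "infinite (UNIV :: 'o set)"
proof -
  have "inj (of_nat :: nat \<Rightarrow> 'o)"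
  proof (rule linorder_injI)
    fix a b :: nat assume "a < b"
    then have "of_nat b - of_nat a = (of_nat (b - a) :: 'o)" by (simp add: of_nat_diff)
    then show "of_nat a \<noteq> (of_nat b :: 'o)" using char_0[of "b - a"] \<open>a < b\<close> by auto
  qed
  then show ?thesis using infinite_iff_countable_subset[of "UNIV :: 'o set"] by blast
qed

text \<open>The element \<open>n\<close> is the resultant, the determinant of the Sylvester matrix
  \<open>S\<close>. A kernel vector of the transpose is a relation \<open>a * Q + b * z = 0\<close>
  with \<open>b\<close> of smaller degree than \<open>Q\<close>; as no root is shared,
  \<open>Q\<close> divides \<open>b\<close>, so both vanish. The bound is the matrix size, at most
  \<open>2 * k\<close>, times the entry degree \<open>k\<close>.\<close>

lemma bounded_elimination:
  assumes Q: "degree Q > 0" "dgp k Q" and z: "dgp k z"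
    and no_common: "\<And>x. poly (hp Q) x = 0 \<Longrightarrow> poly (hp z) x \<noteq> 0"
  obtains n A B where "n \<noteq> 0" "dg (2 * k * k) n" "[:n:] = A * Q + B * z"
proof -
  interpret hp: map_poly_inj_comm_ring_hom h ..
  define m where "m = degree Q"
  define d where "d = degree z"
  define row where "row i = (if i < d then monom 1 i * Q else monom 1 (i - d) * z)" for i
  define S where "S = mat (m + d) (m + d) (\<lambda>(i, j). coeff (row i) j)"
  have S: "S \<in> carrier_mat (m + d) (m + d)" by (simp add: S_def)
  have z0: "z \<noteq> 0"
  proof -
    have "degree (hp Q) > 0" using Q by simp
    then obtain x where "poly (hp Q) x = 0" using alg_closed_imp_poly_has_root by blast
    with no_common show ?thesis by auto
  qed
  have deg_row: "degree (row i) < m + d" if "i < m + d" for i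
  proof (cases "i < d")
    case True
    then have "degree (row i) \<le> i + m"
      using degree_mult_le[of "monom 1 i" Q] by (simp add: row_def m_def degree_monom_eq)
    then show ?thesis using True by simp
  next
    case False
    then have "degree (row i) \<le> i - d + d"
      using degree_mult_le[of "monom 1 (i - d)" z] by (simp add: row_def d_def degree_monom_eq)
    then show ?thesis using False that by simp
  qed
  have row_expand: "row i = (\<Sum>j<m + d. monom (S $$ (i, j)) j)" if "i < m + d" for i
  proof -
    have "row i = (\<Sum>j\<le>degree (row i). monom (coeff (row i) j) j)" by (simp add: poly_as_sum_of_monoms)
    also have "\<dots> = (\<Sum>j<m + d. monom (coeff (row i) j) j)"
      using deg_row[OF that] by (intro sum.mono_neutral_left) (auto simp: coeff_eq_0)
    finally show ?thesis using that by (simp add: S_def)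
  qed
  have nz: "det S \<noteq> 0"
  proof
    assume "det S = 0"
    then have "det (transpose_mat S) = 0" using det_transpose[OF S] by simp
    then obtain v where v: "v \<in> carrier_vec (m + d)" "v \<noteq> 0\<^sub>v (m + d)" "transpose_mat S *\<^sub>v v = 0\<^sub>v (m + d)"
      using det_0_iff_vec_prod_zero[of "transpose_mat S" "m + d"] S by auto
    have col: "(\<Sum>i<m + d. v $ i * S $$ (i, j)) = 0" if j: "j < m + d" for j
    proof -
      have "0 = (transpose_mat S *\<^sub>v v) $ j" using v j by simp
      also have "\<dots> = (\<Sum>i<m + d. v $ i * S $$ (i, j))"
        using j v(1) S by (simp add: scalar_prod_def atLeast0LessThan mult.commute)
      finally show ?thesis by simp
    qed
    define a where "a = (\<Sum>i<d. monom (v $ i) i)"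
    define b where "b = (\<Sum>i<m. monom (v $ (d + i)) i)"
    have sm: "monom x i * q = smult x (monom 1 i * q)" for x i and q :: "'a poly"
      by (metis mult.right_neutral mult_smult_left smult_monom)
    have "a * Q + b * z = (\<Sum>i<d. smult (v $ i) (row i)) + (\<Sum>i<m. smult (v $ (d + i)) (row (d + i)))"
      unfolding a_def b_def sum_distrib_right
      by (subst (1 2) sm) (simp add: row_def)
    also have "\<dots> = (\<Sum>i<m + d. smult (v $ i) (row i))"
    proof -
      have "(\<Sum>i<m. g (d + i)) = (\<Sum>i\<in>{d..<m + d}. g i)" for g :: "nat \<Rightarrow> 'a poly"
        by (rule sum.reindex_bij_witness[of _ "\<lambda>i. i - d" "\<lambda>i. d + i"]) auto
      moreover have "{..<m + d} = {..<d} \<union> {d..<m + d}" by auto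
      ultimately show ?thesis by (simp add: sum.union_disjoint ivl_disj_int)
    qed
    also have "\<dots> = (\<Sum>i<m + d. \<Sum>j<m + d. monom (v $ i * S $$ (i, j)) j)"
      by (intro sum.cong refl, subst row_expand) (auto simp: smult_sum2 smult_monom)
    also have "\<dots> = (\<Sum>j<m + d. monom (\<Sum>i<m + d. v $ i * S $$ (i, j)) j)"
      by (subst sum.swap) (simp add: monom_sum)
    also have "\<dots> = 0" using col by simp
    finally have ab: "a * Q + b * z = 0" .
    have "hp a * hp Q + hp b * hp z = 0"
      using arg_cong[OF ab, of hp] by (simp add: hp.hom_add hp.hom_mult)
    then have "hp b * hp z = hp Q * (- hp a)" by (simp add: add_eq_0_iff2 mult.commute)
    then have "hp Q dvd hp b * hp z" by (rule dvdI)
    moreover have "hp Q \<noteq> 0" using Q(1) by auto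
    ultimately have dvd: "hp Q dvd hp b"
      using no_common dvd_cancel_no_common_root[of "hp Q" "hp z" "hp b"] by blast
    have "degree b < m" unfolding b_def using Q
      by (intro le_less_trans[OF degree_sum_le[where n = "m - 1"]])
        (auto intro: order.trans[OF degree_monom_le] simp: m_def)
    then have b0: "b = 0"
      using dvd_imp_degree_le[OF dvd] by (auto simp: m_def)
    then have "a = 0" using ab Q by auto
    have "v $ i = 0" if "i < m + d" for i
    proof (cases "i < d")
      case True
      then have "v $ i = coeff a i" by (simp add: a_def coeff_sum)
      then show ?thesis by (simp add: \<open>a = 0\<close>)
    next
      case False
      then have "v $ i = coeff b (i - d)" using that by (simp add: b_def coeff_sum)
      then show ?thesis by (simp add: b0)
    qed
    then have "v = 0\<^sub>v (m + d)" using v(1) by (intro eq_vecI) auto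
    with v show False by simp
  qed
  have md: "0 < m + d" using Q by (simp add: m_def)
  define C where "C = adj_mat S"
  have C: "C \<in> carrier_mat (m + d) (m + d)" "C * S = det S \<cdot>\<^sub>m 1\<^sub>m (m + d)"
    using adj_mat[OF S] by (auto simp: C_def)
  \<comment> \<open>Row 0 of the adjugate combines the rows of \<open>S\<close> into
    \<open>det S\<close> times the first unit vector. Column \<open>j\<close> holds coefficients of
    degree \<open>j\<close>, so this is the constant polynomial \<open>det S\<close>.\<close>
  have CS: "(\<Sum>i<m + d. C $$ (0, i) * S $$ (i, j)) = (if j = 0 then det S else 0)" if j: "j < m + d" for j
  proof -
    have "(\<Sum>i<m + d. C $$ (0, i) * S $$ (i, j)) = (C * S) $$ (0, j)"
      using C(1) S j md by (simp add: scalar_prod_def atLeast0LessThan)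
    then show ?thesis unfolding C(2) using j md by simp
  qed
  have "[:det S:] = (\<Sum>j<m + d. monom (if j = 0 then det S else 0) j)"
    using md by (simp add: if_distrib[of "\<lambda>x. monom x _"] monom_0 cong: if_cong)
  also have "\<dots> = (\<Sum>j<m + d. monom (\<Sum>i<m + d. C $$ (0, i) * S $$ (i, j)) j)"
    using CS by (intro sum.cong) auto
  also have "\<dots> = (\<Sum>i<m + d. \<Sum>j<m + d. monom (C $$ (0, i) * S $$ (i, j)) j)"
    by (subst sum.swap) (simp add: monom_sum)
  also have "\<dots> = (\<Sum>i<m + d. smult (C $$ (0, i)) (row i))"
    by (intro sum.cong refl, subst row_expand) (auto simp: smult_sum2 smult_monom)
  also have "\<dots> = (\<Sum>i<m + d. (if i < d then smult (C $$ (0, i)) (monom 1 i) else 0) * Q +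
      (if i < d then 0 else smult (C $$ (0, i)) (monom 1 (i - d))) * z)"
    by (intro sum.cong refl) (simp add: row_def)
  finally have "[:det S:] = (\<Sum>i<m + d. if i < d then smult (C $$ (0, i)) (monom 1 i) else 0) * Q +
      (\<Sum>i<m + d. if i < d then 0 else smult (C $$ (0, i)) (monom 1 (i - d))) * z"
    by (simp add: sum.distrib sum_distrib_right)
  moreover have "dg (2 * k * k) (det S)"
  proof -
    have "dg ((m + d) * k) (det S)"
    proof (rule dg_det[OF S])
      fix i j assume "i < m + d" "j < m + d"
      then show "dg k (S $$ (i, j))"
        using Q(2) z by (auto simp: S_def row_def dgp_def coeff_monom_mult dg_zero)
    qed
    moreover have "(m + d) * k \<le> 2 * k * k" using Q(2) z by (intro mult_right_mono) (auto simp: dgp_def m_def d_def)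
    ultimately show ?thesis by (rule dg_mono)
  qed
  ultimately show ?thesis using nz that by blast
qed

text \<open>A recursion of Newton type yields the leading coefficient times a power sum from the
  earlier power sums, so each step costs one such factor and \<delta> in degree.\<close>

lemma power_sum_bound:
  assumes Q: "dgp \<delta> Q" and roots: "hp Q = smult (h (lead_coeff Q)) (\<Prod>i<degree Q. [:- \<alpha> i, 1:])"
  shows "\<exists>n. dg (k * \<delta>) n \<and> h n = h (lead_coeff Q) ^ k * (\<Sum>i<degree Q. \<alpha> i ^ k)"
proof (induction k rule: less_induct)
  case (less k)
  define c where "c = lead_coeff Q"
  define t where "t = degree Q"
  define s where "s k = (\<Sum>i<t. \<alpha> i ^ k)" for k
  have dgc: "dg \<delta> (coeff Q i)" for i using Q by (simp add: dgp_def)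
  show ?case
  proof (cases "k = 0")
    case True
    then show ?thesis by (intro exI[of _ "of_nat t"]) (simp add: dg_of_nat h.hom_of_nat t_def)
  next
    case False
    obtain \<nu> where \<nu>: "\<And>l. l < k \<Longrightarrow> dg (l * \<delta>) (\<nu> l) \<and> h (\<nu> l) = h c ^ l * s l"
      using less by (metis c_def t_def s_def)
    \<comment> \<open>These merge two cases: for \<open>k < t\<close> Newton's identity with
      inhomogeneous term \<open>r\<close>, otherwise the vanishing of the sum of Q(\<alpha> i)
      \<alpha> i ^ (k - t), where \<open>r\<close> is 0.\<close>
    define l0 where "l0 = min k t"
    define r where "r = (if k < t then of_nat (t - k) * coeff Q (t - k) else 0)"
    have key: "h c * s k = h r - (\<Sum>l = 1..l0. h (coeff Q (t - l)) * s (k - l))"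
    proof (cases "k < t")
      case True
      then have "of_nat (Suc (t - k - 1)) * h (coeff Q (Suc (t - k - 1))) =
          (\<Sum>j = Suc (t - k - 1)..t. h (coeff Q j) * s (j - Suc (t - k - 1)))"
        using newton_identity[OF roots, of "t - k - 1"] by (simp add: s_def t_def del: of_nat_Suc of_nat_diff)
      then have "h r = (\<Sum>j = t - k..t. h (coeff Q j) * s (j - (t - k)))"
        using True by (simp add: r_def h.hom_mult h.hom_of_nat Suc_diff_Suc del: of_nat_diff)
      also have "\<dots> = (\<Sum>l = 0..k. h (coeff Q (t - l)) * s (k - l))"
        using True by (intro sum.reindex_bij_witness[of _ "\<lambda>l. t - l" "\<lambda>j. t - j"]) (auto simp: add.commute)
      also have "\<dots> = h c * s k + (\<Sum>l = 1..k. h (coeff Q (t - l)) * s (k - l))"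
        by (subst sum.atLeast_Suc_atMost) (simp_all add: c_def t_def)
      finally show ?thesis using True by (simp add: l0_def algebra_simps)
    next
      case ge: False
      have "0 = (\<Sum>i<t. poly (hp Q) (\<alpha> i) * \<alpha> i ^ (k - t))"
        by (rule sum.neutral[symmetric]) (use t_def in \<open>auto simp: roots poly_prod intro!: prod_zero\<close>)
      also have "\<dots> = (\<Sum>i<t. \<Sum>j\<le>t. h (coeff Q j) * \<alpha> i ^ (j + (k - t)))"
        by (simp add: poly_altdef t_def sum_distrib_right power_add mult.assoc)
      also have "\<dots> = (\<Sum>j\<le>t. h (coeff Q j) * s (j + (k - t)))"
        by (subst sum.swap) (simp add: s_def sum_distrib_left)
      also have "\<dots> = (\<Sum>l = 0..t. h (coeff Q (t - l)) * s (k - l))"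
        using ge by (intro sum.reindex_bij_witness[of _ "\<lambda>l. t - l" "\<lambda>j. t - j"]) (auto simp: add.commute)
      also have "\<dots> = h c * s k + (\<Sum>l = 1..t. h (coeff Q (t - l)) * s (k - l))"
        by (subst sum.atLeast_Suc_atMost) (simp_all add: c_def t_def)
      finally show ?thesis using ge by (simp add: l0_def r_def min_def algebra_simps add_eq_0_iff2)
    qed
    define n where "n = c ^ (k - 1) * r - (\<Sum>l = 1..l0. c ^ (l - 1) * coeff Q (t - l) * \<nu> (k - l))"
    have "h n = h c ^ (k - 1) * h r - (\<Sum>l = 1..l0. h c ^ (k - 1) * (h (coeff Q (t - l)) * s (k - l)))"
      unfolding n_def h.hom_minus h.hom_sum h.hom_mult h.hom_power
    proof (intro arg_cong2[of _ _ _ _ "(-)"] refl sum.cong)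
      fix l assume l: "l \<in> {1..l0}"
      then have "h (\<nu> (k - l)) = h c ^ (k - l) * s (k - l)" using \<nu>[of "k - l"] False by (auto simp: l0_def)
      moreover have "h c ^ (l - 1) * h c ^ (k - l) = h c ^ (k - 1)"
        using l by (simp add: l0_def flip: power_add)
      ultimately show "h c ^ (l - 1) * h (coeff Q (t - l)) * h (\<nu> (k - l)) =
          h c ^ (k - 1) * (h (coeff Q (t - l)) * s (k - l))"
        by (metis mult.assoc mult.left_commute)
    qed
    also have "\<dots> = h c ^ (k - 1) * (h c * s k)"
      unfolding key by (simp add: right_diff_distrib sum_distrib_left)
    also have "\<dots> = h c ^ k * s k" using False by (cases k) (auto simp: mult.assoc mult.left_commute)
    finally have "h n = h c ^ k * s k" .
    moreover have "dg (k * \<delta>) n"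
      unfolding n_def
    proof (intro dg_diff dg_sum)
      have "dg \<delta> r" unfolding r_def using dgc by (auto intro: dg_mult_0 dg_of_nat simp: dg_zero simp del: of_nat_diff)
      then have "dg ((k - 1) * \<delta> + \<delta>) (c ^ (k - 1) * r)" using dgc by (intro dg_mult dg_power) (simp add: c_def)
      then show "dg (k * \<delta>) (c ^ (k - 1) * r)" using False by (cases k) (simp_all add: add.commute)
    next
      fix l assume l: "l \<in> {1..l0}"
      then have "dg ((l - 1) * \<delta> + \<delta> + (k - l) * \<delta>) (c ^ (l - 1) * coeff Q (t - l) * \<nu> (k - l))"
        using \<nu>[of "k - l"] dgc False by (intro dg_mult dg_power) (auto simp: c_def l0_def)
      moreover have "(l - 1) * \<delta> + \<delta> + (k - l) * \<delta> = k * \<delta>"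
      proof -
        have "(l - 1) * \<delta> + \<delta> + (k - l) * \<delta> = ((l - 1) + 1 + (k - l)) * \<delta>" by (simp add: algebra_simps)
        also have "(l - 1) + 1 + (k - l) = k" using l by (auto simp: l0_def)
        finally show ?thesis .
      qed
      ultimately show "dg (k * \<delta>) (c ^ (l - 1) * coeff Q (t - l) * \<nu> (k - l))" by simp
    qed
    ultimately show ?thesis by (auto simp: c_def s_def t_def)
  qed
qed

text \<open>Expanding \<open>G\<close> reduces this to plain power sums. One exponent
  \<open>K\<close> serves every \<open>k\<close> with \<open>k + \<gamma> \<le> K\<close>, so that
  the same power of the leading coefficient factors out of a whole Hankel matrix.\<close>

lemma weighted_power_sum_bound:
  assumes Q: "dgp \<delta> Q" and roots: "hp Q = smult (h (lead_coeff Q)) (\<Prod>i<degree Q. [:- \<alpha> i, 1:])"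
    and G: "dgp \<gamma> G" and K: "k + \<gamma> \<le> K"
  shows "\<exists>n. dg (K * \<delta> + \<gamma>) n \<and> h n = h (lead_coeff Q) ^ K * (\<Sum>i<degree Q. poly (hp G) (\<alpha> i) * \<alpha> i ^ k)"
proof -
  define c where "c = lead_coeff Q"
  obtain \<nu> where \<nu>: "\<And>k. dg (k * \<delta>) (\<nu> k)" "\<And>k. h (\<nu> k) = h c ^ k * (\<Sum>i<degree Q. \<alpha> i ^ k)"
    using power_sum_bound[OF Q roots] unfolding c_def by metis
  have degG: "degree G \<le> \<gamma>" using G by (simp add: dgp_def)
  define n where "n = (\<Sum>l\<le>degree G. coeff G l * (c ^ (K - (k + l)) * \<nu> (k + l)))"
  have "(\<Sum>i<degree Q. poly (hp G) (\<alpha> i) * \<alpha> i ^ k) =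
      (\<Sum>i<degree Q. \<Sum>l\<le>degree G. h (coeff G l) * \<alpha> i ^ (k + l))"
    by (simp add: poly_altdef sum_distrib_right power_add mult.assoc mult.commute[of "\<alpha> _ ^ k"])
  also have "\<dots> = (\<Sum>l\<le>degree G. h (coeff G l) * (\<Sum>i<degree Q. \<alpha> i ^ (k + l)))"
    by (subst sum.swap) (simp add: sum_distrib_left)
  finally have "h c ^ K * (\<Sum>i<degree Q. poly (hp G) (\<alpha> i) * \<alpha> i ^ k) =
      (\<Sum>l\<le>degree G. h (coeff G l) * (h c ^ (K - (k + l)) * h (\<nu> (k + l))))"
    using K degG by (auto simp: sum_distrib_left \<nu>(2) mult.left_commute simp flip: power_add mult.assoc intro!: sum.cong)
  then have "h n = h c ^ K * (\<Sum>i<degree Q. poly (hp G) (\<alpha> i) * \<alpha> i ^ k)"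
    by (simp add: n_def h.hom_sum h.hom_mult h.hom_power)
  moreover have "dg (K * \<delta> + \<gamma>) n"
    unfolding n_def
  proof (rule dg_sum)
    fix l assume l: "l \<in> {..degree G}"
    have "dg \<delta> c" using Q by (simp add: c_def dgp_def)
    then have "dg (\<gamma> + ((K - (k + l)) * \<delta> + (k + l) * \<delta>)) (coeff G l * (c ^ (K - (k + l)) * \<nu> (k + l)))"
      using G \<nu>(1) by (intro dg_mult dg_power) (auto simp: dgp_def)
    moreover have "(K - (k + l)) * \<delta> + (k + l) * \<delta> = K * \<delta>"
      using l K degG by (simp flip: add_mult_distrib)
    ultimately show "dg (K * \<delta> + \<gamma>) (coeff G l * (c ^ (K - (k + l)) * \<nu> (k + l)))"
      by (simp add: add.commute)
  qed
  ultimately show ?thesis unfolding c_def by blast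
qed

text \<open>If \<open>W\<close> denotes the set of roots of \<open>Q\<close> at which \<open>G\<close> does not vanish, then \<open>H\<close> is a
  bounded multiple of \<open>\<Prod>\<beta>\<in>W. (T - \<beta>)\<close>: it is the determinant of the Hankel matrix of the
  power sums of the roots weighted by the values of \<open>G\<close>, bordered by the row \<open>1, T, T\<^sup>2, \<dots>\<close>.
  This matrix is the product of two Vandermonde matrices and a diagonal matrix.\<close>

lemma bounded_root_selection:
  assumes Q: "dgp \<delta> Q" "Q \<noteq> 0" and G: "dgp \<gamma> G"
  obtains H where "dgp (\<delta> * ((2 * \<delta> + \<gamma>) * \<delta> + \<gamma>) + \<delta>) H" "H \<noteq> 0"
    "\<And>x. poly (hp H) x = 0 \<longleftrightarrow> poly (hp Q) x = 0 \<and> poly (hp G) x \<noteq> 0"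
    "\<And>x. poly (hp H) x = 0 \<Longrightarrow> poly (hp (pderiv H)) x \<noteq> 0"
proof -
  interpret hp: map_poly_inj_comm_ring_hom h ..
  define c where "c = lead_coeff Q"
  have c0: "h c \<noteq> 0" using Q by (simp add: c_def)
  have "hp Q \<noteq> 0" using Q by simp
  then obtain \<alpha> where "hp Q = smult (lead_coeff (hp Q)) (\<Prod>i<degree (hp Q). [:- \<alpha> i, 1:])"
    by (rule alg_closed_factorization)
  then have roots: "hp Q = smult (h c) (\<Prod>i<degree Q. [:- \<alpha> i, 1:])" by (simp add: c_def)
  define W where "W = {x. poly (hp Q) x = 0 \<and> poly (hp G) x \<noteq> 0}"
  have Qroot: "poly (hp Q) x = 0 \<longleftrightarrow> x \<in> \<alpha> ` {..<degree Q}" for x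
    unfolding roots using c0 by (auto simp: poly_prod)
  have finW: "finite W" and cardW: "card W \<le> degree Q"
  proof -
    have sub: "W \<subseteq> \<alpha> ` {..<degree Q}" by (auto simp: W_def Qroot)
    then show "finite W" by (rule finite_subset) auto
    show "card W \<le> degree Q"
      using card_mono[OF _ sub] card_image_le[of "{..<degree Q}" \<alpha>] by simp
  qed
  define p where "p = card W"
  have p\<delta>: "p \<le> \<delta>" using cardW Q(1) by (simp add: p_def dgp_def)
  obtain \<beta> where "bij_betw \<beta> {0..<card W} W"
    using ex_bij_betw_nat_finite[OF finW] by blast
  then have \<beta>: "bij_betw \<beta> {..<p} W" by (simp add: p_def atLeast0LessThan)
  then have \<beta>W: "\<beta> l \<in> W" if "l < p" for l using that by (auto simp: bij_betw_def)
  \<comment> \<open>Hankel entries have exponent \<open>i + j \<le> 2 * \<delta>\<close>, and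
    expanding \<open>G\<close> raises it by at most \<gamma>.\<close>
  define K where "K = 2 * \<delta> + \<gamma>"
  define w where "w l = of_nat (card {i. i < degree Q \<and> \<alpha> i = \<beta> l}) * poly (hp G) (\<beta> l)" for l
  have w0: "w l \<noteq> 0" if "l < p" for l
  proof -
    have "\<beta> l \<in> \<alpha> ` {..<degree Q}" using \<beta>W[OF that] by (simp add: W_def Qroot)
    then have "{i. i < degree Q \<and> \<alpha> i = \<beta> l} \<noteq> {}" by auto
    then have "card {i. i < degree Q \<and> \<alpha> i = \<beta> l} > 0" by (simp add: card_gt_0_iff)
    then show ?thesis using char_0 \<beta>W[OF that] by (simp add: w_def W_def)
  qed
  have \<sigma>: "(\<Sum>i<degree Q. poly (hp G) (\<alpha> i) * \<alpha> i ^ k) = (\<Sum>l<p. w l * \<beta> l ^ k)" for k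
  proof -
    have "(\<Sum>i<degree Q. poly (hp G) (\<alpha> i) * \<alpha> i ^ k) =
        (\<Sum>i\<in>{i. i < degree Q \<and> \<alpha> i \<in> W}. poly (hp G) (\<alpha> i) * \<alpha> i ^ k)"
      using Qroot by (intro sum.mono_neutral_right) (auto simp: W_def)
    also have "\<dots> = (\<Sum>x\<in>W. \<Sum>i | i \<in> {i. i < degree Q \<and> \<alpha> i \<in> W} \<and> \<alpha> i = x. poly (hp G) (\<alpha> i) * \<alpha> i ^ k)"
      using finW by (intro sum.group[symmetric]) auto
    also have "\<dots> = (\<Sum>x\<in>W. of_nat (card {i. i < degree Q \<and> \<alpha> i = x}) * poly (hp G) x * x ^ k)"
    proof (rule sum.cong[OF refl])
      fix x assume x: "x \<in> W"
      then have "{i. i \<in> {i. i < degree Q \<and> \<alpha> i \<in> W} \<and> \<alpha> i = x} = {i. i < degree Q \<and> \<alpha> i = x}" by auto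
      then show "(\<Sum>i | i \<in> {i. i < degree Q \<and> \<alpha> i \<in> W} \<and> \<alpha> i = x. poly (hp G) (\<alpha> i) * \<alpha> i ^ k) =
          of_nat (card {i. i < degree Q \<and> \<alpha> i = x}) * poly (hp G) x * x ^ k"
        by (simp add: mult.assoc)
    qed
    also have "\<dots> = (\<Sum>l<p. w l * \<beta> l ^ k)"
      using sum.reindex_bij_betw[OF \<beta>, of "\<lambda>x. of_nat (card {i. i < degree Q \<and> \<alpha> i = x}) * poly (hp G) x * x ^ k"]
      by (simp add: w_def)
    finally show ?thesis .
  qed
  have "\<exists>n. dg (K * \<delta> + \<gamma>) n \<and> h n = h c ^ K * (\<Sum>l<p. w l * \<beta> l ^ k)" if "k \<le> 2 * \<delta>" for k
    using weighted_power_sum_bound[OF Q(1) roots[unfolded c_def] G, of k K] that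
    by (simp add: \<sigma> c_def K_def)
  then obtain \<nu> where \<nu>: "\<And>k. k \<le> 2 * \<delta> \<Longrightarrow> dg (K * \<delta> + \<gamma>) (\<nu> k)"
    "\<And>k. k \<le> 2 * \<delta> \<Longrightarrow> h (\<nu> k) = h c ^ K * (\<Sum>l<p. w l * \<beta> l ^ k)" by metis
  \<comment> \<open>The cofactors along row \<open>p\<close> delete it, so its zeros stand for the
    border \<open>1, T, T^2, ...\<close>, which appears as \<open>x ^ j\<close> in
    \<open>Ax\<close>.\<close>
  define A where "A = mat (Suc p) (Suc p) (\<lambda>(i, j). if i < p then \<nu> (i + j) else 0)"
  define H where "H = (\<Sum>j<Suc p. monom (cofactor A p j) j)"
  define L where "L = mat (Suc p) (Suc p) (\<lambda>(i, l). if i < p then (if l < p then h c ^ K * w l * \<beta> l ^ i else 0)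
      else if l < p then 0 else 1)"
  define B where "B x = mat (Suc p) (Suc p) (\<lambda>(l, j). (if l < p then \<beta> l else x) ^ j)" for x
  have H_eq: "poly (hp H) x = det L * det (B x)" for x
  proof -
    define Ax where "Ax = mat (Suc p) (Suc p) (\<lambda>(i, j). if i < p then h (\<nu> (i + j)) else x ^ j)"
    have del: "mat_delete Ax p j = map_mat h (mat_delete A p j)" if "j < Suc p" for j
      using that by (intro eq_matI) (auto simp: mat_delete_def Ax_def A_def)
    have "poly (hp H) x = (\<Sum>j<Suc p. h (cofactor A p j) * x ^ j)"
      unfolding H_def hp.hom_sum poly_sum by (simp add: poly_monom h.map_poly_hom_monom)
    also have "\<dots> = (\<Sum>j<Suc p. Ax $$ (p, j) * cofactor Ax p j)"
    proof (intro sum.cong refl)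
      fix j assume j: "j \<in> {..<Suc p}"
      have "Ax $$ (p, j) = x ^ j" using j by (simp add: Ax_def)
      moreover have "cofactor Ax p j = h (cofactor A p j)"
        using del j by (simp add: cofactor_def h.hom_mult h.hom_power h.hom_uminus)
      ultimately show "h (cofactor A p j) * x ^ j = Ax $$ (p, j) * cofactor Ax p j" by simp
    qed
    also have "\<dots> = det Ax"
      by (rule laplace_expansion_row[symmetric]) (auto simp: Ax_def)
    also have "Ax = L * B x"
    proof (rule eq_matI)
      fix i j assume "i < dim_row (L * B x)" "j < dim_col (L * B x)"
      then have ij: "i < Suc p" "j < Suc p" by (auto simp: L_def B_def)
      have "(L * B x) $$ (i, j) = (\<Sum>l<Suc p. L $$ (i, l) * B x $$ (l, j))"
        using ij by (simp add: L_def B_def scalar_prod_def atLeast0LessThan del: sum.lessThan_Suc)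
      also have "\<dots> = Ax $$ (i, j)"
      proof (cases "i < p")
        case True
        then have "i + j \<le> 2 * \<delta>" using ij p\<delta> by simp
        with True ij show ?thesis
          by (simp add: L_def B_def Ax_def \<nu>(2) sum_distrib_left power_add mult.assoc)
      next
        case False
        with ij show ?thesis by (simp add: L_def B_def Ax_def)
      qed
      finally show "Ax $$ (i, j) = (L * B x) $$ (i, j)" by simp
    qed (auto simp: Ax_def L_def B_def)
    also have "det (L * B x) = det L * det (B x)"
      by (rule det_mult[of _ "Suc p"]) (auto simp: L_def B_def)
    finally show ?thesis .
  qed
  have detL: "det L \<noteq> 0"
  proof
    have Lc: "L \<in> carrier_mat (Suc p) (Suc p)" by (simp add: L_def)
    assume "det L = 0"
    then have "det (transpose_mat L) = 0" using det_transpose[OF Lc] by simp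
    then obtain v where v: "v \<in> carrier_vec (Suc p)" "v \<noteq> 0\<^sub>v (Suc p)" "transpose_mat L *\<^sub>v v = 0\<^sub>v (Suc p)"
      using det_0_iff_vec_prod_zero[of "transpose_mat L" "Suc p"] Lc by auto
    have col: "(\<Sum>i<Suc p. L $$ (i, l) * v $ i) = 0" if l: "l < Suc p" for l
    proof -
      have "0 = (transpose_mat L *\<^sub>v v) $ l" using v l by simp
      also have "\<dots> = (\<Sum>i<Suc p. L $$ (i, l) * v $ i)"
        using l v(1) Lc by (simp add: scalar_prod_def atLeast0LessThan del: sum.lessThan_Suc)
      finally show ?thesis by simp
    qed
    define f where "f = (\<Sum>j<p. monom (v $ j) j)"
    have vp: "v $ p = 0" using col[of p] by (simp add: L_def)
    have "poly f (\<beta> l) = 0" if l: "l < p" for l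
    proof -
      have "h c ^ K * w l * poly f (\<beta> l) = (\<Sum>i<p. L $$ (i, l) * v $ i)"
        using l by (simp add: f_def poly_sum poly_monom L_def sum_distrib_left mult_ac)
      also have "\<dots> = 0" using col[of l] l vp by simp
      finally show ?thesis using c0 w0[OF l] by simp
    qed
    moreover have "degree f < p" if "p > 0"
      using that unfolding f_def
      by (intro le_less_trans[OF degree_sum_le[where n = "p - 1"]]) (auto intro: order.trans[OF degree_monom_le])
    moreover have "card (\<beta> ` {..<p}) = p" unfolding bij_betw_imp_surj_on[OF \<beta>] by (simp add: p_def)
    ultimately have "f = 0 \<or> p = 0"
      using poly_eq_0_if_many_roots[of "\<beta> ` {..<p}" f] by fastforce
    moreover have "coeff f j = v $ j" if "j < p" for j
      using that by (simp add: f_def coeff_sum)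
    ultimately have "v $ j = 0" if "j < p" for j using that by auto
    then have "v $ j = 0" if "j < Suc p" for j using vp that by (auto simp: less_Suc_eq)
    then have "v = 0\<^sub>v (Suc p)" using v(1) by (intro eq_vecI) auto
    with v show False by simp
  qed
  have rootsH: "poly (hp H) x = 0 \<longleftrightarrow> x \<in> W" for x
  proof
    assume x: "x \<in> W"
    then obtain l where l: "l < p" "\<beta> l = x" using \<beta> by (auto simp: bij_betw_def)
    then have "row (B x) l = row (B x) p" by (intro eq_vecI) (auto simp: B_def)
    then have "det (B x) = 0" using l by (intro det_identical_rows[of _ "Suc p" l p]) (auto simp: B_def)
    then show "poly (hp H) x = 0" by (simp add: H_eq)
  next
    assume 0: "poly (hp H) x = 0"
    show "x \<in> W"
    proof (rule ccontr)
      assume x: "x \<notin> W"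
      have "inj_on (\<lambda>l. if l < p then \<beta> l else x) {..<Suc p}"
        using \<beta> x \<beta>W by (auto simp: bij_betw_def inj_on_def less_Suc_eq)
      from det_vandermonde_nonzero[OF this] have "det (B x) \<noteq> 0" by (simp add: B_def)
      with 0 detL show False by (simp add: H_eq)
    qed
  qed
  have H0: "H \<noteq> 0"
  proof
    assume "H = 0"
    then have "W = UNIV" using rootsH by auto
    then show False using finW infinite_closure by simp
  qed
  have degH: "degree H \<le> p"
    unfolding H_def by (intro degree_sum_le) (auto intro: order.trans[OF degree_monom_le])
  have "dgp (\<delta> * ((2 * \<delta> + \<gamma>) * \<delta> + \<gamma>) + \<delta>) H"
    unfolding dgp_def
  proof (intro conjI allI)
    show "degree H \<le> \<delta> * ((2 * \<delta> + \<gamma>) * \<delta> + \<gamma>) + \<delta>" using degH p\<delta> by simp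
    fix j
    have "dg (p * (K * \<delta> + \<gamma>)) (cofactor A p j)" if j: "j < Suc p" for j
    proof -
      have "dg (p * (K * \<delta> + \<gamma>)) (det (mat_delete A p j))"
      proof (rule dg_det)
        show "mat_delete A p j \<in> carrier_mat p p" by (auto simp: mat_delete_def A_def)
        fix i l assume il: "i < p" "l < p"
        then have "mat_delete A p j $$ (i, l) = \<nu> (i + (if l < j then l else Suc l))"
          by (simp add: mat_delete_def A_def)
        then show "dg (K * \<delta> + \<gamma>) (mat_delete A p j $$ (i, l))" using il p\<delta> by (simp add: \<nu>(1))
      qed
      then show ?thesis unfolding cofactor_def
        using dg_power[OF dg_uminus[OF dg_one], of "p + j"] by (intro dg_mult_0) auto
    qed
    then have "dg (p * (K * \<delta> + \<gamma>)) (coeff H j)"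
      by (cases "j < Suc p") (auto simp: H_def coeff_sum dg_zero)
    moreover have "p * (K * \<delta> + \<gamma>) \<le> \<delta> * ((2 * \<delta> + \<gamma>) * \<delta> + \<gamma>) + \<delta>"
      unfolding K_def by (intro trans_le_add1 mult_right_mono p\<delta>) simp
    ultimately show "dg (\<delta> * ((2 * \<delta> + \<gamma>) * \<delta> + \<gamma>) + \<delta>) (coeff H j)" by (rule dg_mono)
  qed
  \<comment> \<open>At a multiple root \<open>x\<close> the quotient \<open>r\<close> would still
    vanish on all of \<open>W\<close>, although its degree is below \<open>card W\<close>.\<close>
  moreover have "poly (hp (pderiv H)) x \<noteq> 0" if x: "poly (hp H) x = 0" for x
  proof
    assume d: "poly (hp (pderiv H)) x = 0"
    obtain r where r: "hp H = [:- x, 1:] * r" using x by (metis dvdE poly_eq_0_iff_dvd)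
    then have r0: "r \<noteq> 0" using H0 by auto
    have "hp (pderiv H) = pderiv (hp H)"
      by (rule poly_eqI) (simp add: coeff_pderiv h.hom_mult h.hom_add h.hom_of_nat)
    also have "\<dots> = [:- x, 1:] * pderiv r + r * pderiv [:- x, 1:]" by (simp only: r pderiv_mult)
    finally have "poly r x = 0" using d by (simp add: pderiv_pCons)
    moreover have "poly r y = 0" if "y \<in> W" "y \<noteq> x" for y
      using rootsH[of y] that unfolding r by simp
    ultimately have "\<And>y. y \<in> W \<Longrightarrow> poly r y = 0" by blast
    moreover have "degree r < card W"
    proof -
      have "degree (hp H) = degree [:- x, 1:] + degree r" unfolding r using r0 by (intro degree_mult_eq) auto
      then show ?thesis using degH by (simp add: p_def)
    qed
    ultimately show False using poly_eq_0_if_many_roots[OF finW, of r] r0 by blast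
  qed
  ultimately show ?thesis using that[of H] H0 rootsH by (auto simp: W_def)
qed

text \<open>Over the closure \<open>g\<close> divides the pseudo-remainder, whose degree is too
  small unless it is zero. Divisibility over the closure thus becomes an identity over the base
  ring.\<close>

lemma pseudo_division_exact:
  assumes g: "g \<noteq> 0" and dvd: "hp g dvd hp f"
  obtains q where "smult (lead_coeff g ^ (Suc (degree f) - degree g)) f = g * q"
proof -
  interpret hp: map_poly_inj_comm_ring_hom h ..
  obtain q r where qr: "pseudo_divmod f g = (q, r)" by fastforce
  from pseudo_divmod[OF g qr] have 1: "smult (lead_coeff g ^ (Suc (degree f) - degree g)) f = g * q + r"
    and 2: "r = 0 \<or> degree r < degree g" by auto
  have "hp r = smult (h (lead_coeff g ^ (Suc (degree f) - degree g))) (hp f) - hp g * hp q"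
    using arg_cong[OF 1, of hp] by (simp add: hp.hom_add hp.hom_mult h.map_poly_hom_smult)
  then have "hp g dvd hp r" using dvd by (simp add: dvd_diff dvd_smult)
  then have "r = 0" using 2 dvd_imp_degree_le[of "hp g" "hp r"] by fastforce
  with 1 that[of q] show ?thesis by simp
qed

end

subsection \<open>Order of vanishing of power series\<close>

definition ordge :: "nat \<Rightarrow> 'a::zero fps \<Rightarrow> bool" where
  "ordge M f \<longleftrightarrow> (\<forall>i<M. fps_nth f i = 0)"

lemma ordge_0 [simp]: "ordge M 0"
  by (simp add: ordge_def)

lemma ordge_add: "ordge M f \<Longrightarrow> ordge M g \<Longrightarrow> ordge M (f + g)" for f :: "'a::monoid_add fps"
  by (simp add: ordge_def)

lemma ordge_diff: "ordge M f \<Longrightarrow> ordge M g \<Longrightarrow> ordge M (f - g)" for f :: "'a::ab_group_add fps"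
  by (simp add: ordge_def)

lemma ordge_uminus: "ordge M f \<Longrightarrow> ordge M (- f)" for f :: "'a::ab_group_add fps"
  by (simp add: ordge_def)

lemma ordge_mult: "ordge M f \<Longrightarrow> ordge M (g * f)" for f :: "'a::comm_ring_1 fps"
  by (auto simp: ordge_def fps_mult_nth intro!: sum.neutral)

lemma ordge_mult2: "ordge M f \<Longrightarrow> ordge M (f * g)" for f :: "'a::comm_ring_1 fps"
  by (subst mult.commute) (rule ordge_mult)

lemma ordge_mono: "ordge M f \<Longrightarrow> M' \<le> M \<Longrightarrow> ordge M' f"
  by (simp add: ordge_def)

lemma ordge_sum: "(\<And>x. x \<in> A \<Longrightarrow> ordge M (g x)) \<Longrightarrow> ordge M (\<Sum>x\<in>A. g x)"
  for g :: "'x \<Rightarrow> 'a::ab_group_add fps"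
  by (induction A rule: infinite_finite_induct) (auto intro: ordge_add)

lemma ordge_fps_deriv: "ordge (Suc M) f \<Longrightarrow> ordge M (fps_deriv f)" for f :: "'a::comm_ring_1 fps"
  by (simp add: ordge_def)

lemma not_ordge_mult:
  fixes f g :: "'a::idom fps"
  assumes "\<not> ordge a f" "\<not> ordge b g"
  shows "\<not> ordge (a + b) (f * g)"
proof -
  have f0: "f \<noteq> 0" and g0: "g \<noteq> 0" using assms by auto
  have "subdegree f < a" "subdegree g < b"
    using assms nth_less_subdegree_zero unfolding ordge_def
    by (metis not_less order.strict_trans1 order.strict_trans2)+
  then have "subdegree (f * g) < a + b" using f0 g0 by simp
  moreover have "fps_nth (f * g) (subdegree (f * g)) \<noteq> 0" using f0 g0 by simp
  ultimately show ?thesis unfolding ordge_def by blast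
qed

text \<open>Orders add in a domain; the \<open>Suc\<close> is what makes the bound hold for
  \<open>n = 0\<close>, where the power is 1.\<close>

lemma not_ordge_power:
  fixes f :: "'a::idom fps"
  assumes "\<not> ordge a f"
  shows "\<not> ordge (Suc (n * a)) (f ^ n)"
proof (induction n)
  case (Suc n)
  then show ?case using not_ordge_mult[OF assms Suc.IH] by (simp add: add.assoc)
qed (simp add: ordge_def)

text \<open>The approximate form of cancelling a nonzero factor and taking a root: the factor costs
  \<open>b\<close>, the root divides the remaining order by \<open>n\<close>.\<close>

lemma ordge_cancel_power:
  fixes f g :: "'a::idom fps"
  assumes "ordge M (f ^ n * g)" "\<not> ordge b g" "Suc (n * a) + b \<le> M"
  shows "ordge a f"
proof (rule ccontr)
  assume "\<not> ordge a f"
  from not_ordge_mult[OF not_ordge_power[OF this, of n] assms(2)] assms(1,3) ordge_mono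
  show False by blast
qed

subsection \<open>The polynomial ring in the generic linear forms\<close>

text \<open>The variable \<open>(0, i)\<close> is the generic linear form \<open>Y\<^sub>i\<close>, and \<open>(Suc i, c)\<close> is its
  coefficient at the coordinate \<open>u\<^sub>c\<close>.  Degrees are taken with respect to the \<open>Y\<^sub>i\<close> only.\<close>

type_synonym gpoly = "(nat \<times> nat) mpoly"

abbreviation Yv :: "nat \<Rightarrow> gpoly" where "Yv i \<equiv> mvar (0, i)"
abbreviation Lv :: "nat \<Rightarrow> nat \<Rightarrow> gpoly" where "Lv i c \<equiv> mvar (Suc i, c)"

definition dgY :: "nat \<Rightarrow> nat \<Rightarrow> gpoly \<Rightarrow> bool" where
  "dgY r k p \<longleftrightarrow> (\<forall>m\<in>keys p. (\<forall>i\<ge>r. lookup m (0, i) = 0) \<and>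
     (\<Sum>i<r. lookup m (0, i)) \<le> k)"

lemma filtration_dgY: "filtration (dgY r)"
proof
  show "dgY r k 0" for k by (simp add: dgY_def)
  show "dgY r 0 1" by (simp add: dgY_def)
  show "dgY r k (a + b)" if "dgY r k a" "dgY r k b" for k a b
    using that Poly_Mapping.keys_add[of a b] unfolding dgY_def by blast
  show "dgY r k (- a)" if "dgY r k a" for k a
    using that by (simp add: dgY_def in_keys_iff)
  show "dgY r (k + l) (a * b)" if "dgY r k a" "dgY r l b" for k l a b
    unfolding dgY_def
  proof
    fix m assume "m \<in> keys (a * b)"
    then obtain m1 m2 where m: "m = m1 + m2" "m1 \<in> keys a" "m2 \<in> keys b"
      using keys_mult[of a b] by auto
    with that show "(\<forall>i\<ge>r. lookup m (0, i) = 0) \<and> (\<Sum>i<r. lookup m (0, i)) \<le> k + l"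
      unfolding dgY_def by (auto simp: lookup_add sum.distrib intro!: add_mono)
  qed
  show "dgY r l a" if "dgY r k a" "k \<le> l" for k l a
    using that unfolding dgY_def by (meson order_trans)
qed

interpretation dgY: filtration "dgY r" for r by (rule filtration_dgY)

lemma dgY_mconst [simp]: "dgY r k (mconst c)"
  by (auto simp: dgY_def mconst_def split: if_splits)

lemma dgY_Yv: "i < r \<Longrightarrow> dgY r 1 (Yv i)"
  by (auto simp: dgY_def mvar_def lookup_single when_def)

lemma dgY_Lv [simp]: "dgY r k (Lv i c)"
  by (auto simp: dgY_def mvar_def lookup_single when_def)

lemma dgY_Suc_r: "dgY r k p \<Longrightarrow> dgY (Suc r) k p"
  by (auto simp: dgY_def)

text \<open>Reads a polynomial as univariate in \<open>Yv r\<close>, the shape to which the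
  eliminations apply.\<close>

definition up :: "nat \<Rightarrow> gpoly \<Rightarrow> gpoly poly" where
  "up r = msubst (\<lambda>c. [:mconst c:]) (\<lambda>v. if v = (0, r) then [:0, 1:] else [:mvar v:])"

lemma comm_ring_hom_up: "comm_ring_hom (up r)"
  unfolding up_def by (intro comm_ring_hom_msubst comm_ring_hom_pCons comm_ring_hom_mconst)

lemma up_mconst [simp]: "up r (mconst c) = [:mconst c:]"
  and up_mvar: "up r (mvar v) = (if v = (0, r) then [:0, 1:] else [:mvar v:])"
  unfolding up_def by (simp_all add: msubst_mconst msubst_mvar comm_ring_hom_pCons comm_ring_hom_mconst)

lemma poly_up: "poly (up r p) (Yv r) = p"
proof -
  interpret comm_ring_hom "up r" by (rule comm_ring_hom_up)
  show ?thesis by (induction p rule: mpoly_induct) (simp_all add: hom_add hom_mult up_mvar)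
qed

lemma comm_ring_hom_const_poly: "comm_ring_hom (\<lambda>p::'a::comm_ring_1. [:p:])"
  by unfold_locales (auto simp: one_pCons)

lemma up_single:
  "up r (single m c) =
     monom (single (m - single (0, r) (lookup m (0, r))) c)
       (lookup m (0, r))"
proof -
  interpret comm_ring_hom "up r" by (rule comm_ring_hom_up)
  define l where "l = lookup m (0, r)"
  define m' where "m' = m - single (0, r) l"
  have m: "m = m' + single (0, r) l"
    by (intro poly_mapping_eqI) (auto simp: m'_def l_def lookup_add lookup_minus lookup_single when_def)
  have "mon_val (\<lambda>v. if v = (0, r) then [:0, 1:] else [:mvar v:]) m' = mon_val (\<lambda>v. [:mvar v:]) m'"
    by (rule mon_val_cong) (auto simp: in_keys_iff m'_def l_def lookup_minus lookup_single when_def split: if_splits)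
  also have "\<dots> = [:mon_val mvar m':]"
  proof -
    interpret c: comm_ring_hom "\<lambda>p::gpoly. [:p:]" by (rule comm_ring_hom_const_poly)
    show ?thesis by (simp only: mon_val_def c.hom_prod c.hom_power)
  qed
  also have "mon_val mvar m' = single m' 1" by (simp add: single_eq_mon_val)
  finally have "mon_val (\<lambda>v. if v = (0, r) then [:0, 1:] else [:mvar v:]) m = monom (single m' 1) l"
    unfolding m mon_val_add by (simp add: monom_altdef)
  then have "up r (single m c) = monom (mconst c * single m' 1) l"
    unfolding up_def by (simp add: msubst_single comm_ring_hom_pCons comm_ring_hom_mconst smult_monom)
  then show ?thesis by (simp add: m'_def l_def flip: single_eq_const_mult)
qed

lemma dgp_up:
  assumes "dgY (Suc r) k p"
  shows "dgY.dgp r k (up r p)"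
proof -
  interpret comm_ring_hom "up r" by (rule comm_ring_hom_up)
  let ?m' = "\<lambda>m. m - single (0, r) (lookup m (0, r))"
  have up: "up r p = (\<Sum>m\<in>keys p. monom (single (?m' m) (lookup p m))
       (lookup m (0, r)))"
    by (subst poly_mapping_sum_singles[of p], subst hom_sum) (simp only: up_single)
  have l: "lookup m (0, r) \<le> k" if "m \<in> keys p" for m
    using assms that by (force simp: dgY_def)
  have d: "dgY r k (single (?m' m) c)" if m: "m \<in> keys p" for m c
  proof -
    have "lookup (?m' m) (0, i) = 0" if "i \<ge> r" for i
      using assms m that by (cases "i = r") (auto simp: dgY_def lookup_minus lookup_single when_def)
    moreover have "(\<Sum>i<r. lookup (?m' m) (0, i)) \<le> (\<Sum>i<Suc r. lookup m (0, i))"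
      by (simp add: lookup_minus lookup_single when_def)
    moreover have "\<dots> \<le> k" using assms m by (simp add: dgY_def)
    ultimately show ?thesis by (auto simp: dgY_def)
  qed
  show ?thesis
    unfolding dgY.dgp_def
  proof (intro conjI allI)
    show "degree (up r p) \<le> k"
      unfolding up by (intro degree_sum_le finite_keys order_trans[OF degree_monom_le] l)
    show "dgY r k (coeff (up r p) i)" for i
      unfolding up coeff_sum coeff_monom by (intro dgY.dg_sum) (auto simp: d dgY.dg_zero)
  qed
qed

lemma dgY_poly:
  assumes "dgY.dgp r k q"
  shows "dgY (Suc r) (2 * k) (poly q (Yv r))"
  unfolding poly_altdef
proof (rule dgY.dg_sum)
  fix i assume i: "i \<in> {..degree q}"
  have "dgY (Suc r) (k + i * 1) (coeff q i * Yv r ^ i)"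
    using assms by (intro dgY.dg_mult dgY.dg_power dgY_Suc_r dgY_Yv) (auto simp: dgY.dgp_def)
  then show "dgY (Suc r) (2 * k) (coeff q i * Yv r ^ i)"
    by (rule dgY.dg_mono) (use i assms in \<open>auto simp: dgY.dgp_def\<close>)
qed

lemma up_const:
  assumes "dgY r k p"
  shows "up r p = [:p:]"
proof -
  have "(0, r) \<notin> vars p" using assms by (auto simp: dgY_def vars_def in_keys_iff)
  then have "up r p = msubst (\<lambda>c. [:mconst c:]) (\<lambda>v. [:mvar v:]) p"
    unfolding up_def by (intro msubst_cong) auto
  also have "\<dots> = [:msubst mconst mvar p:]"
    using hom_msubst[OF comm_ring_hom_mconst comm_ring_hom_const_poly, of mvar p]
    by (simp add: comp_def)
  finally show ?thesis by (simp add: msubst_mconst_mvar)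
qed

lemma up_poly:
  assumes "dgY.dgp r k q"
  shows "up r (poly q (Yv r)) = q"
proof -
  interpret comm_ring_hom "up r" by (rule comm_ring_hom_up)
  have "up r (poly q (Yv r)) = (\<Sum>i\<le>degree q. [:coeff q i:] * [:0, 1:] ^ i)"
    unfolding poly_altdef hom_sum hom_mult hom_power
    using assms by (intro sum.cong refl) (simp add: up_mvar dgY.dgp_def up_const[of r k])
  also have "\<dots> = (\<Sum>i\<le>degree q. monom (coeff q i) i)" by (simp add: monom_altdef)
  finally show ?thesis by (simp add: poly_as_sum_of_monoms)
qed

subsection \<open>The generic point\<close>

type_synonym gfield = "gpoly fract alg_closure"

definition emb :: "gpoly \<Rightarrow> gfield" where "emb p = to_ac (to_fract p)"

lemma inj_comm_ring_hom_emb: "inj_comm_ring_hom emb"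
  by unfold_locales (auto simp: emb_def)

interpretation emb: inj_comm_ring_hom emb by (rule inj_comm_ring_hom_emb)

interpretation ge: graded_embedding "dgY r" emb for r
proof
  fix k :: nat assume "k > 0"
  then have "emb (mconst (of_nat k)) \<noteq> 0" by simp
  then show "of_nat k \<noteq> (0 :: gfield)" by (simp add: mconst_of_nat emb.hom_of_nat)
qed

lemma comm_ring_hom_emb_mconst: "comm_ring_hom (\<lambda>c. emb (mconst c))"
  by unfold_locales (auto simp: mconst_add mconst_mult emb.hom_add emb.hom_mult)

text \<open>A point on the generic line in direction \<open>Yv r\<close>: the parameters and the
  other forms stay independent, and only \<open>Yv r\<close> is specialised, later to a root of an
  equation over them.\<close>

definition ev :: "nat \<Rightarrow> gfield \<Rightarrow> gpoly \<Rightarrow> gfield" where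
  "ev r \<alpha> = msubst (\<lambda>c. emb (mconst c)) (\<lambda>v. if v = (0, r) then \<alpha> else emb (mvar v))"

lemma comm_ring_hom_ev: "comm_ring_hom (ev r \<alpha>)"
  unfolding ev_def by (intro comm_ring_hom_msubst comm_ring_hom_emb_mconst)

interpretation ev: comm_ring_hom "ev r \<alpha>" for r \<alpha> by (rule comm_ring_hom_ev)

lemma ev_mconst [simp]: "ev r \<alpha> (mconst c) = emb (mconst c)"
  and ev_mvar: "ev r \<alpha> (mvar v) = (if v = (0, r) then \<alpha> else emb (mvar v))"
  unfolding ev_def by (simp_all add: msubst_mconst msubst_mvar comm_ring_hom_emb_mconst)

lemma map_poly_emb_const: "map_poly emb [:p:] = [:emb p:]"
  by (rule poly_eqI) (simp add: coeff_map_poly coeff_pCons split: nat.split)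

lemma ev_eq_poly_up: "ev r \<alpha> p = poly (map_poly emb (up r p)) \<alpha>"
proof -
  interpret u: comm_ring_hom "up r" by (rule comm_ring_hom_up)
  interpret mp: map_poly_comm_ring_hom emb ..
  show ?thesis
    by (induction p rule: mpoly_induct)
      (simp_all add: ev.hom_add ev.hom_mult u.hom_add u.hom_mult mp.hom_add mp.hom_mult ev_mvar up_mvar map_poly_emb_const)
qed

lemma ev_eq_emb: "dgY r k p \<Longrightarrow> ev r \<alpha> p = emb p"
  by (simp add: ev_eq_poly_up up_const map_poly_emb_const)

subsection \<open>The curve and its derivations\<close>

abbreviation gderiv :: "(nat \<times> nat \<Rightarrow> gpoly) \<Rightarrow> gpoly \<Rightarrow> gpoly" where
  "gderiv \<equiv> mderiv mconst mvar"

lemma gderiv_mult: "gderiv a (p * q) = p * gderiv a q + gderiv a p * q"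
  by (simp add: mderiv_mult comm_ring_hom_mconst msubst_mconst_mvar)

lemma gderiv_add: "gderiv a (p + q) = gderiv a p + gderiv a q"
  by (simp add: mderiv_add comm_ring_hom_mconst)

lemma gderiv_mconst [simp]: "gderiv a (mconst c) = 0"
  and gderiv_mvar [simp]: "gderiv a (mvar v) = a v"
  and gderiv_0 [simp]: "gderiv a 0 = 0"
  by (simp_all add: comm_ring_hom_mconst)

lemma gderiv_sum: "gderiv a (\<Sum>x\<in>A. g x) = (\<Sum>x\<in>A. gderiv a (g x))"
  by (induction A rule: infinite_finite_induct) (auto simp: gderiv_add)

text \<open>Replacing one variable in a monomial by a factor of degree zero cannot raise the degree;
  \<open>wt\<close> counts the forms and ignores the parameters.\<close>

lemma dgY_gderiv:
  assumes a: "\<And>v. dgY r 0 (a v)" and p: "dgY r k p"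
  shows "dgY r k (gderiv a p)"
proof -
  define wt :: "nat \<times> nat \<Rightarrow> nat" where "wt v = (if fst v = 0 then 1 else 0)" for v
  have var: "dgY r (wt v) (mvar v)" if "fst v = 0 \<longrightarrow> snd v < r" for v
  proof (cases v)
    case (Pair i j)
    then show ?thesis using that dgY_Yv[of j r] dgY_Lv[of r 0 "i - 1" j] by (cases i) (auto simp: wt_def)
  qed
  have pow: "dgY r (e * wt v) (gderiv a (mvar v ^ e))" if "fst v = 0 \<longrightarrow> snd v < r" for v e
  proof (induction e)
    case (Suc e)
    have "dgY r (wt v + e * wt v) (mvar v * gderiv a (mvar v ^ e) + a v * mvar v ^ e)"
      using dgY.dg_mult[OF var[OF that] Suc.IH] dgY.dg_mono[OF dgY.dg_mult_0[OF a dgY.dg_power[OF var[OF that]]]]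
      by (intro dgY.dg_add) auto
    then show ?case by (simp add: gderiv_mult)
  qed (simp add: dgY.dg_zero flip: mconst_1)
  have prd: "dgY r (\<Sum>v\<in>W. e v * wt v) (gderiv a (\<Prod>v\<in>W. mvar v ^ e v))"
    if "finite W" "\<And>v. v \<in> W \<Longrightarrow> fst v = 0 \<longrightarrow> snd v < r" for W e
    using that
  proof (induction W rule: finite_induct)
    case (insert v W)
    have 1: "dgY r (\<Sum>v\<in>W. e v * wt v) (\<Prod>v\<in>W. mvar v ^ e v)"
      using insert.prems by (intro dgY.dg_prod dgY.dg_power var) auto
    have v: "fst v = 0 \<longrightarrow> snd v < r" using insert.prems by blast
    have "dgY r (e v * wt v + (\<Sum>v\<in>W. e v * wt v))
        (mvar v ^ e v * gderiv a (\<Prod>v\<in>W. mvar v ^ e v) + gderiv a (mvar v ^ e v) * (\<Prod>v\<in>W. mvar v ^ e v))"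
      using insert by (intro dgY.dg_add dgY.dg_mult dgY.dg_power var v pow 1) auto
    then show ?case using insert by (simp add: gderiv_mult)
  qed (simp add: dgY.dg_zero flip: mconst_1)
  have "gderiv a p = (\<Sum>m\<in>keys p. mconst (lookup p m) * gderiv a (mon_val mvar m))"
    by (subst poly_mapping_sum_singles[of p], subst gderiv_sum)
      (simp only: single_eq_const_mult[of _ "lookup p _"] single_eq_mon_val gderiv_mult gderiv_mconst, simp)
  moreover have "dgY r k (mconst c * gderiv a (mon_val mvar m))" if m: "m \<in> keys p" for m c
  proof -
    let ?K = "keys m"
    have ok: "fst v = 0 \<longrightarrow> snd v < r" if "v \<in> ?K" for v
    proof (intro impI, rule ccontr)
      assume v: "fst v = 0" "\<not> snd v < r"
      then have "lookup m (0, snd v) = 0" using p m by (simp add: dgY_def)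
      moreover have "v = (0, snd v)" using v(1) by (simp add: prod_eq_iff)
      ultimately show False using that by (metis in_keys_iff)
    qed
    have "(\<Sum>v\<in>?K. lookup m v * wt v) = (\<Sum>v\<in>{v\<in>?K. fst v = 0}. lookup m v)"
      by (intro sum.mono_neutral_cong_right) (auto simp: wt_def)
    also have "\<dots> \<le> (\<Sum>v\<in>Pair 0 ` {..<r}. lookup m v)"
      using ok by (intro sum_mono2) force+
    also have "\<dots> = (\<Sum>i<r. lookup m (0, i))"
      by (subst sum.reindex) (auto simp: inj_on_def)
    also have "\<dots> \<le> k" using p m by (simp add: dgY_def)
    finally have le: "(\<Sum>v\<in>?K. lookup m v * wt v) \<le> k" .
    show ?thesis
      using dgY.dg_mono[OF prd[OF finite_keys ok] le] by (intro dgY.dg_mult_0) (auto simp: mon_val_def)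
  qed
  ultimately show ?thesis by (simp add: dgY.dg_sum)
qed

definition dY :: "nat \<Rightarrow> gpoly \<Rightarrow> gpoly" where
  "dY r = gderiv (\<lambda>v. if v = (0, r) then 1 else 0)"

definition dL :: "nat \<Rightarrow> nat \<Rightarrow> gpoly \<Rightarrow> gpoly" where
  "dL r c = gderiv (\<lambda>v. if v = (Suc r, c) then 1 else 0)"

definition lin_coeff :: "nat \<Rightarrow> nat \<Rightarrow> gpoly" where
  "lin_coeff i c = (if i = c then 1 else if i < c then Lv i c else 0)"

text \<open>The derivative with respect to the coordinate \<open>u\<^sub>c\<close>, where \<open>Y\<^sub>i = u\<^sub>i + \<Sum>c>i. \<lambda>\<^sub>i\<^sub>c u\<^sub>c\<close>.\<close>

definition grad :: "nat \<Rightarrow> gpoly \<Rightarrow> gpoly" where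
  "grad c = gderiv (\<lambda>v. if fst v = 0 then lin_coeff (snd v) c else 0)"

lemma dgY_lin_coeff [simp]: "dgY r 0 (lin_coeff i c)"
  by (simp add: lin_coeff_def dgY.dg_one dgY.dg_zero)

lemma dgY_grad: "dgY r k p \<Longrightarrow> dgY r k (grad c p)"
  and dgY_dY: "dgY r k p \<Longrightarrow> dgY r k (dY i p)"
  and dgY_dL: "dgY r k p \<Longrightarrow> dgY r k (dL i c p)"
  unfolding grad_def dY_def dL_def
  by (intro dgY_gderiv; simp add: dgY.dg_one dgY.dg_zero)+

lemma up_dY: "up r (dY r p) = pderiv (up r p)"
proof -
  interpret comm_ring_hom "up r" by (rule comm_ring_hom_up)
  show ?thesis
    by (induction p rule: mpoly_induct)
      (simp_all add: dY_def gderiv_add gderiv_mult hom_add hom_mult pderiv_add pderiv_mult up_mvar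
        pderiv_pCons algebra_simps)
qed

definition lift_fps :: "complex fps \<Rightarrow> gpoly fps" where
  "lift_fps f = Abs_fps (\<lambda>k. mconst (fps_nth f k))"

lemma lift_fps_nth [simp]: "fps_nth (lift_fps f) k = mconst (fps_nth f k)"
  by (simp add: lift_fps_def)

lemma fps_deriv_lift_fps: "fps_deriv (lift_fps f) = lift_fps (fps_deriv f)"
  by (rule fps_ext) (simp add: mconst_mult mconst_add mconst_of_nat)

lemma lift_fps_0 [simp]: "lift_fps 0 = 0"
  by (rule fps_ext) simp

definition map_fps :: "('a \<Rightarrow> 'a) \<Rightarrow> 'a fps \<Rightarrow> 'a::comm_ring_1 fps" where
  "map_fps D f = Abs_fps (\<lambda>k. D (fps_nth f k))"

lemma map_fps_nth [simp]: "fps_nth (map_fps D f) k = D (fps_nth f k)"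
  by (simp add: map_fps_def)

text \<open>Differentiation in the parameters acts on coefficients and loses no order, whereas
  \<open>ordge_fps_deriv\<close> loses one.\<close>

lemma ordge_map_fps: "D 0 = 0 \<Longrightarrow> ordge M f \<Longrightarrow> ordge M (map_fps D f)"
  by (simp add: ordge_def)

lemma map_fps_gderiv_mult:
  "map_fps (gderiv a) (f * g) = f * map_fps (gderiv a) g + map_fps (gderiv a) f * g"
  by (rule fps_ext) (simp add: fps_mult_nth gderiv_sum gderiv_mult sum.distrib)

lemma map_fps_gderiv_add: "map_fps (gderiv a) (f + g) = map_fps (gderiv a) f + map_fps (gderiv a) g"
  by (rule fps_ext) (simp add: gderiv_add)

lemma map_fps_gderiv_sum: "map_fps (gderiv a) (\<Sum>x\<in>A. g x) = (\<Sum>x\<in>A. map_fps (gderiv a) (g x))"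
  by (rule fps_ext) (simp add: fps_sum_nth gderiv_sum)

lemma map_fps_gderiv_const: "map_fps (gderiv a) (fps_const p) = fps_const (gderiv a p)"
  by (rule fps_ext) (auto simp: fps_const_def)

lemma map_fps_gderiv_lift_fps [simp]: "map_fps (gderiv a) (lift_fps f) = 0"
  by (rule fps_ext) simp

lemma comm_ring_hom_fps_const_mconst: "comm_ring_hom (\<lambda>c. fps_const (mconst c :: gpoly))"
  by unfold_locales (auto simp: mconst_add mconst_mult simp flip: fps_const_add fps_const_mult)

locale curve =
  fixes N :: nat and u :: "nat \<Rightarrow> complex fps"
  assumes u_outside: "c \<ge> N \<Longrightarrow> u c = 0"
begin

definition U :: "nat \<Rightarrow> gpoly fps" where "U c = lift_fps (u c)"

definition y :: "nat \<Rightarrow> gpoly fps" where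
  "y i = (\<Sum>c<N. fps_const (lin_coeff i c) * U c)"

text \<open>Restriction to the curve with the parameters kept indeterminate, so that orders in t are
  those for generic parameters.\<close>

definition psi :: "gpoly \<Rightarrow> gpoly fps" where
  "psi = msubst (\<lambda>c. fps_const (mconst c)) (\<lambda>v. if fst v = 0 then y (snd v) else fps_const (mvar v))"

lemma comm_ring_hom_psi: "comm_ring_hom psi"
  unfolding psi_def by (intro comm_ring_hom_msubst comm_ring_hom_fps_const_mconst)

sublocale psi: comm_ring_hom psi by (rule comm_ring_hom_psi)

lemma psi_mconst [simp]: "psi (mconst c) = fps_const (mconst c)"
  and psi_mvar: "psi (mvar v) = (if fst v = 0 then y (snd v) else fps_const (mvar v))"
  unfolding psi_def by (simp_all add: msubst_mconst msubst_mvar comm_ring_hom_fps_const_mconst)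

lemma psi_lin_coeff: "psi (lin_coeff i c) = fps_const (lin_coeff i c)"
  by (simp add: lin_coeff_def psi_mvar)

lemma psi_chain_rule: "fps_deriv (psi p) = (\<Sum>c<N. psi (grad c p) * fps_deriv (U c))"
proof (induction p rule: mpoly_induct)
  case (var v)
  show ?case
    by (cases "fst v = 0")
      (simp_all add: psi_mvar grad_def y_def psi_lin_coeff fps_deriv_sum)
next
  case (mult p q)
  then show ?case
    by (simp add: psi.hom_mult grad_def gderiv_mult psi.hom_add ring_distribs sum.distrib sum_distrib_left
        sum_distrib_right mult_ac)
qed (simp_all add: grad_def psi.hom_add gderiv_add ring_distribs sum.distrib)

text \<open>The parameter \<open>Lv r c\<close> enters \<open>psi p\<close> explicitly and through
  \<open>y r\<close>, whose derivative in it is \<open>U c\<close>. If \<open>psi p\<close> has high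
  order, so has the left-hand side, and \<open>U c\<close> becomes approximately minus
  \<open>dL r c p\<close> divided by \<open>dY r p\<close>.\<close>

lemma psi_parameter_rule:
  assumes "r < c" "c < N"
  shows "map_fps (dL r c) (psi p) = psi (dL r c p) + psi (dY r p) * U c"
  unfolding dL_def dY_def
proof (induction p rule: mpoly_induct)
  case (const a)
  then show ?case by (simp add: map_fps_gderiv_const)
next
  case (var v)
  let ?a = "\<lambda>v. if v = (Suc r, c) then 1 else 0"
  show ?case
  proof (cases "fst v = 0")
    case True
    then obtain i where v: "v = (0, i)" by (cases v) auto
    have lc: "gderiv ?a (lin_coeff i c') = (if i = r \<and> c' = c then 1 else 0)" for c'
      using assms by (auto simp: lin_coeff_def simp flip: mconst_1)
    have "map_fps (gderiv ?a) (psi (mvar v)) = (\<Sum>c'<N. fps_const (gderiv ?a (lin_coeff i c')) * U c')"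
      by (simp add: v psi_mvar y_def map_fps_gderiv_sum map_fps_gderiv_mult map_fps_gderiv_const U_def)
    also have "\<dots> = (\<Sum>c'<N. if c' = c then (if i = r then U c else 0) else 0)"
      unfolding lc by (intro sum.cong) auto
    also have "\<dots> = (if i = r then U c else 0)" using assms by simp
    finally show ?thesis by (simp add: v)
  next
    case False
    then have "v \<noteq> (0, r)" by auto
    with False show ?thesis by (simp add: psi_mvar map_fps_gderiv_const)
  qed
next
  case (add p q)
  then show ?case by (simp add: psi.hom_add map_fps_gderiv_add gderiv_add ring_distribs)
next
  case (mult p q)
  then show ?case
    by (simp add: psi.hom_mult psi.hom_add map_fps_gderiv_mult gderiv_mult algebra_simps)
qed

end

subsection \<open>Linear elimination along a curve\<close>

context filtration
begin

text \<open>For the degrees \<open>dgY (Suc r)\<close> and the point \<open>ev r \<alpha>\<close>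
  this is the field generated by the parameters, the first \<open>r\<close> forms and
  \<alpha>.\<close>

definition fracs :: "('a \<Rightarrow> 'o::field) \<Rightarrow> 'o set" where
  "fracs \<eta> = {\<eta> p / \<eta> q | p q. (\<exists>k. dg k p) \<and> (\<exists>k. dg k q) \<and> \<eta> q \<noteq> 0}"

lemma ev_in_fracs: "comm_ring_hom \<eta> \<Longrightarrow> dg k p \<Longrightarrow> \<eta> p \<in> fracs \<eta>"
proof -
  assume "comm_ring_hom \<eta>" and p: "dg k p"
  then interpret comm_ring_hom \<eta> by blast
  show ?thesis unfolding fracs_def mem_Collect_eq
    by (intro exI[of _ p] exI[of _ 1]) (use p dg_one in auto)
qed

lemma fracs_closed:
  assumes \<eta>: "comm_ring_hom \<eta>" and x: "x \<in> fracs \<eta>" and y: "y \<in> fracs \<eta>"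
  shows "x + y \<in> fracs \<eta>" "x * y \<in> fracs \<eta>" "x - y \<in> fracs \<eta>" "x / y \<in> fracs \<eta>"
proof -
  interpret comm_ring_hom \<eta> by (rule \<eta>)
  obtain p q k l where x': "x = \<eta> p / \<eta> q" "dg k p" "dg l q" "\<eta> q \<noteq> 0" using x by (auto simp: fracs_def)
  obtain p' q' k' l' where y': "y = \<eta> p' / \<eta> q'" "dg k' p'" "dg l' q'" "\<eta> q' \<noteq> 0" using y by (auto simp: fracs_def)
  have dgs: "\<exists>k. dg k (a * b)" if "dg i a" "dg j b" for a b i j using dg_mult[OF that] by blast
  have dga: "\<exists>k. dg k (a + b)" if "dg i a" "dg j b" for a b i j
    using dg_add[of "max i j"] dg_mono that by (metis max.cobounded1 max.cobounded2)
  have qq: "\<exists>k. dg k (q * q')" "\<eta> (q * q') \<noteq> 0" using dgs x' y' by (auto simp: hom_mult)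
  have pe: "\<eta> p = x * \<eta> q" "\<eta> p' = y * \<eta> q'" using x' y' by auto
  have "x + y = \<eta> (p * q' + p' * q) / \<eta> (q * q')"
    using x'(4) y'(4) by (simp add: hom_add hom_mult pe field_simps)
  moreover have "\<exists>k. dg k (p * q' + p' * q)" using dga dgs x' y' by metis
  ultimately show "x + y \<in> fracs \<eta>" using qq unfolding fracs_def by blast
  have "x - y = \<eta> (p * q' - p' * q) / \<eta> (q * q')"
    using x'(4) y'(4) by (simp add: hom_minus hom_mult pe field_simps)
  moreover have "\<exists>k. dg k (p * q' - p' * q)"
    using dga dgs x' y' dg_uminus by (metis diff_conv_add_uminus)
  ultimately show "x - y \<in> fracs \<eta>" using qq unfolding fracs_def by blast
  have "x * y = \<eta> (p * p') / \<eta> (q * q')" using x' y' by (simp add: hom_mult)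
  moreover have "\<exists>k. dg k (p * p')" using dgs x' y' by metis
  ultimately show "x * y \<in> fracs \<eta>" using qq unfolding fracs_def by blast
  show "x / y \<in> fracs \<eta>"
  proof (cases "\<eta> p' = 0")
    case True
    then have "x / y = \<eta> 0" using y' by simp
    then show ?thesis using ev_in_fracs[OF \<eta> dg_zero] by metis
  next
    case False
    then have "x / y = \<eta> (p * q') / \<eta> (q * p')" "\<eta> (q * p') \<noteq> 0"
      using x' y' by (simp_all add: hom_mult)
    moreover have "\<exists>k. dg k (p * q')" "\<exists>k. dg k (q * p')" using dgs x' y' by metis+
    ultimately show ?thesis unfolding fracs_def by blast
  qed
qed

lemma fracs_sum:
  assumes \<eta>: "comm_ring_hom \<eta>" and "\<And>i. i \<in> A \<Longrightarrow> g i \<in> fracs \<eta>"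
  shows "(\<Sum>i\<in>A. g i) \<in> fracs \<eta>"
proof -
  interpret comm_ring_hom \<eta> by (rule \<eta>)
  have "0 \<in> fracs \<eta>" using ev_in_fracs[OF \<eta> dg_zero] by simp
  then show ?thesis using assms(2)
    by (induction A rule: infinite_finite_induct) (auto intro: fracs_closed[OF \<eta>])
qed

text \<open>Gaussian elimination in which a pivot must have small order along the curve; coefficients
  of large order are treated as zero.\<close>

lemma linear_elimination:
  fixes \<psi> :: "'a \<Rightarrow> 'b::idom fps" and x :: "'j \<Rightarrow> 'b fps"
  assumes \<psi>: "comm_ring_hom \<psi>" and "finite J"
    and "\<And>\<kappa> \<beta>. \<kappa> \<in> I \<Longrightarrow> \<beta> \<in> J \<Longrightarrow> dg D (G \<kappa> \<beta>)" "\<And>\<kappa>. \<kappa> \<in> I \<Longrightarrow> dg D (g \<kappa>)"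
    and "\<And>\<kappa>. \<kappa> \<in> I \<Longrightarrow> ordge M ((\<Sum>\<beta>\<in>J. \<psi> (G \<kappa> \<beta>) * x \<beta>) - \<psi> (g \<kappa>))"
  shows "\<exists>g0. dg (D * 3 ^ card J) g0 \<and> \<not> ordge (Suc (card J * M)) (\<psi> g0) \<and>
    (\<forall>\<eta> :: 'a \<Rightarrow> 'o::field. comm_ring_hom \<eta> \<longrightarrow>
       (\<forall>z. dg (D * 3 ^ card J) z \<longrightarrow> ordge M (\<psi> z) \<longrightarrow> \<eta> z = 0) \<longrightarrow> \<eta> g0 \<noteq> 0 \<longrightarrow>
       (\<exists>b. (\<forall>\<beta>\<in>J. b \<beta> \<in> fracs \<eta>) \<and> (\<forall>\<kappa>\<in>I. (\<Sum>\<beta>\<in>J. \<eta> (G \<kappa> \<beta>) * b \<beta>) = \<eta> (g \<kappa>))))"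
  using assms(2-)
proof (induction J arbitrary: G g D rule: finite_induct)
  case empty
  interpret \<psi>: comm_ring_hom \<psi> by (rule \<psi>)
  have "\<eta> (g \<kappa>) = 0" if "\<kappa> \<in> I" "\<forall>z. dg D z \<longrightarrow> ordge M (\<psi> z) \<longrightarrow> \<eta> z = 0" for \<kappa> and \<eta> :: "'a \<Rightarrow> 'o"
    using empty(2)[OF that(1)] empty(3)[OF that(1)] that(2) ordge_uminus[of M "- \<psi> (g \<kappa>)"] by auto
  then show ?case
    by (intro exI[of _ 1]) (auto simp: ordge_def intro: dg_mono[OF dg_one])
next
  case (insert \<beta> J)
  interpret \<psi>: comm_ring_hom \<psi> by (rule \<psi>)
  have card: "card (insert \<beta> J) = Suc (card J)" using insert by simp
  show ?case
  proof (cases "\<forall>\<kappa>\<in>I. ordge M (\<psi> (G \<kappa> \<beta>))")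
    case True
    \<comment> \<open>Without a pivot in column \<beta>, dropping the column changes the equations
      by terms of high order only; the unknown is set to 0.\<close>
    have "ordge M ((\<Sum>\<beta>\<in>J. \<psi> (G \<kappa> \<beta>) * x \<beta>) - \<psi> (g \<kappa>))" if "\<kappa> \<in> I" for \<kappa>
    proof -
      have "(\<Sum>\<beta>\<in>J. \<psi> (G \<kappa> \<beta>) * x \<beta>) - \<psi> (g \<kappa>) =
          ((\<Sum>\<beta>\<in>insert \<beta> J. \<psi> (G \<kappa> \<beta>) * x \<beta>) - \<psi> (g \<kappa>)) - \<psi> (G \<kappa> \<beta>) * x \<beta>"
        using insert.hyps by simp
      then show ?thesis using insert.prems(3)[OF that] True that by (simp only: ordge_diff ordge_mult2)
    qed
    with insert.IH[of D G g] insert.prems obtain g0 where g0: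
      "dg (D * 3 ^ card J) g0" "\<not> ordge (Suc (card J * M)) (\<psi> g0)"
      "\<And>\<eta> :: 'a \<Rightarrow> 'o. comm_ring_hom \<eta> \<Longrightarrow>
       (\<forall>z. dg (D * 3 ^ card J) z \<longrightarrow> ordge M (\<psi> z) \<longrightarrow> \<eta> z = 0) \<Longrightarrow> \<eta> g0 \<noteq> 0 \<Longrightarrow>
       (\<exists>b. (\<forall>\<beta>\<in>J. b \<beta> \<in> fracs \<eta>) \<and> (\<forall>\<kappa>\<in>I. (\<Sum>\<beta>\<in>J. \<eta> (G \<kappa> \<beta>) * b \<beta>) = \<eta> (g \<kappa>)))"
      by auto
    have le: "D * 3 ^ card J \<le> D * 3 ^ card (insert \<beta> J)" unfolding card by simp
    show ?thesis
    proof (intro exI[of _ g0] conjI allI impI)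
      show "dg (D * 3 ^ card (insert \<beta> J)) g0" using g0(1) le by (rule dg_mono)
      show "\<not> ordge (Suc (card (insert \<beta> J) * M)) (\<psi> g0)"
        using g0(2) ordge_mono[of "Suc (card (insert \<beta> J) * M)" "\<psi> g0" "Suc (card J * M)"] by (auto simp: card)
      fix \<eta> :: "'a \<Rightarrow> 'o"
      assume \<eta>: "comm_ring_hom \<eta>" "\<forall>z. dg (D * 3 ^ card (insert \<beta> J)) z \<longrightarrow> ordge M (\<psi> z) \<longrightarrow> \<eta> z = 0" "\<eta> g0 \<noteq> 0"
      interpret \<eta>: comm_ring_hom \<eta> by (rule \<eta>)
      obtain b where b: "\<forall>\<beta>\<in>J. b \<beta> \<in> fracs \<eta>" "\<forall>\<kappa>\<in>I. (\<Sum>\<beta>\<in>J. \<eta> (G \<kappa> \<beta>) * b \<beta>) = \<eta> (g \<kappa>)"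
        using g0(3)[OF \<eta>(1) _ \<eta>(3)] \<eta>(2) dg_mono[OF _ le] by blast
      have "(\<Sum>\<beta>'\<in>insert \<beta> J. \<eta> (G \<kappa> \<beta>') * (b(\<beta> := 0)) \<beta>') = (\<Sum>\<beta>\<in>J. \<eta> (G \<kappa> \<beta>) * b \<beta>)" for \<kappa>
        using insert.hyps by (auto intro!: sum.cong)
      moreover have "0 \<in> fracs \<eta>" using ev_in_fracs[OF \<eta>(1) dg_zero] by simp
      ultimately show "\<exists>b. (\<forall>\<beta>\<in>insert \<beta> J. b \<beta> \<in> fracs \<eta>) \<and>
          (\<forall>\<kappa>\<in>I. (\<Sum>\<beta>\<in>insert \<beta> J. \<eta> (G \<kappa> \<beta>) * b \<beta>) = \<eta> (g \<kappa>))"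
        using b by (intro exI[of _ "b(\<beta> := 0)"]) auto
    qed
  next
    case False
    then obtain \<kappa>0 where \<kappa>0: "\<kappa>0 \<in> I" "\<not> ordge M (\<psi> (G \<kappa>0 \<beta>))" by blast
    define piv where "piv = G \<kappa>0 \<beta>"
    define G' where "G' \<kappa> \<beta>' = piv * G \<kappa> \<beta>' - G \<kappa> \<beta> * G \<kappa>0 \<beta>'" for \<kappa> \<beta>'
    define g' where "g' \<kappa> = piv * g \<kappa> - G \<kappa> \<beta> * g \<kappa>0" for \<kappa>
    have dgG: "dg (D + D) (G' \<kappa> \<beta>')" if "\<kappa> \<in> I" "\<beta>' \<in> J" for \<kappa> \<beta>'
      unfolding G'_def piv_def using insert.prems(1) that \<kappa>0 by (intro dg_diff dg_mult) auto
    have dgg: "dg (D + D) (g' \<kappa>)" if "\<kappa> \<in> I" for \<kappa>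
      unfolding g'_def piv_def using insert.prems that \<kappa>0 by (intro dg_diff dg_mult) auto
    have row: "(\<Sum>\<beta>'\<in>J. h (G' \<kappa> \<beta>') * t \<beta>') - h (g' \<kappa>) =
        h piv * ((\<Sum>\<beta>'\<in>insert \<beta> J. h (G \<kappa> \<beta>') * t \<beta>') - h (g \<kappa>)) -
        h (G \<kappa> \<beta>) * ((\<Sum>\<beta>'\<in>insert \<beta> J. h (G \<kappa>0 \<beta>') * t \<beta>') - h (g \<kappa>0))"
      if "comm_ring_hom h" for \<kappa> t and h :: "'a \<Rightarrow> 'h::comm_ring_1"
    proof -
      interpret h: comm_ring_hom h by (rule that)
      have "(\<Sum>\<beta>'\<in>J. h (G' \<kappa> \<beta>') * t \<beta>') =
          h piv * (\<Sum>\<beta>'\<in>J. h (G \<kappa> \<beta>') * t \<beta>') - h (G \<kappa> \<beta>) * (\<Sum>\<beta>'\<in>J. h (G \<kappa>0 \<beta>') * t \<beta>')"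
        unfolding G'_def h.hom_minus h.hom_mult sum_distrib_left by (simp add: algebra_simps sum_subtractf)
      then show ?thesis
        unfolding g'_def h.hom_minus h.hom_mult using insert.hyps by (simp add: algebra_simps piv_def)
    qed
    have ordG: "ordge M ((\<Sum>\<beta>'\<in>J. \<psi> (G' \<kappa> \<beta>') * x \<beta>') - \<psi> (g' \<kappa>))" if "\<kappa> \<in> I" for \<kappa>
      unfolding row[OF \<psi>]
      by (rule ordge_diff[OF ordge_mult[OF insert.prems(3)[OF that]] ordge_mult[OF insert.prems(3)[OF \<kappa>0(1)]]])
    obtain g0 where g0:
      "dg ((D + D) * 3 ^ card J) g0" "\<not> ordge (Suc (card J * M)) (\<psi> g0)"
      "\<And>\<eta> :: 'a \<Rightarrow> 'o. comm_ring_hom \<eta> \<Longrightarrow>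
       (\<forall>z. dg ((D + D) * 3 ^ card J) z \<longrightarrow> ordge M (\<psi> z) \<longrightarrow> \<eta> z = 0) \<Longrightarrow> \<eta> g0 \<noteq> 0 \<Longrightarrow>
       (\<exists>b. (\<forall>\<beta>\<in>J. b \<beta> \<in> fracs \<eta>) \<and> (\<forall>\<kappa>\<in>I. (\<Sum>\<beta>\<in>J. \<eta> (G' \<kappa> \<beta>) * b \<beta>) = \<eta> (g' \<kappa>)))"
      using insert.IH[of "D + D" G' g', OF dgG dgg ordG] by auto
    \<comment> \<open>The reduced system has degree \<open>D + D\<close> and the pivot contributes
      another \<open>D\<close>, hence a factor 3 per unknown.\<close>
    have le: "(D + D) * 3 ^ card J \<le> D * 3 ^ card (insert \<beta> J)"
      and le': "D + (D + D) * 3 ^ card J \<le> D * 3 ^ card (insert \<beta> J)"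
      unfolding card by (simp_all add: algebra_simps)
    \<comment> \<open>The product of all pivots is returned: where it does not vanish, back
      substitution succeeds.\<close>
    show ?thesis
    proof (intro exI[of _ "piv * g0"] conjI allI impI)
      have "dg D piv" using insert.prems(1) \<kappa>0 by (simp add: piv_def)
      from dg_mult[OF this g0(1)] show "dg (D * 3 ^ card (insert \<beta> J)) (piv * g0)" using le' by (rule dg_mono)
      have "Suc (card (insert \<beta> J) * M) = M + Suc (card J * M)" by (simp add: card)
      then show "\<not> ordge (Suc (card (insert \<beta> J) * M)) (\<psi> (piv * g0))"
        using not_ordge_mult[OF \<kappa>0(2) g0(2)] by (simp add: \<psi>.hom_mult piv_def)
      fix \<eta> :: "'a \<Rightarrow> 'o"
      assume \<eta>: "comm_ring_hom \<eta>" "\<forall>z. dg (D * 3 ^ card (insert \<beta> J)) z \<longrightarrow> ordge M (\<psi> z) \<longrightarrow> \<eta> z = 0"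
        "\<eta> (piv * g0) \<noteq> 0"
      interpret \<eta>: comm_ring_hom \<eta> by (rule \<eta>)
      have piv0: "\<eta> piv \<noteq> 0" and g00: "\<eta> g0 \<noteq> 0" using \<eta>(3) by (auto simp: \<eta>.hom_mult)
      obtain b where b: "\<forall>\<beta>\<in>J. b \<beta> \<in> fracs \<eta>" "\<forall>\<kappa>\<in>I. (\<Sum>\<beta>\<in>J. \<eta> (G' \<kappa> \<beta>) * b \<beta>) = \<eta> (g' \<kappa>)"
        using g0(3)[OF \<eta>(1) _ g00] \<eta>(2) dg_mono[OF _ le] by blast
      define b' where "b' = b(\<beta> := (\<eta> (g \<kappa>0) - (\<Sum>\<beta>'\<in>J. \<eta> (G \<kappa>0 \<beta>') * b \<beta>')) / \<eta> piv)"
      have sumJ: "(\<Sum>\<beta>'\<in>J. \<eta> (H \<beta>') * b' \<beta>') = (\<Sum>\<beta>'\<in>J. \<eta> (H \<beta>') * b \<beta>')" for H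
        using insert.hyps by (auto simp: b'_def intro!: sum.cong)
      have r0: "(\<Sum>\<beta>'\<in>insert \<beta> J. \<eta> (G \<kappa>0 \<beta>') * b' \<beta>') = \<eta> (g \<kappa>0)"
        using insert.hyps piv0 by (simp add: sumJ) (simp add: b'_def piv_def)
      have "(\<Sum>\<beta>'\<in>insert \<beta> J. \<eta> (G \<kappa> \<beta>') * b' \<beta>') = \<eta> (g \<kappa>)" if "\<kappa> \<in> I" for \<kappa>
      proof -
        have "\<eta> piv * ((\<Sum>\<beta>'\<in>insert \<beta> J. \<eta> (G \<kappa> \<beta>') * b' \<beta>') - \<eta> (g \<kappa>)) = 0"
          using row[OF \<eta>(1), of \<kappa> b'] b(2) that r0 by (simp add: sumJ)
        then show ?thesis using piv0 by simp
      qed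
      moreover have "b' \<beta>' \<in> fracs \<eta>" if "\<beta>' \<in> insert \<beta> J" for \<beta>'
      proof (cases "\<beta>' = \<beta>")
        case True
        have "dg D piv" "dg D (g \<kappa>0)" "\<And>\<beta>'. \<beta>' \<in> J \<Longrightarrow> dg D (G \<kappa>0 \<beta>')"
          using insert.prems \<kappa>0 by (auto simp: piv_def)
        then show ?thesis
          using b(1) True by (auto simp: b'_def intro!: fracs_closed[OF \<eta>(1)] fracs_sum[OF \<eta>(1)] ev_in_fracs[OF \<eta>(1)])
      qed (use b(1) that in \<open>auto simp: b'_def\<close>)
      ultimately show "\<exists>b. (\<forall>\<beta>\<in>insert \<beta> J. b \<beta> \<in> fracs \<eta>) \<and>
          (\<forall>\<kappa>\<in>I. (\<Sum>\<beta>\<in>insert \<beta> J. \<eta> (G \<kappa> \<beta>) * b \<beta>) = \<eta> (g \<kappa>))" by blast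
    qed
  qed
qed

subsection \<open>Derivations on fields of fractions\<close>

text \<open>By \<open>stable\<close>, \<Delta> depends only on the image under \<eta>, so the
  quotient rule gives the same value for all representations of a fraction.\<close>

lemma derivation_on_fracs:
  fixes \<eta> :: "'a \<Rightarrow> 'o::field"
  assumes \<eta>: "comm_ring_hom \<eta>"
    and add: "\<And>p q. \<Delta> (p + q) = \<Delta> p + \<Delta> q"
    and mult: "\<And>p q. \<Delta> (p * q) = \<eta> p * \<Delta> q + \<Delta> p * \<eta> q"
    and closed: "\<And>k p. dg k p \<Longrightarrow> \<Delta> p \<in> fracs \<eta>"
    and stable: "\<And>k p. dg k p \<Longrightarrow> \<eta> p = 0 \<Longrightarrow> \<Delta> p = 0"
  obtains D where "\<And>p q k l. dg k p \<Longrightarrow> dg l q \<Longrightarrow> \<eta> q \<noteq> 0 \<Longrightarrow> D (\<eta> p / \<eta> q) = (\<Delta> p - \<eta> p / \<eta> q * \<Delta> q) / \<eta> q"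
    "\<And>x. x \<in> fracs \<eta> \<Longrightarrow> D x \<in> fracs \<eta>"
    "\<And>x y. x \<in> fracs \<eta> \<Longrightarrow> y \<in> fracs \<eta> \<Longrightarrow> D (x + y) = D x + D y"
    "\<And>x y. x \<in> fracs \<eta> \<Longrightarrow> y \<in> fracs \<eta> \<Longrightarrow> D (x * y) = x * D y + D x * y"
proof -
  interpret comm_ring_hom \<eta> by (rule \<eta>)
  define Pr where "Pr x d \<longleftrightarrow> (\<exists>p q k l. dg k p \<and> dg l q \<and> \<eta> q \<noteq> 0 \<and> x = \<eta> p / \<eta> q \<and> d = (\<Delta> p - x * \<Delta> q) / \<eta> q)" for x d
  define D where "D x = (SOME d. Pr x d)" for x
  have min: "\<Delta> (p - q) = \<Delta> p - \<Delta> q" for p q using add[of "p - q" q] by simp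
  have uniq: "d = d'" if d1: "Pr x d" and d2: "Pr x d'" for x d d'
  proof -
    obtain p q k l where 1: "dg k p" "dg l q" "\<eta> q \<noteq> 0" "x = \<eta> p / \<eta> q" "d = (\<Delta> p - x * \<Delta> q) / \<eta> q"
      using d1 unfolding Pr_def by blast
    obtain p' q' k' l' where 2: "dg k' p'" "dg l' q'" "\<eta> q' \<noteq> 0" "x = \<eta> p' / \<eta> q'" "d' = (\<Delta> p' - x * \<Delta> q') / \<eta> q'"
      using d2 unfolding Pr_def by blast
    have "\<eta> p = x * \<eta> q" using 1(3,4) by simp
    moreover have "\<eta> p' = x * \<eta> q'" using 2(3,4) by simp
    ultimately have p: "\<eta> p = x * \<eta> q" "\<eta> p' = x * \<eta> q'" .
    have "\<eta> (p * q' - p' * q) = 0" by (simp add: hom_minus hom_mult p)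
    moreover have "dg (max (k + l') (k' + l)) (p * q' - p' * q)"
      using dg_mult[OF 1(1) 2(2)] dg_mult[OF 2(1) 1(2)] by (intro dg_diff) (auto intro: dg_mono)
    ultimately have "\<Delta> (p * q' - p' * q) = 0" using stable by blast
    then have "\<eta> q' * (\<Delta> p - x * \<Delta> q) = \<eta> q * (\<Delta> p' - x * \<Delta> q')"
      by (simp add: min mult p algebra_simps)
    then show ?thesis unfolding 1(5) 2(5) using 1(3) 2(3) by (simp add: frac_eq_eq mult.commute)
  qed
  have D_eq: "D x = d" if "Pr x d" for x d
    unfolding D_def using that uniq by (metis someI_ex)
  have rep: "\<exists>p q k l. dg k p \<and> dg l q \<and> \<eta> q \<noteq> 0 \<and> x = \<eta> p / \<eta> q" if "x \<in> fracs \<eta>" for x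
    using that by (auto simp: fracs_def)
  have D_frac: "D (\<eta> p / \<eta> q) = (\<Delta> p - \<eta> p / \<eta> q * \<Delta> q) / \<eta> q" if "dg k p" "dg l q" "\<eta> q \<noteq> 0" for p q k l
    by (rule D_eq) (use that in \<open>auto simp: Pr_def\<close>)
  show ?thesis
  proof (rule that[of D])
    show "D (\<eta> p / \<eta> q) = (\<Delta> p - \<eta> p / \<eta> q * \<Delta> q) / \<eta> q" if "dg k p" "dg l q" "\<eta> q \<noteq> 0" for p q k l
      using D_frac that by blast
    show "D x \<in> fracs \<eta>" if x: "x \<in> fracs \<eta>" for x
    proof -
      obtain p q k l where 1: "dg k p" "dg l q" "\<eta> q \<noteq> 0" "x = \<eta> p / \<eta> q" using rep[OF x] by blast
      show ?thesis unfolding 1(4) D_frac[OF 1(1-3)] using x 1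
        by (auto intro!: fracs_closed[OF \<eta>] closed ev_in_fracs[OF \<eta>])
    qed
    fix x y assume x: "x \<in> fracs \<eta>" and y: "y \<in> fracs \<eta>"
    obtain p q k l where 1: "dg k p" "dg l q" "\<eta> q \<noteq> 0" "x = \<eta> p / \<eta> q" using rep[OF x] by blast
    obtain p' q' k' l' where 2: "dg k' p'" "dg l' q'" "\<eta> q' \<noteq> 0" "y = \<eta> p' / \<eta> q'" using rep[OF y] by blast
    have p: "\<eta> p = x * \<eta> q" "\<eta> p' = y * \<eta> q'" using 1 2 by auto
    have Dx: "D x = (\<Delta> p - x * \<Delta> q) / \<eta> q" using D_frac[OF 1(1-3)] 1(4) by simp
    have Dy: "D y = (\<Delta> p' - y * \<Delta> q') / \<eta> q'" using D_frac[OF 2(1-3)] 2(4) by simp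
    have qq: "dg (l + l') (q * q')" "\<eta> (q * q') \<noteq> 0" using 1 2 dg_mult by (auto simp: hom_mult)
    have "dg (max (k + l') (k' + l)) (p * q' + p' * q)"
      using dg_mult[OF 1(1) 2(2)] dg_mult[OF 2(1) 1(2)] by (intro dg_add) (auto intro: dg_mono)
    from D_frac[OF this qq]
    have "D (\<eta> (p * q' + p' * q) / \<eta> (q * q')) =
      (\<Delta> (p * q' + p' * q) - \<eta> (p * q' + p' * q) / \<eta> (q * q') * \<Delta> (q * q')) / \<eta> (q * q')" .
    moreover have "\<eta> (p * q' + p' * q) / \<eta> (q * q') = x + y"
      using 1(3) 2(3) by (simp add: hom_add hom_mult p field_simps)
    ultimately have "D (x + y) = (\<Delta> (p * q' + p' * q) - (x + y) * \<Delta> (q * q')) / \<eta> (q * q')" by simp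
    also have "\<Delta> (p * q' + p' * q) - (x + y) * \<Delta> (q * q') = \<eta> q' * (\<Delta> p - x * \<Delta> q) + \<eta> q * (\<Delta> p' - y * \<Delta> q')"
      by (simp add: add mult p algebra_simps)
    also have "\<dots> / \<eta> (q * q') = D x + D y"
      unfolding Dx Dy using 1(3) 2(3) by (simp add: hom_mult field_simps)
    finally show "D (x + y) = D x + D y" .
    from D_frac[OF dg_mult[OF 1(1) 2(1)] qq]
    have "D (\<eta> (p * p') / \<eta> (q * q')) = (\<Delta> (p * p') - \<eta> (p * p') / \<eta> (q * q') * \<Delta> (q * q')) / \<eta> (q * q')" .
    moreover have "\<eta> (p * p') / \<eta> (q * q') = x * y"
      using 1(3) 2(3) by (simp add: hom_mult p field_simps)
    ultimately have "D (x * y) = (\<Delta> (p * p') - x * y * \<Delta> (q * q')) / \<eta> (q * q')" by simp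
    also have "\<Delta> (p * p') - x * y * \<Delta> (q * q') = y * \<eta> q' * (\<Delta> p - x * \<Delta> q) + x * \<eta> q * (\<Delta> p' - y * \<Delta> q')"
      by (simp add: mult p algebra_simps)
    also have "\<dots> / \<eta> (q * q') = x * D y + D x * y"
      unfolding Dx Dy using 1(3) 2(3) by (simp add: hom_mult field_simps)
    finally show "D (x * y) = x * D y + D x * y" .
  qed
qed

text \<open>Substitution of \<open>z\<close> commutes with the derivations, so it kills all
  derivatives of \<open>f\<close> and the ideal they generate, but not 1. As \<open>D\<close> is a
  derivation on \<open>E\<close> only, membership in \<open>E\<close> is carried through the
  induction.\<close>

lemma not_unit_diff_ideal_if_solution:
  fixes D :: "'o::field \<Rightarrow> 'o"
  assumes \<kappa>: "comm_ring_hom \<kappa>" "\<And>c. \<kappa> c \<in> E" "\<And>c. D (\<kappa> c) = 0"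
    and E: "\<And>x y. x \<in> E \<Longrightarrow> y \<in> E \<Longrightarrow> x + y \<in> E" "\<And>x y. x \<in> E \<Longrightarrow> y \<in> E \<Longrightarrow> x * y \<in> E"
    and D: "\<And>x y. x \<in> E \<Longrightarrow> y \<in> E \<Longrightarrow> D (x + y) = D x + D y"
      "\<And>x y. x \<in> E \<Longrightarrow> y \<in> E \<Longrightarrow> D (x * y) = x * D y + D x * y"
    and z: "\<And>v. z v \<in> E" "\<And>v. D (z v) = z (dshift v)"
    and f: "\<And>i. i < s \<Longrightarrow> msubst \<kappa> z (f i) = 0"
  shows "1 \<notin> diff_ideal s f"
proof
  interpret ms: comm_ring_hom "msubst \<kappa> z" by (rule comm_ring_hom_msubst[OF \<kappa>(1)])
  have main: "msubst \<kappa> z p \<in> E \<and> D (msubst \<kappa> z p) = msubst \<kappa> z (dderiv p)" for p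
    by (induction p rule: mpoly_induct)
      (simp_all add: msubst_mconst msubst_mvar \<kappa> z ms.hom_add ms.hom_mult E D dderiv_add dderiv_mult)
  have D0: "D 0 = 0"
  proof -
    interpret \<kappa>: comm_ring_hom \<kappa> by (rule \<kappa>)
    show ?thesis using \<kappa>(3)[of 0] by simp
  qed
  have "msubst \<kappa> z (dderivs k p) = 0" if "msubst \<kappa> z p = 0" for k p
    using that
  proof (induction k arbitrary: p)
    case (Suc k)
    have "msubst \<kappa> z (dderiv p) = 0" using main[of p] Suc.prems D0 by simp
    from Suc.IH[OF this] show ?case by (simp add: dderivs_Suc)
  qed simp
  then have gen: "msubst \<kappa> z t = 0" if "t \<in> {dderivs k (f i) | i k. i < s}" for t using that f by auto
  assume "1 \<in> diff_ideal s f"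
  then obtain T g where T: "T \<subseteq> {dderivs k (f i) | i k. i < s}" "1 = (\<Sum>t\<in>T. g t * t)"
    by (auto simp: diff_ideal_def ideal_gen_def ideal_in_def)
  from arg_cong[OF T(2), of "msubst \<kappa> z"]
  have "msubst \<kappa> z 1 = (\<Sum>t\<in>T. msubst \<kappa> z (g t) * msubst \<kappa> z t)"
    by (simp only: ms.hom_sum ms.hom_mult)
  also have "\<dots> = 0" using T(1) gen by (intro sum.neutral) auto
  finally show False by simp
qed

end

lemma dvd_if_simple_roots_subset:
  fixes p w :: "'o::alg_closed_field poly"
  assumes "p \<noteq> 0" "\<And>x. poly p x = 0 \<Longrightarrow> poly w x = 0" "\<And>x. poly p x = 0 \<Longrightarrow> poly (pderiv p) x \<noteq> 0"
  shows "p dvd w"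
  using assms
proof (induction "degree p" arbitrary: p w rule: less_induct)
  case less
  show ?case
  proof (cases "degree p = 0")
    case True
    then show ?thesis using less.prems(1) by (metis is_unit_iff_degree unit_imp_dvd)
  next
    case False
    then obtain x where x: "poly p x = 0" using alg_closed_imp_poly_has_root[of p] by auto
    then obtain p' where p': "p = [:- x, 1:] * p'" by (metis dvdE poly_eq_0_iff_dvd)
    then have p'0: "p' \<noteq> 0" using less.prems by auto
    then have "degree p = degree [:- x, 1:] + degree p'" unfolding p' by (intro degree_mult_eq) auto
    then have deg: "degree p' < degree p" by simp
    obtain w' where w': "w = [:- x, 1:] * w'" using less.prems(2)[OF x] by (metis dvdE poly_eq_0_iff_dvd)
    have dp: "pderiv p = [:- x, 1:] * pderiv p' + p' * pderiv [:- x, 1:]" by (simp only: p' pderiv_mult)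
    have p'x: "poly p' x \<noteq> 0" using less.prems(3)[OF x] unfolding dp by (simp add: pderiv_pCons)
    have "p' dvd w'"
    proof (rule less.hyps[OF deg p'0])
      fix y assume y: "poly p' y = 0"
      then have yx: "y \<noteq> x" and py: "poly p y = 0" using p'x by (auto simp: p')
      show "poly w' y = 0" using less.prems(2)[OF py] yx by (simp add: w')
      show "poly (pderiv p') y \<noteq> 0" using less.prems(3)[OF py] y unfolding dp by auto
    qed
    then show ?thesis unfolding p' w' by (rule mult_dvd_mono[OF dvd_refl])
  qed
qed

text \<open>Since \<open>H\<close> may be reducible, vanishing of \<open>p\<close> at \<alpha> does
  not make \<open>H\<close> divide \<open>p\<close>. Root selection supplies \<open>W\<close>,
  vanishing at exactly those roots of \<open>H\<close> where \<open>p\<close> does not; then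
  \<open>H\<close> divides \<open>W * p\<close> up to a leading coefficient, and \<open>W\<close> is
  nonzero at \<alpha>. Differentiating this identity at \<alpha> leaves a nonzero multiple of
  \<open>\<Delta> p\<close>.\<close>

lemma generic_derivation_stable:
  fixes \<Delta> :: "gpoly \<Rightarrow> gfield"
  assumes mult: "\<And>p q. \<Delta> (p * q) = ev r \<alpha> p * \<Delta> q + \<Delta> p * ev r \<alpha> q"
    and H: "dgY.dgp r k H" "H \<noteq> 0" "poly (map_poly emb H) \<alpha> = 0"
      "\<And>x. poly (map_poly emb H) x = 0 \<Longrightarrow> poly (map_poly emb (pderiv H)) x \<noteq> 0"
    and zero: "\<Delta> (poly H (Yv r)) = 0"
    and p: "dgY (Suc r) l p" "ev r \<alpha> p = 0"
  shows "\<Delta> p = 0"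
proof -
  interpret mp: map_poly_inj_comm_ring_hom emb ..
  obtain W k' where W: "dgY.dgp r k' W"
    "\<And>x. poly (map_poly emb W) x = 0 \<longleftrightarrow> poly (map_poly emb H) x = 0 \<and> poly (map_poly emb (up r p)) x \<noteq> 0"
    using ge.bounded_root_selection[OF H(1,2) dgp_up[OF p(1)]] by metis
  have pd: "map_poly emb (pderiv H) = pderiv (map_poly emb H)"
    by (rule poly_eqI) (simp add: coeff_pderiv emb.hom_mult emb.hom_add emb.hom_of_nat)
  have "map_poly emb H dvd map_poly emb (W * up r p)"
  proof (rule dvd_if_simple_roots_subset)
    show "map_poly emb H \<noteq> 0" using H(2) by simp
    fix x assume x: "poly (map_poly emb H) x = 0"
    then show "poly (map_poly emb (W * up r p)) x = 0" using W(2)[of x] by (auto simp: mp.hom_mult)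
    show "poly (pderiv (map_poly emb H)) x \<noteq> 0" using H(4)[OF x] by (simp add: pd)
  qed
  then obtain B j where "smult (lead_coeff H ^ j) (W * up r p) = H * B"
    using ge.pseudo_division_exact[OF H(2)] by metis
  then have "poly (smult (lead_coeff H ^ j) (W * up r p)) (Yv r) = poly (H * B) (Yv r)" by simp
  then have eq: "(lead_coeff H ^ j * poly W (Yv r)) * p = poly H (Yv r) * poly B (Yv r)"
    by (simp add: poly_up mult.assoc)
  have evH: "ev r \<alpha> (poly H (Yv r)) = 0" using H(3) by (simp add: ev_eq_poly_up up_poly[OF H(1)])
  have "ev r \<alpha> (poly W (Yv r)) \<noteq> 0"
    using W(2)[of \<alpha>] p(2) by (simp add: ev_eq_poly_up up_poly[OF W(1)])
  moreover have "ev r \<alpha> (lead_coeff H) \<noteq> 0"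
    using H(1,2) by (subst ev_eq_emb[of r k]) (auto simp: dgY.dgp_def)
  ultimately have "ev r \<alpha> (lead_coeff H ^ j * poly W (Yv r)) \<noteq> 0" by (simp add: ev.hom_mult ev.hom_power)
  moreover have "ev r \<alpha> (lead_coeff H ^ j * poly W (Yv r)) * \<Delta> p = 0"
    using arg_cong[OF eq, of \<Delta>] mult[of "lead_coeff H ^ j * poly W (Yv r)" p]
      mult[of "poly H (Yv r)" "poly B (Yv r)"] p(2) evH zero by simp
  ultimately show ?thesis by simp
qed

subsection \<open>Homogenization and coordinates\<close>

definition mon_deg :: "('v \<Rightarrow>\<^sub>0 nat) \<Rightarrow> nat" where
  "mon_deg m = (\<Sum>v\<in>keys m. lookup m v)"

lemma mon_deg_le_total_degree: "m \<in> keys p \<Longrightarrow> mon_deg m \<le> total_degree p"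
  unfolding total_degree_def mon_deg_def by (auto intro!: Max_ge)

lemma mon_val_scale: "mon_val (\<lambda>v. a * w v) m = a ^ mon_deg m * mon_val w m"
  by (simp add: mon_val_def mon_deg_def power_mult_distrib prod.distrib power_sum)

text \<open>The expression s^d f(p/s) without division, for any common bound \<open>d\<close> on the
  degrees of the equations.\<close>

definition homog :: "nat \<Rightarrow> gpoly \<Rightarrow> ('v \<Rightarrow> gpoly) \<Rightarrow> 'v mpoly \<Rightarrow> gpoly" where
  "homog d s p f = (\<Sum>m\<in>keys f. mconst (lookup f m) * (s ^ (d - mon_deg m) * mon_val p m))"

lemma hom_mon_val: "comm_ring_hom \<chi> \<Longrightarrow> \<chi> (mon_val p m) = mon_val (\<lambda>v. \<chi> (p v)) m"
proof -
  assume "comm_ring_hom \<chi>"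
  then interpret comm_ring_hom \<chi> .
  show ?thesis by (simp add: mon_val_def hom_prod hom_power)
qed

lemma hom_homog:
  assumes "comm_ring_hom \<chi>"
  shows "\<chi> (homog d s p f) = (\<Sum>m\<in>keys f.
     \<chi> (mconst (lookup f m)) * (\<chi> s ^ (d - mon_deg m) * mon_val (\<lambda>v. \<chi> (p v)) m))"
proof -
  interpret comm_ring_hom \<chi> by (rule assms)
  show ?thesis by (simp add: homog_def hom_sum hom_mult hom_power hom_mon_val[OF assms])
qed

lemma scaled_msubst:
  assumes "total_degree f \<le> d"
  shows "\<sigma> ^ d * msubst \<kappa> w f = (\<Sum>m\<in>keys f.
     \<kappa> (lookup f m) * (\<sigma> ^ (d - mon_deg m) * mon_val (\<lambda>v. \<sigma> * w v) m))"
  unfolding msubst_def sum_distrib_left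
proof (intro sum.cong refl)
  fix m assume "m \<in> keys f"
  then have "\<sigma> ^ d = \<sigma> ^ (d - mon_deg m) * \<sigma> ^ mon_deg m"
    using mon_deg_le_total_degree[of m f] assms by (simp flip: power_add)
  then show "\<sigma> ^ d * (\<kappa> (lookup f m) * mon_val w m) =
      \<kappa> (lookup f m) * (\<sigma> ^ (d - mon_deg m) * mon_val (\<lambda>v. \<sigma> * w v) m)"
    by (simp add: mon_val_scale mult_ac)
qed

lemma homog_exact:
  assumes "comm_ring_hom \<chi>" "total_degree f \<le> d" "\<And>v. v \<in> vars f \<Longrightarrow> \<chi> s * w v = \<chi> (p v)"
  shows "\<chi> (homog d s p f) = \<chi> s ^ d * msubst (\<lambda>c. \<chi> (mconst c)) w f"
  unfolding hom_homog[OF assms(1)] scaled_msubst[OF assms(2)]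
  using assms(3)[symmetric] by (intro sum.cong refl arg_cong2[of _ _ _ _ "(*)"] mon_val_cong) (auto simp: vars_def)

lemma ordge_prod_diff:
  fixes a b :: "'v \<Rightarrow> 'a::comm_ring_1 fps"
  assumes "\<And>v. v \<in> W \<Longrightarrow> ordge M (a v - b v)"
  shows "ordge M ((\<Prod>v\<in>W. a v) - (\<Prod>v\<in>W. b v))"
  using assms
proof (induction W rule: infinite_finite_induct)
  case (insert v W)
  have "a v * prod a W - b v * prod b W = (a v - b v) * prod a W + b v * (prod a W - prod b W)"
    by (simp add: algebra_simps)
  moreover have "ordge M ((a v - b v) * prod a W + b v * (prod a W - prod b W))"
    using insert by (intro ordge_add ordge_mult ordge_mult2) auto
  ultimately show ?case using insert by simp
qed auto

lemma ordge_power_diff: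
  fixes a b :: "'a::comm_ring_1 fps"
  assumes "ordge M (a - b)"
  shows "ordge M (a ^ k - b ^ k)"
  using ordge_prod_diff[of "{..<k}" M "\<lambda>_. a" "\<lambda>_. b"] assms by simp

text \<open>The counterpart of \<open>homog_exact\<close> for the curve, on which
  \<open>s * w = p\<close> holds only modulo t^M; such congruences pass through sums and
  products.\<close>

lemma homog_approx:
  fixes \<chi> :: "gpoly \<Rightarrow> 'a::comm_ring_1 fps"
  assumes "comm_ring_hom \<chi>" "total_degree f \<le> d" "\<And>v. v \<in> vars f \<Longrightarrow> ordge M (\<chi> s * w v - \<chi> (p v))"
  shows "ordge M (\<chi> s ^ d * msubst (\<lambda>c. \<chi> (mconst c)) w f - \<chi> (homog d s p f))"
proof -
  have "\<chi> s ^ d * msubst (\<lambda>c. \<chi> (mconst c)) w f - \<chi> (homog d s p f) = (\<Sum>m\<in>keys f.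
     \<chi> (mconst (lookup f m)) * (\<chi> s ^ (d - mon_deg m) *
       (mon_val (\<lambda>v. \<chi> s * w v) m - mon_val (\<lambda>v. \<chi> (p v)) m)))"
    unfolding hom_homog[OF assms(1)] scaled_msubst[OF assms(2)]
    by (simp add: sum_subtractf right_diff_distrib)
  moreover have "ordge M (mon_val (\<lambda>v. \<chi> s * w v) m - mon_val (\<lambda>v. \<chi> (p v)) m)"
    if "m \<in> keys f" for m
    unfolding mon_val_def using assms(3) that
    by (intro ordge_prod_diff ordge_power_diff) (auto simp: vars_def)
  ultimately show ?thesis by (simp add: ordge_sum ordge_mult)
qed

lemma dgY_homog:
  assumes "dgY r k s" "\<And>v. v \<in> vars f \<Longrightarrow> dgY r k (p v)" "total_degree f \<le> d"
  shows "dgY r (d * k) (homog d s p f)"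
  unfolding homog_def
proof (rule dgY.dg_sum)
  fix m assume m: "m \<in> keys f"
  have "dgY r ((d - mon_deg m) * k + (\<Sum>v\<in>keys m. lookup m v * k))
      (s ^ (d - mon_deg m) * mon_val p m)"
    unfolding mon_val_def using assms(1,2) m
    by (intro dgY.dg_mult dgY.dg_power dgY.dg_prod) (auto simp: vars_def)
  moreover have "(d - mon_deg m) * k + (\<Sum>v\<in>keys m. lookup m v * k) = d * k"
    using mon_deg_le_total_degree[OF m] assms(3)
    by (simp add: mon_deg_def flip: sum_distrib_right add_mult_distrib)
  ultimately show "dgY r (d * k) (mconst (lookup f m) * (s ^ (d - mon_deg m) * mon_val p m))"
    by (simp add: dgY.dg_mult_0)
qed

text \<open>On the hypersurface \<open>Q = 0\<close> the coordinate \<open>u\<^sub>c\<close> is the quotient of \<open>pcoord N r Q c\<close> by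
  \<open>\<partial>Q/\<partial>Y\<^sub>r\<close>: for \<open>c > r\<close> this is the derivative of \<open>Q = 0\<close> with respect to \<open>\<lambda>\<^sub>r\<^sub>c\<close>, and for
  \<open>c \<le> r\<close> one solves the linear equation defining \<open>Y\<^sub>c\<close>.\<close>

function pcoord :: "nat \<Rightarrow> nat \<Rightarrow> gpoly \<Rightarrow> nat \<Rightarrow> gpoly" where
  "pcoord N r Q i = (if r < i then - dL r i Q
     else dY r Q * Yv i - (\<Sum>c\<in>{i<..<N}. Lv i c * pcoord N r Q c))"
  by auto
termination by (relation "measure (\<lambda>(N, r, Q, i). Suc r - i)") auto

declare pcoord.simps [simp del]

lemma dgY_pcoord: "dgY (Suc r) k Q \<Longrightarrow> dgY (Suc r) (Suc k) (pcoord N r Q i)"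
proof (induction N r Q i rule: pcoord.induct)
  case (1 N r Q i)
  show ?case
  proof (cases "r < i")
    case True
    have "dgY (Suc r) k (- dL r i Q)" by (rule dgY.dg_uminus[OF dgY_dL[OF 1(2)]])
    then show ?thesis using True by (subst pcoord.simps) (auto intro: dgY.dg_mono)
  next
    case False
    have "dgY (Suc r) (k + 1) (dY r Q * Yv i)"
      using False by (intro dgY.dg_mult dgY_dY 1(2) dgY_Yv) auto
    moreover have "dgY (Suc r) (Suc k) (\<Sum>c\<in>{i<..<N}. Lv i c * pcoord N r Q c)"
      using 1(1)[OF False _ 1(2)] by (intro dgY.dg_sum dgY.dg_mult_0) auto
    ultimately show ?thesis using False by (subst pcoord.simps) (auto intro: dgY.dg_diff)
  qed
qed

text \<open>The forms are unitriangular in the coordinates, so back substitution makes each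
  coordinate a polynomial in all \<open>N\<close> forms; \<open>pcoord\<close> has only the first
  \<open>r + 1\<close> at its disposal.\<close>

function ucoord :: "nat \<Rightarrow> nat \<Rightarrow> gpoly" where
  "ucoord N i = Yv i - (\<Sum>c\<in>{i<..<N}. Lv i c * ucoord N c)"
  by auto
termination by (relation "measure (\<lambda>(N, i). N - i)") auto

declare ucoord.simps [simp del]

context curve
begin

lemma y_expand:
  assumes "i < N"
  shows "y i = U i + (\<Sum>c\<in>{i<..<N}. fps_const (Lv i c) * U c)"
proof -
  have "y i = fps_const (lin_coeff i i) * U i + (\<Sum>c\<in>{..<N} - {i}. fps_const (lin_coeff i c) * U c)"
    unfolding y_def using assms by (intro sum.remove) auto
  also have "(\<Sum>c\<in>{..<N} - {i}. fps_const (lin_coeff i c) * U c) = (\<Sum>c\<in>{i<..<N}. fps_const (Lv i c) * U c)"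
    by (intro sum.mono_neutral_cong_right) (auto simp: lin_coeff_def)
  finally show ?thesis by (simp add: lin_coeff_def)
qed

lemma psi_ucoord: "i < N \<Longrightarrow> psi (ucoord N i) = U i"
proof (induction "N - i" arbitrary: i rule: less_induct)
  case less
  have "psi (ucoord N i) = y i - (\<Sum>c\<in>{i<..<N}. fps_const (Lv i c) * psi (ucoord N c))"
    by (subst ucoord.simps) (simp add: psi.hom_minus psi.hom_sum psi.hom_mult psi_mvar)
  also have "(\<Sum>c\<in>{i<..<N}. fps_const (Lv i c) * psi (ucoord N c)) = (\<Sum>c\<in>{i<..<N}. fps_const (Lv i c) * U c)"
    using less by (intro sum.cong refl) auto
  finally show ?case using y_expand[OF less.prems] by simp
qed

text \<open>Downward induction on \<open>i\<close>: above \<open>r\<close> the parameter rule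
  applies to \<open>Q\<close>, and from \<open>r\<close> downwards the definition of
  \<open>y i\<close> is linear in the later coordinates. No order is lost.\<close>

lemma psi_pcoord:
  assumes r: "r < N" and Q: "ordge M (psi Q)" and i: "i < N"
  shows "ordge M (psi (dY r Q) * U i - psi (pcoord N r Q i))"
  using i
proof (induction "N - i" arbitrary: i rule: less_induct)
  case less
  show ?case
  proof (cases "r < i")
    case True
    have "ordge M (map_fps (dL r i) (psi Q))"
      by (rule ordge_map_fps[OF _ Q]) (simp add: dL_def)
    then show ?thesis
      using True less.prems by (simp add: psi_parameter_rule pcoord.simps[of N r Q i] psi.hom_uminus add.commute)
  next
    case False
    have "psi (pcoord N r Q i) = psi (dY r Q) * y i - (\<Sum>c\<in>{i<..<N}. fps_const (Lv i c) * psi (pcoord N r Q c))"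
      using False by (subst pcoord.simps) (simp add: psi.hom_minus psi.hom_sum psi.hom_mult psi_mvar)
    then have "psi (dY r Q) * U i - psi (pcoord N r Q i) =
        - (\<Sum>c\<in>{i<..<N}. fps_const (Lv i c) * (psi (dY r Q) * U c - psi (pcoord N r Q c)))"
      unfolding y_expand[OF less.prems]
      by (simp add: algebra_simps sum_subtractf sum_distrib_left)
    moreover have "ordge M (psi (dY r Q) * U c - psi (pcoord N r Q c))" if "c \<in> {i<..<N}" for c
      using that less.prems by (intro less.hyps) auto
    ultimately show ?thesis by (simp only: ordge_uminus ordge_sum ordge_mult)
  qed
qed

end

lemma comm_ring_hom_lift_fps: "comm_ring_hom lift_fps"
proof
  interpret c: comm_ring_hom "mconst :: complex \<Rightarrow> gpoly" by (rule comm_ring_hom_mconst)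
  show "lift_fps (x * y) = lift_fps x * lift_fps y" for x y
    by (rule fps_ext) (simp add: fps_mult_nth c.hom_sum mconst_mult)
  show "lift_fps (x + y) = lift_fps x + lift_fps y" for x y
    by (rule fps_ext) (simp add: mconst_add)
  show "lift_fps 1 = 1" by (rule fps_ext) (simp add: fps_one_def)
qed simp

lemma lift_fps_const: "lift_fps (fps_const c) = fps_const (mconst c)"
  by (rule fps_ext) (simp add: fps_const_def)

lemma comm_ring_hom_fps_const: "comm_ring_hom (fps_const :: 'a::comm_ring_1 \<Rightarrow> 'a fps)"
  by unfold_locales (auto simp flip: fps_const_add fps_const_mult)

lemma ordge_lift_fps: "ordge M f \<Longrightarrow> ordge M (lift_fps f)"
  by (simp add: ordge_def)

subsection \<open>Numerical bounds\<close>

text \<open>\<open>A\<close> majorizes the degrees of one step: \<open>3 * \<delta> ^ 3\<close> for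
  the squarefree part, \<open>Suc (2 * (3 * \<delta> ^ 3))\<close> for the numerators of the
  coordinates, three times this times \<open>3 ^ j\<close> for the product of pivots, and
  \<open>d\<close> times this for the cleared equations. As the second is at most
  \<open>7 * \<delta> ^ 3\<close>, the constant is 3 * 7 = 21.\<close>

lemma step_degree_bounds:
  fixes \<delta> d j N A :: nat
  assumes "1 \<le> \<delta>" "d \<le> \<delta>" "j \<le> N" and A: "A = 21 * 3 ^ N * \<delta> ^ 4"
  shows "\<delta> * ((2 * \<delta> + 0) * \<delta> + 0) + \<delta> \<le> 3 * \<delta> ^ 3" "3 * \<delta> ^ 3 \<le> A"
    "3 * Suc (2 * (3 * \<delta> ^ 3)) * 3 ^ j \<le> A" "d * Suc (2 * (3 * \<delta> ^ 3)) \<le> A"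
    "\<delta> \<le> A" "1 \<le> A" "N \<le> A"
proof -
  have d3: "1 \<le> \<delta> ^ 3" "\<delta> \<le> \<delta> ^ 3" "\<delta> ^ 3 \<le> \<delta> ^ 4" "1 \<le> \<delta> ^ 4"
    using assms power_increasing[of 1 3 \<delta>] power_increasing[of 3 4 \<delta>] by auto
  show "\<delta> * ((2 * \<delta> + 0) * \<delta> + 0) + \<delta> \<le> 3 * \<delta> ^ 3"
    using d3(2) by (simp add: power3_eq_cube algebra_simps)
  have c: "Suc (2 * (3 * \<delta> ^ 3)) \<le> 7 * \<delta> ^ 3" using d3(1) by simp
  have N: "N \<le> 3 ^ N" using less_exp[of N] power_mono[of 2 3 N] by simp
  have g: "x * y \<le> 3 ^ N * \<delta> ^ 4" if "x \<le> 3 ^ N" "y \<le> \<delta> ^ 4" for x y :: nat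
    using that by (rule mult_le_mono)
  show "3 * \<delta> ^ 3 \<le> A" using g[of 1 "\<delta> ^ 3"] d3 unfolding A by simp
  show "3 * Suc (2 * (3 * \<delta> ^ 3)) * 3 ^ j \<le> A"
  proof -
    have "3 * Suc (2 * (3 * \<delta> ^ 3)) * 3 ^ j \<le> 3 * (7 * \<delta> ^ 3) * 3 ^ j"
      using c by (intro mult_le_mono) auto
    also have "\<dots> = 21 * (3 ^ j * \<delta> ^ 3)" by simp
    also have "\<dots> \<le> 21 * (3 ^ N * \<delta> ^ 4)" using assms d3 by (intro mult_le_mono2 g) (auto intro: power_increasing)
    finally show ?thesis unfolding A by simp
  qed
  show "d * Suc (2 * (3 * \<delta> ^ 3)) \<le> A"
  proof -
    have "d * Suc (2 * (3 * \<delta> ^ 3)) \<le> \<delta> * (7 * \<delta> ^ 3)" using c assms by (intro mult_le_mono) auto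
    also have "\<dots> = 7 * (1 * \<delta> ^ 4)" by (simp add: power3_eq_cube power4_eq_xxxx)
    also have "\<dots> \<le> 21 * (3 ^ N * \<delta> ^ 4)" by (intro mult_le_mono g) auto
    finally show ?thesis unfolding A by simp
  qed
  show "\<delta> \<le> A" using g[of 1 "\<delta>"] d3 unfolding A by simp
  show "1 \<le> A" using d3 unfolding A by simp
  show "N \<le> A" using g[of N 1] N d3 unfolding A by simp
qed

lemma step_selection_bound:
  fixes a A \<gamma> :: nat
  assumes "a \<le> A" "\<gamma> \<le> A" "1 \<le> A"
  shows "a * ((2 * a + \<gamma>) * a + \<gamma>) + a \<le> 5 * A ^ 3" "A \<le> 5 * A ^ 3"
proof -
  have A: "A \<le> A ^ 3" "A ^ 2 \<le> A ^ 3"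
    using assms power_increasing[of 1 3 A] power_increasing[of 2 3 A] by auto
  have "a * ((2 * a + \<gamma>) * a + \<gamma>) + a \<le> A * ((2 * A + A) * A + A) + A"
    using assms by (intro add_mono mult_mono) auto
  also have "\<dots> = 3 * A ^ 3 + A ^ 2 + A" by (simp add: power3_eq_cube power2_eq_square algebra_simps)
  finally show "a * ((2 * a + \<gamma>) * a + \<gamma>) + a \<le> 5 * A ^ 3" using A by simp
  show "A \<le> 5 * A ^ 3" using A by simp
qed

text \<open>The order budget of one step, backwards from \<open>M'\<close>: the second cancellation
  needs \<open>13 * A ^ 4 * M'\<close>, and the first, which must leave that much, needs
  \<open>17 * A ^ 5 * M'\<close>. Here \<open>t\<close> is the exponent of the polynomial whose
  order is wanted and \<open>k\<close> that of a leading coefficient.\<close>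

lemma step_order_bounds:
  fixes A M' N :: nat
  assumes A: "1 \<le> A" "N \<le> A" and M': "1 \<le> M'"
  shows "t \<le> A \<Longrightarrow> k \<le> Suc (A * A) \<Longrightarrow> Suc (t * (13 * A ^ 4 * M')) + Suc (k * M') \<le> 17 * A ^ 5 * M'"
    "t \<le> A \<Longrightarrow> k \<le> Suc (A * (5 * A ^ 3 + A)) \<Longrightarrow>
       Suc (t * M') + (Suc (t * Suc (N * M')) + Suc (k * M')) \<le> 13 * A ^ 4 * M'"
    "Suc M' \<le> 13 * A ^ 4 * M'" "13 * A ^ 4 * M' \<le> 17 * A ^ 5 * M'"
proof -
  have pw: "1 \<le> A ^ 5" "A * A \<le> A ^ 5" "1 \<le> A ^ 4" "A \<le> A ^ 4" "A * A \<le> A ^ 4" "A ^ 4 \<le> A ^ 5" "A \<le> A ^ 5"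
    using A power_increasing[of 2 5 A] power_increasing[of 1 4 A] power_increasing[of 2 4 A]
      power_increasing[of 4 5 A] power_increasing[of 1 5 A] by (auto simp: power2_eq_square)
  define x where "x = A ^ 5 * M'"
  define w where "w = A ^ 4 * M'"
  have le: "y * M' \<le> x" if "y \<le> A ^ 5" for y unfolding x_def using that by (rule mult_le_mono1)
  have lw: "y * M' \<le> w" if "y \<le> A ^ 4" for y unfolding w_def using that by (rule mult_le_mono1)
  have x1: "1 \<le> x" "M' \<le> x" using le[of 1] M' pw by auto
  have w1: "1 \<le> w" "M' \<le> w" using lw[of 1] M' pw by auto
  {
    assume t: "t \<le> A" and k: "k \<le> Suc (A * A)"
    have "t * (13 * A ^ 4 * M') \<le> A * (13 * A ^ 4 * M')" using t by (rule mult_le_mono1)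
    also have "\<dots> = 13 * x" by (simp add: x_def power_Suc[of A 4, simplified] mult_ac)
    finally have 1: "t * (13 * A ^ 4 * M') \<le> 13 * x" .
    have "k * M' \<le> Suc (A * A) * M'" using k by (rule mult_le_mono1)
    then have "k * M' \<le> M' + x" using le[OF pw(2)] by simp
    with 1 x1 have "Suc (t * (13 * A ^ 4 * M')) + Suc (k * M') \<le> 17 * x" by linarith
    then show "Suc (t * (13 * A ^ 4 * M')) + Suc (k * M') \<le> 17 * A ^ 5 * M'" by (simp add: x_def mult.assoc)
  }
  {
    assume t: "t \<le> A" and k: "k \<le> Suc (A * (5 * A ^ 3 + A))"
    have 1: "t * M' \<le> w" using t pw by (intro lw) simp
    have "t * N \<le> A * A" using t A by (intro mult_le_mono)
    then have "t * N * M' \<le> w" using pw by (intro lw) simp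
    moreover have "t \<le> w" using t pw w1 M' mult_le_mono[of t "A ^ 4" 1 M'] by (simp add: w_def)
    ultimately have 2: "t * Suc (N * M') \<le> 2 * w" by (simp add: mult.assoc)
    have "k * M' \<le> Suc (A * (5 * A ^ 3 + A)) * M'" using k by (rule mult_le_mono1)
    also have "\<dots> = M' + 5 * (A ^ 4 * M') + A * A * M'"
      by (simp add: power3_eq_cube power4_eq_xxxx algebra_simps)
    also have "\<dots> \<le> M' + 5 * w + w" using lw[OF pw(5)] by (simp add: w_def)
    finally have 3: "k * M' \<le> M' + 5 * w + w" .
    from 1 2 3 w1 have "Suc (t * M') + (Suc (t * Suc (N * M')) + Suc (k * M')) \<le> 13 * w" by linarith
    then show "Suc (t * M') + (Suc (t * Suc (N * M')) + Suc (k * M')) \<le> 13 * A ^ 4 * M'" by (simp add: w_def mult.assoc)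
  }
  have "Suc M' \<le> 13 * w" using w1 by linarith
  then show "Suc M' \<le> 13 * A ^ 4 * M'" by (simp only: w_def mult.assoc)
  show "13 * A ^ 4 * M' \<le> 17 * A ^ 5 * M'" using pw by (intro mult_le_mono) auto
qed

subsection \<open>Dropping the dimension\<close>

lemma (in filtration) dgp_mono: "dgp k q \<Longrightarrow> k \<le> l \<Longrightarrow> dgp l q"
  by (auto simp: dgp_def intro: dg_mono)

text \<open>A complex vector space is no finite union of proper subspaces: \<open>z + c * z'\<close>
  also works at the new point, and each point excludes at most one \<open>c\<close>. Different
  witnesses at different roots thus become one polynomial for the resultant.\<close>

lemma exists_nonvanishing_combination:
  fixes R :: "'o::field set" and \<eta> :: "'o \<Rightarrow> gpoly \<Rightarrow> 'o"
  assumes "finite R" and hom: "\<And>x. comm_ring_hom (\<eta> x)"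
    and zero: "0 \<in> Z"
    and lin: "\<And>z z' c. z \<in> Z \<Longrightarrow> z' \<in> Z \<Longrightarrow> z + mconst c * z' \<in> Z"
    and ne: "\<And>x. x \<in> R \<Longrightarrow> \<exists>z\<in>Z. \<eta> x z \<noteq> 0"
  shows "\<exists>z\<in>Z. \<forall>x\<in>R. \<eta> x z \<noteq> 0"
  using assms(1) ne
proof (induction R rule: finite_induct)
  case (insert x R)
  then obtain z where z: "z \<in> Z" "\<forall>x\<in>R. \<eta> x z \<noteq> 0" by auto
  obtain z' where z': "z' \<in> Z" "\<eta> x z' \<noteq> 0" using insert.prems by auto
  define bad where "bad y = {c. \<eta> y (z + mconst c * z') = 0}" for y
  have "finite (bad y)" if "y \<in> insert x R" for y
  proof -
    interpret comm_ring_hom "\<eta> y" by (rule hom)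
    have "c = c'" if c: "c \<in> bad y" "c' \<in> bad y" for c c'
    proof (rule ccontr)
      assume "c \<noteq> c'"
      have e: "\<eta> y z + \<eta> y (mconst c) * \<eta> y z' = 0" "\<eta> y z + \<eta> y (mconst c') * \<eta> y z' = 0"
        using c by (auto simp: bad_def hom_add hom_mult)
      have "\<eta> y (mconst c) * \<eta> y z' = \<eta> y (mconst c') * \<eta> y z'"
        using trans[OF e(1) e(2)[symmetric]] by simp
      moreover have "mconst (c - c') = (mconst c - mconst c' :: gpoly)"
        using mconst_add[of c "- c'"] by (simp add: mconst_uminus)
      then have "\<eta> y (mconst (c - c')) = \<eta> y (mconst c) - \<eta> y (mconst c')" by (simp only: hom_minus)
      ultimately have "\<eta> y (mconst (c - c')) * \<eta> y z' = 0" by (simp add: left_diff_distrib)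
      moreover have "\<eta> y (mconst (c - c')) \<noteq> 0"
      proof
        assume "\<eta> y (mconst (c - c')) = 0"
        then have "\<eta> y (mconst (1 / (c - c')) * mconst (c - c')) = 0" by (simp add: hom_mult)
        then show False using \<open>c \<noteq> c'\<close> by (simp flip: mconst_mult)
      qed
      ultimately have "\<eta> y z' = 0" by simp
      then have "\<eta> y z = 0" using e by simp
      with \<open>\<eta> y z' = 0\<close> that z(2) z'(2) \<open>y \<in> insert x R\<close> show False by auto
    qed
    then have "bad y \<subseteq> {c}" if "c \<in> bad y" for c using that by blast
    then show ?thesis by (metis finite.emptyI finite_insert finite_subset ex_in_conv)
  qed
  then have "finite (\<Union>y\<in>insert x R. bad y)" using insert.hyps by blast
  then obtain c where "c \<notin> (\<Union>y\<in>insert x R. bad y)" using ex_new_if_finite[OF infinite_UNIV_char_0] by blast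
  then show ?case using lin[OF z(1) z'(1), of c] by (intro bexI[of _ "z + mconst c * z'"]) (auto simp: bad_def)
qed (use zero in auto)

definition ix :: "nat \<Rightarrow> nat \<times> nat \<Rightarrow> nat" where
  "ix e v = fst v * (e + 1) + snd v"

text \<open>Marks the coordinates of order \<open>e\<close>. Under the numbering \<open>ix\<close>,
  the derivative of any other coordinate is the next one.\<close>

definition top :: "nat \<Rightarrow> nat \<Rightarrow> bool" where
  "top e c \<longleftrightarrow> Suc c mod (e + 1) = 0"

lemma ix_less: "v \<in> dvars n e \<Longrightarrow> ix e v < n * (e + 1)"
proof -
  assume v: "v \<in> dvars n e"
  then have "fst v < n" "snd v \<le> e" by (auto simp: dvars_def)
  then have "fst v * (e + 1) + snd v < (fst v + 1) * (e + 1)" by simp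
  also have "\<dots> \<le> n * (e + 1)" using \<open>fst v < n\<close> by (intro mult_le_mono1) simp
  finally show ?thesis by (simp add: ix_def)
qed

lemma not_top_ix: "j < e \<Longrightarrow> \<not> top e (ix e (i, j))"
  by (simp add: top_def ix_def flip: add_Suc_right)

lemma not_top_less: "c < n * (e + 1) \<Longrightarrow> \<not> top e c \<Longrightarrow> Suc c < n * (e + 1)"
  by (metis Suc_lessI mod_mult_self2_is_0 top_def)

text \<open>Successive coordinates are exact derivatives of each other; only the equations
  \<open>f\<close> hold approximately.\<close>

locale approx_system = curve N u for N u +
  fixes n e s :: nat and f :: "nat \<Rightarrow> (nat \<times> nat) mpoly" and d L :: nat
  assumes N_eq: "N = n * (e + 1)"
    and vars_f: "i < s \<Longrightarrow> vars (f i) \<subseteq> dvars n e"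
    and deg_f: "i < s \<Longrightarrow> total_degree (f i) \<le> d"
    and u_deriv: "c < N \<Longrightarrow> \<not> top e c \<Longrightarrow> fps_deriv (u c) = u (Suc c)"
    and f_u: "i < s \<Longrightarrow> ordge L (msubst fps_const (\<lambda>v. u (ix e v)) (f i))"
begin

lemma U_deriv: "c < N \<Longrightarrow> \<not> top e c \<Longrightarrow> fps_deriv (U c) = U (Suc c)"
  using u_deriv[of c] by (simp add: U_def fps_deriv_lift_fps)

lemma f_U: "i < s \<Longrightarrow> ordge L (msubst (\<lambda>c. psi (mconst c)) (\<lambda>v. U (ix e v)) (f i))"
proof -
  assume i: "i < s"
  have "lift_fps (msubst fps_const (\<lambda>v. u (ix e v)) (f i)) =
      msubst (\<lambda>c. psi (mconst c)) (\<lambda>v. U (ix e v)) (f i)"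
    by (subst hom_msubst[OF comm_ring_hom_fps_const comm_ring_hom_lift_fps])
      (simp add: comp_def lift_fps_const U_def)
  with ordge_lift_fps[OF f_u[OF i]] show ?thesis by simp
qed

text \<open>An exact point of the generic hypersurface at which the linear equations for the derivation
  are solvable yields a differential field containing a solution of the system.\<close>

lemma not_unit_diff_ideal_if_point:
  assumes r: "r < N"
    and H: "dgY.dgp r k H" "H \<noteq> 0" "poly (map_poly emb H) \<alpha> = 0"
      "\<And>x. poly (map_poly emb H) x = 0 \<Longrightarrow> poly (map_poly emb (pderiv H)) x \<noteq> 0"
    and p: "\<And>c. dgY (Suc r) k' (p c)" and S: "dgY (Suc r) k' S" "ev r \<alpha> S \<noteq> 0"
    and a: "\<And>c. c < N \<Longrightarrow> a c \<in> dgY.fracs (Suc r) (ev r \<alpha>)"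
      "\<And>c. c < N \<Longrightarrow> \<not> top e c \<Longrightarrow> a c = ev r \<alpha> (p (Suc c)) / ev r \<alpha> S"
    and eq1: "(\<Sum>c<N. ev r \<alpha> (grad c (poly H (Yv r))) * a c) = 0"
    and eq2: "\<And>i. i < N \<Longrightarrow> (\<Sum>c<N. ev r \<alpha> (S * grad c (p i) - p i * grad c S - (if c = i then S * S else 0)) * a c) = 0"
    and f0: "\<And>i. i < s \<Longrightarrow> ev r \<alpha> (homog d S (\<lambda>v. p (ix e v)) (f i)) = 0"
  shows "1 \<notin> diff_ideal s f"
proof -
  define \<eta> where "\<eta> = ev r \<alpha>"
  define E where "E = dgY.fracs (Suc r) \<eta>"
  interpret \<eta>: comm_ring_hom \<eta> unfolding \<eta>_def by (rule comm_ring_hom_ev)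
  \<comment> \<open>The chain rule with \<open>a c\<close> prescribed as the derivative of the
    coordinate \<open>c\<close>.\<close>
  define \<Delta> where "\<Delta> q = (\<Sum>c<N. \<eta> (grad c q) * a c)" for q
  have add: "\<Delta> (q + q') = \<Delta> q + \<Delta> q'" for q q'
    by (simp add: \<Delta>_def grad_def gderiv_add \<eta>.hom_add ring_distribs sum.distrib)
  have mult: "\<Delta> (q * q') = \<eta> q * \<Delta> q' + \<Delta> q * \<eta> q'" for q q'
    by (simp add: \<Delta>_def grad_def gderiv_mult \<eta>.hom_add \<eta>.hom_mult ring_distribs sum.distrib
        sum_distrib_left sum_distrib_right mult_ac)
  have fr: "x + y \<in> E" "x * y \<in> E" "x / y \<in> E" if "x \<in> E" "y \<in> E" for x y
    using dgY.fracs_closed[OF comm_ring_hom_ev that[unfolded E_def \<eta>_def]] by (simp_all add: E_def \<eta>_def)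
  have E_ev: "\<eta> q \<in> E" if "dgY (Suc r) k q" for q k
    using dgY.ev_in_fracs[OF comm_ring_hom_ev that] by (simp add: E_def \<eta>_def)
  have closed: "\<Delta> q \<in> E" if "dgY (Suc r) k q" for q k
  proof -
    have "\<eta> (grad c q) * a c \<in> E" if "c < N" for c
      using E_ev[OF dgY_grad[OF \<open>dgY (Suc r) k q\<close>]] a(1)[OF that] by (intro fr) (auto simp: E_def \<eta>_def)
    then show ?thesis
      unfolding \<Delta>_def E_def by (intro dgY.fracs_sum[OF \<eta>.comm_ring_hom_axioms]) auto
  qed
  have stable: "\<Delta> q = 0" if "dgY (Suc r) l q" "\<eta> q = 0" for q l
    using generic_derivation_stable[of \<Delta> r \<alpha>, OF mult[unfolded \<eta>_def] H, of l q] eq1 that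
    by (simp add: \<Delta>_def \<eta>_def)
  obtain D where D: "\<And>p q k l. dgY (Suc r) k p \<Longrightarrow> dgY (Suc r) l q \<Longrightarrow> \<eta> q \<noteq> 0 \<Longrightarrow>
        D (\<eta> p / \<eta> q) = (\<Delta> p - \<eta> p / \<eta> q * \<Delta> q) / \<eta> q"
    "\<And>x. x \<in> E \<Longrightarrow> D x \<in> E"
    "\<And>x y. x \<in> E \<Longrightarrow> y \<in> E \<Longrightarrow> D (x + y) = D x + D y"
    "\<And>x y. x \<in> E \<Longrightarrow> y \<in> E \<Longrightarrow> D (x * y) = x * D y + D x * y"
  proof (rule dgY.derivation_on_fracs[where \<Delta> = \<Delta> and \<eta> = \<eta> and r = "Suc r"])
    show "comm_ring_hom \<eta>" by (rule \<eta>.comm_ring_hom_axioms)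
    show "\<Delta> (p + q) = \<Delta> p + \<Delta> q" for p q by (rule add)
    show "\<Delta> (p * q) = \<eta> p * \<Delta> q + \<Delta> p * \<eta> q" for p q by (rule mult)
    show "\<Delta> p \<in> dgY.fracs (Suc r) \<eta>" if "dgY (Suc r) k p" for k p
      using closed[OF that] by (simp add: E_def)
    show "\<Delta> p = 0" if "dgY (Suc r) k p" "\<eta> p = 0" for k p using stable[OF that] .
    fix D' assume "\<And>p q k l. dgY (Suc r) k p \<Longrightarrow> dgY (Suc r) l q \<Longrightarrow> \<eta> q \<noteq> 0 \<Longrightarrow>
        D' (\<eta> p / \<eta> q) = (\<Delta> p - \<eta> p / \<eta> q * \<Delta> q) / \<eta> q"
      "\<And>x. x \<in> dgY.fracs (Suc r) \<eta> \<Longrightarrow> D' x \<in> dgY.fracs (Suc r) \<eta>"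
      "\<And>x y. x \<in> dgY.fracs (Suc r) \<eta> \<Longrightarrow> y \<in> dgY.fracs (Suc r) \<eta> \<Longrightarrow> D' (x + y) = D' x + D' y"
      "\<And>x y. x \<in> dgY.fracs (Suc r) \<eta> \<Longrightarrow> y \<in> dgY.fracs (Suc r) \<eta> \<Longrightarrow> D' (x * y) = x * D' y + D' x * y"
    then show thesis by (intro that[of D']) (auto simp: E_def)
  qed
  define \<xi> where "\<xi> c = \<eta> (p c) / \<eta> S" for c
  have S0: "\<eta> S \<noteq> 0" using S(2) by (simp add: \<eta>_def)
  have \<xi>E: "\<xi> c \<in> E" for c
    unfolding \<xi>_def using E_ev[OF p] E_ev[OF S(1)] by (rule fr(3))
  \<comment> \<open>Equation \<open>eq2\<close> is the quotient rule for \<open>p c / S\<close> with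
    the denominator cleared.\<close>
  have D\<xi>: "D (\<xi> c) = a c" if c: "c < N" for c
  proof -
    have "(\<Sum>c'<N. \<eta> (S * grad c' (p c) - p c * grad c' S - (if c' = c then S * S else 0)) * a c') =
        \<eta> S * \<Delta> (p c) - \<eta> (p c) * \<Delta> S - (\<Sum>c'<N. if c' = c then \<eta> S * \<eta> S * a c else 0)"
      unfolding \<Delta>_def sum_distrib_left sum_subtractf[symmetric]
      by (intro sum.cong refl) (simp add: \<eta>.hom_minus \<eta>.hom_add \<eta>.hom_mult algebra_simps)
    also have "(\<Sum>c'<N. if c' = c then \<eta> S * \<eta> S * a c else 0) = \<eta> S * \<eta> S * a c" using c by simp
    finally have "\<eta> S * \<Delta> (p c) - \<eta> (p c) * \<Delta> S = \<eta> S * \<eta> S * a c"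
      using eq2[OF c] by (simp add: \<eta>_def)
    then show ?thesis
      unfolding \<xi>_def D(1)[OF p S(1) S0] using S0 by (simp add: field_simps)
  qed
  \<comment> \<open>Orders above \<open>e\<close>, which do not occur in \<open>f\<close>, are
    obtained by iterating \<open>D\<close> on the coordinate of order \<open>e\<close>.\<close>
  define z where "z v = (if fst v < n then (if snd v \<le> e then \<xi> (ix e v) else (D ^^ (snd v - e)) (\<xi> (ix e (fst v, e)))) else 0)"
    for v :: "nat \<times> nat"
  have DE: "(D ^^ j) x \<in> E" if "x \<in> E" for x j using that D(2) by (induction j) auto
  have E0: "0 \<in> E" using E_ev[of 0 0] dgY.dg_zero by simp
  have D0: "D 0 = 0" using D(3)[OF E0 E0] by (metis add.right_neutral add_left_cancel)
  have zD: "D (z v) = z (dshift v)" for v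
  proof (cases v)
    case (Pair i j)
    consider "i \<ge> n" | "i < n" "j < e" | "i < n" "j \<ge> e" by linarith
    then show ?thesis
    proof cases
      case 1
      then show ?thesis using Pair by (simp add: z_def dshift_def D0)
    next
      case 2
      then have "ix e v < N" using ix_less[of v n e] Pair unfolding N_eq by (simp add: dvars_def)
      then have "D (\<xi> (ix e v)) = \<xi> (Suc (ix e v))"
        using D\<xi> a(2)[of "ix e v"] not_top_ix[OF 2(2), of i] Pair by (simp add: \<xi>_def \<eta>_def)
      moreover have "Suc (ix e v) = ix e (dshift v)" using Pair by (simp add: ix_def dshift_def)
      ultimately show ?thesis using 2 Pair by (simp add: z_def dshift_def)
    next
      case 3
      then show ?thesis
        using Pair by (cases "j = e") (auto simp: z_def dshift_def Suc_diff_le ix_def)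
    qed
  qed
  show ?thesis
  proof (rule dgY.not_unit_diff_ideal_if_solution[of "\<lambda>c. emb (mconst c)" E D z])
    show "comm_ring_hom (\<lambda>c. emb (mconst c))" by (rule comm_ring_hom_emb_mconst)
    show "emb (mconst c) \<in> E" for c using E_ev[OF dgY_mconst[of "Suc r" 0 c]] by (simp add: \<eta>_def)
    show "D (emb (mconst c)) = 0" for c
    proof -
      have \<Delta>c: "\<Delta> (mconst c) = 0" for c by (simp add: \<Delta>_def grad_def)
      then show ?thesis
        using \<Delta>c[of 1] D(1)[OF dgY_mconst[of "Suc r" 0 c] dgY_mconst[of "Suc r" 0 1]] by (simp add: \<eta>_def)
    qed
    show "z v \<in> E" for v using \<xi>E DE E0 by (auto simp: z_def)
    show "D (z v) = z (dshift v)" for v by (rule zD)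
    fix i assume i: "i < s"
    have "msubst (\<lambda>c. emb (mconst c)) z (f i) = msubst (\<lambda>c. emb (mconst c)) (\<lambda>v. \<xi> (ix e v)) (f i)"
      using vars_f[OF i] by (intro msubst_cong) (auto simp: z_def dvars_def)
    moreover have "\<eta> (homog d S (\<lambda>v. p (ix e v)) (f i)) = \<eta> S ^ d * msubst (\<lambda>c. \<eta> (mconst c)) (\<lambda>v. \<xi> (ix e v)) (f i)"
      using S0 by (intro homog_exact \<eta>.comm_ring_hom_axioms deg_f[OF i]) (simp add: \<xi>_def)
    ultimately show "msubst (\<lambda>c. emb (mconst c)) z (f i) = 0"
      using f0[OF i] S0 by (simp add: \<eta>_def)
  qed (use D(3,4) fr in auto)
qed

text \<open>Both parts differentiate in t and lose one order: the first the equation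
  \<open>Q = 0\<close>, the second \<open>U i = p i / S\<close>. With error term \<epsilon> = S U -
  p, the second system has residue S' \<epsilon> - S \<epsilon>'.\<close>

lemma psi_linear_system:
  assumes r: "r < N" and Q: "ordge (Suc M) (psi Q)"
  defines "S \<equiv> dY r Q" and "p \<equiv> pcoord N r Q"
  shows "ordge M (\<Sum>c<N. psi (grad c Q) * fps_deriv (U c))"
    "i < N \<Longrightarrow> ordge M (\<Sum>c<N. psi (S * grad c (p i) - p i * grad c S - (if c = i then S * S else 0)) * fps_deriv (U c))"
proof -
  show "ordge M (\<Sum>c<N. psi (grad c Q) * fps_deriv (U c))"
    using ordge_fps_deriv[OF Q] by (simp add: psi_chain_rule)
  assume i: "i < N"
  define \<epsilon> where "\<epsilon> = psi S * U i - psi (p i)"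
  have \<epsilon>: "ordge (Suc M) \<epsilon>" unfolding \<epsilon>_def S_def p_def by (rule psi_pcoord[OF r Q i])
  have "(\<Sum>c<N. psi (S * grad c (p i) - p i * grad c S - (if c = i then S * S else 0)) * fps_deriv (U c)) =
      psi S * (\<Sum>c<N. psi (grad c (p i)) * fps_deriv (U c)) - psi (p i) * (\<Sum>c<N. psi (grad c S) * fps_deriv (U c)) -
      (\<Sum>c<N. if c = i then psi S * psi S * fps_deriv (U i) else 0)"
    unfolding sum_distrib_left sum_subtractf[symmetric]
    by (intro sum.cong refl) (simp add: psi.hom_minus psi.hom_add psi.hom_mult algebra_simps)
  also have "(\<Sum>c<N. if c = i then psi S * psi S * fps_deriv (U i) else 0) = psi S * psi S * fps_deriv (U i)"
    using i by simp
  also have "psi S * (\<Sum>c<N. psi (grad c (p i)) * fps_deriv (U c)) - psi (p i) * (\<Sum>c<N. psi (grad c S) * fps_deriv (U c)) -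
      psi S * psi S * fps_deriv (U i) = fps_deriv (psi S) * \<epsilon> - psi S * fps_deriv \<epsilon>"
    unfolding psi_chain_rule[symmetric] \<epsilon>_def by (simp add: algebra_simps)
  also have "ordge M \<dots>"
    using ordge_mono[OF \<epsilon>, of M] ordge_fps_deriv[OF \<epsilon>] by (intro ordge_diff ordge_mult) auto
  finally show "ordge M (\<Sum>c<N. psi (S * grad c (p i) - p i * grad c S - (if c = i then S * S else 0)) * fps_deriv (U c))" .
qed

text \<open>Along the curve the right-hand side has order at least \<open>M\<close>. The cofactor of
  \<open>P ^ t\<close> has order below \<open>b\<close>, so the rest must come from
  \<open>P\<close>.\<close>

lemma psi_power_relation:
  assumes eq: "smult (c ^ k) (P ^ t * P') = Q * B" and Q: "ordge M (psi (poly Q (Yv r)))"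
    and c: "\<not> ordge b (psi (poly P' (Yv r) * c ^ k))" and M: "Suc (t * a) + b \<le> M"
  shows "ordge a (psi (poly P (Yv r)))"
proof -
  from arg_cong[OF eq, of "\<lambda>q. poly q (Yv r)"]
  have "poly P (Yv r) ^ t * (poly P' (Yv r) * c ^ k) = poly Q (Yv r) * poly B (Yv r)"
    by (simp add: mult_ac)
  from arg_cong[OF this, of psi]
  have "psi (poly P (Yv r)) ^ t * psi (poly P' (Yv r) * c ^ k) = psi (poly B (Yv r)) * psi (poly Q (Yv r))"
    by (simp add: psi.hom_mult psi.hom_power mult_ac)
  then have "ordge M (psi (poly P (Yv r)) ^ t * psi (poly P' (Yv r) * c ^ k))"
    using ordge_mult[OF Q] by simp
  then show ?thesis using c M by (rule ordge_cancel_power)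
qed

text \<open>Under \<open>indep\<close>, nonzero polynomials of bounded degree in the first
  \<open>r\<close> forms have low order and can be cancelled. \<open>H\<close> is the squarefree
  part of \<open>Q0\<close> in \<open>Yv r\<close>, and \<open>H'\<close> the part of
  \<open>H\<close> on which the pivot product \<open>g0\<close> does not vanish. Either some root of
  \<open>H'\<close> is a zero of everything in \<open>Z\<close>, and a solution of \<open>f\<close>
  arises there, or a resultant with \<open>H'\<close> violates \<open>indep\<close>.\<close>

lemma dimension_drop:
  assumes unit: "1 \<in> diff_ideal s f"
    and r: "r < N" and \<delta>: "1 \<le> \<delta>" "d \<le> \<delta>" and A: "A = 21 * 3 ^ N * \<delta> ^ 4"
    and Q0: "Q0 \<noteq> 0" "dgY (Suc r) \<delta> Q0" "ordge M (psi Q0)"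
    and M: "17 * A ^ 5 * M' \<le> M" "M \<le> L" "1 \<le> M'"
  shows "\<exists>q. q \<noteq> 0 \<and> dgY r (50 * A ^ 6) q \<and> ordge M' (psi q)"
proof (rule ccontr)
  assume "\<not> ?thesis"
  then have indep: "\<not> ordge M' (psi q)" if "q \<noteq> 0" "dgY r (50 * A ^ 6) q" for q using that by blast
  interpret mp: map_poly_inj_comm_ring_hom emb ..
  define J where "J = {c. c < N \<and> top e c}"
  have J: "finite J" "card J \<le> N"
    using card_mono[of "{..<N}" J] by (auto simp: J_def)
  define b where "b = 3 * \<delta> ^ 3"
  define k1 where "k1 = Suc (2 * b)"
  note db = step_degree_bounds[OF \<delta> J(2) A, folded b_def, folded k1_def]
  have A1: "1 \<le> A" by (rule db(6))
  note ob = step_order_bounds[OF A1 db(7) M(3)]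
  have A6: "x \<le> 50 * A ^ 6" if "x \<le> A" for x
    using that power_increasing[of 1 6 A] A1 by simp

  define P0 where "P0 = up r Q0"
  have P0: "dgY.dgp r \<delta> P0" "P0 \<noteq> 0" "poly P0 (Yv r) = Q0"
    using dgp_up[OF Q0(2)] poly_up[of r Q0] Q0(1) by (auto simp: P0_def)
  \<comment> \<open>Leading coefficients in \<open>Yv r\<close> involve only the first
    \<open>r\<close> forms, so \<open>indep\<close> applies to them.\<close>
  have lead: "\<not> ordge M' (psi (lead_coeff P))" if "dgY.dgp r k P" "k \<le> A" "P \<noteq> 0" for P k
  proof (rule indep)
    show "lead_coeff P \<noteq> 0" using that(3) by simp
    have "dgY r k (lead_coeff P)" using that(1) by (simp add: dgY.dgp_def)
    then show "dgY r (50 * A ^ 6) (lead_coeff P)" using A6[OF that(2)] by (rule dgY.dg_mono)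
  qed
  \<comment> \<open>Root selection with \<open>G = 1\<close> keeps every root of \<open>P0\<close>
    once.\<close>
  obtain H where H: "dgY.dgp r b H" "H \<noteq> 0"
    "\<And>x. poly (map_poly emb H) x = 0 \<longleftrightarrow> poly (map_poly emb P0) x = 0"
    "\<And>x. poly (map_poly emb H) x = 0 \<Longrightarrow> poly (map_poly emb (pderiv H)) x \<noteq> 0"
  proof -
    have "dgY.dgp r 0 [:1:]" by (auto simp: dgY.dgp_def coeff_pCons dgY.dg_zero dgY.dg_one split: nat.split)
    from ge.bounded_root_selection[OF P0(1,2) this] obtain H where
      "dgY.dgp r (\<delta> * ((2 * \<delta> + 0) * \<delta> + 0) + \<delta>) H" "H \<noteq> 0"
      "\<And>x. poly (map_poly emb H) x = 0 \<longleftrightarrow> poly (map_poly emb P0) x = 0 \<and> poly (map_poly emb [:1:]) x \<noteq> 0"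
      "\<And>x. poly (map_poly emb H) x = 0 \<Longrightarrow> poly (map_poly emb (pderiv H)) x \<noteq> 0" by metis
    then show ?thesis using that[of H] dgY.dgp_mono[OF _ db(1)] by (auto simp: map_poly_emb_const)
  qed
  define Q where "Q = poly H (Yv r)"
  have upQ: "up r Q = H" unfolding Q_def by (rule up_poly[OF H(1)])
  have degH: "degree H \<le> b" and degP0: "degree P0 \<le> \<delta>" using H(1) P0(1) by (auto simp: dgY.dgp_def)
  \<comment> \<open>Having the same roots, \<open>P0\<close> divides a power of \<open>H\<close> up
    to a leading coefficient, so the order of \<open>Q0\<close> passes to \<open>Q\<close>.\<close>
  have ordQ: "ordge (13 * A ^ 4 * M') (psi Q)"
  proof -
    have "map_poly emb P0 dvd map_poly emb H ^ degree (map_poly emb P0)"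
      using H(3) P0(2) by (intro dvd_power_if_roots_subset) auto
    then have "map_poly emb P0 dvd map_poly emb (H ^ degree P0)" by (simp add: mp.hom_power)
    then obtain B where B: "smult (lead_coeff P0 ^ (Suc (degree (H ^ degree P0)) - degree P0)) (H ^ degree P0 * 1) = P0 * B"
      using ge.pseudo_division_exact[OF P0(2)] by (metis mult.right_neutral)
    have "degree (H ^ degree P0) \<le> A * A"
      using degree_power_le[of H "degree P0"] degH degP0 db(2,5) mult_le_mono[of "degree H" A "degree P0" A] by linarith
    then have k: "Suc (degree (H ^ degree P0)) - degree P0 \<le> Suc (A * A)" by simp
    show ?thesis
      unfolding Q_def
    proof (rule psi_power_relation[OF B])
      show "ordge M (psi (poly P0 (Yv r)))" using Q0(3) P0(3) by simp
      show "\<not> ordge (Suc ((Suc (degree (H ^ degree P0)) - degree P0) * M'))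
          (psi (poly 1 (Yv r) * lead_coeff P0 ^ (Suc (degree (H ^ degree P0)) - degree P0)))"
        using not_ordge_power[OF lead[OF P0(1) db(5) P0(2)]] by (simp add: psi.hom_power)
      show "Suc (degree P0 * (13 * A ^ 4 * M')) + Suc ((Suc (degree (H ^ degree P0)) - degree P0) * M') \<le> M"
        using ob(1)[OF _ k, of "degree P0"] degP0 db(5) M(1) by linarith
    qed
  qed
  have ordQ': "ordge (Suc M') (psi Q)" using ordQ ob(3) by (rule ordge_mono)

  define S where "S = dY r Q"
  define p where "p = pcoord N r Q"
  have dgQ: "dgY (Suc r) (2 * b) Q" unfolding Q_def by (rule dgY_poly[OF H(1)])
  have dgp: "dgY (Suc r) k1 (p c)" for c unfolding p_def k1_def by (rule dgY_pcoord[OF dgQ])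
  have dgS: "dgY (Suc r) k1 S"
    unfolding S_def k1_def by (rule dgY.dg_mono[OF dgY_dY[OF dgQ]]) simp
  \<comment> \<open>Rows \<open>i < N\<close> differentiate the coordinates \<open>p i / S\<close>;
    every row from \<open>N\<close> on is the tangency condition for \<open>Q\<close>, so one index
    set serves both.\<close>
  define W where "W i c = (if i < N then S * grad c (p i) - p i * grad c S - (if c = i then S * S else 0) else grad c Q)" for i c
  have dgW: "dgY (Suc r) (k1 + k1) (W i c)" for i c
  proof (cases "i < N")
    case True
    then show ?thesis unfolding W_def using dgp dgS
      by (auto intro!: dgY.dg_diff dgY.dg_mult dgY_grad simp: dgY.dg_zero)
  next
    case False
    have "dgY (Suc r) (k1 + k1) (grad c Q)"
      by (rule dgY.dg_mono[OF dgY_grad[OF dgQ]]) (simp add: k1_def)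
    then show ?thesis using False by (simp add: W_def)
  qed
  have ordW: "ordge M' (\<Sum>c<N. psi (W i c) * fps_deriv (U c))" for i
    using psi_linear_system(1)[OF r ordQ'] psi_linear_system(2)[OF r ordQ', of i, folded S_def p_def]
    by (cases "i < N") (auto simp: W_def)
  \<comment> \<open>A coordinate outside \<open>J\<close> has the next coordinate,
    \<open>p (Suc c) / S\<close>, as its derivative. These columns are known and move to the right;
    multiplication by \<open>S\<close> clears the denominator.\<close>
  define g where "g i = - (\<Sum>c\<in>{..<N} - J. W i c * p (Suc c))" for i
  have split_sum: "(\<Sum>c<N. h c) = (\<Sum>c\<in>J. h c) + (\<Sum>c\<in>{..<N} - J. h c)" for h :: "nat \<Rightarrow> 'h::comm_ring_1"
    by (subst sum.subset_diff[of J "{..<N}"]) (auto simp: J_def add.commute)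
  have dgG: "dgY (Suc r) (3 * k1) (S * W i c)" for i c
    by (rule dgY.dg_mono[OF dgY.dg_mult[OF dgS dgW]]) simp
  have dgg: "dgY (Suc r) (3 * k1) (g i)" for i
  proof -
    have "dgY (Suc r) (3 * k1) (W i c * p (Suc c))" for c
      by (rule dgY.dg_mono[OF dgY.dg_mult[OF dgW dgp]]) simp
    then show ?thesis unfolding g_def by (intro dgY.dg_uminus dgY.dg_sum)
  qed
  have nontop: "Suc c < N \<and> \<not> top e c \<and> c < N" if "c \<in> {..<N} - J" for c
    using that not_top_less[of c n e] by (auto simp: J_def N_eq)
  have ordG: "ordge M' ((\<Sum>c\<in>J. psi (S * W i c) * fps_deriv (U c)) - psi (g i))" for i
  proof -
    have "(\<Sum>c\<in>J. psi (S * W i c) * fps_deriv (U c)) - psi (g i) =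
       psi S * (\<Sum>c\<in>J. psi (W i c) * fps_deriv (U c)) + (\<Sum>c\<in>{..<N} - J. psi (W i c) * psi (p (Suc c)))"
      by (simp add: g_def psi.hom_uminus psi.hom_sum psi.hom_mult sum_distrib_left mult_ac)
    also have "\<dots> = psi S * (\<Sum>c<N. psi (W i c) * fps_deriv (U c)) -
        (\<Sum>c\<in>{..<N} - J. psi (W i c) * (psi S * fps_deriv (U c) - psi (p (Suc c))))"
      unfolding split_sum by (simp add: algebra_simps sum_subtractf sum_distrib_left)
    also have "ordge M' \<dots>"
    proof (rule ordge_diff[OF ordge_mult[OF ordW] ordge_sum])
      fix c assume c: "c \<in> {..<N} - J"
      have "ordge (Suc M') (psi S * U (Suc c) - psi (p (Suc c)))"
        unfolding S_def p_def using nontop[OF c] by (intro psi_pcoord[OF r ordQ']) auto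
      then show "ordge M' (psi (W i c) * (psi S * fps_deriv (U c) - psi (p (Suc c))))"
        using nontop[OF c] by (intro ordge_mult) (auto simp: U_deriv intro: ordge_mono)
    qed
    finally show ?thesis .
  qed
  obtain g0 where g0: "dgY (Suc r) (3 * k1 * 3 ^ card J) g0" "\<not> ordge (Suc (card J * M')) (psi g0)"
    "\<And>\<eta> :: gpoly \<Rightarrow> gfield. comm_ring_hom \<eta> \<Longrightarrow>
       (\<forall>z. dgY (Suc r) (3 * k1 * 3 ^ card J) z \<longrightarrow> ordge M' (psi z) \<longrightarrow> \<eta> z = 0) \<Longrightarrow> \<eta> g0 \<noteq> 0 \<Longrightarrow>
       \<exists>b. (\<forall>c\<in>J. b c \<in> dgY.fracs (Suc r) \<eta>) \<and> (\<forall>i\<in>UNIV. (\<Sum>c\<in>J. \<eta> (S * W i c) * b c) = \<eta> (g i))"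
    using dgY.linear_elimination[where r = "Suc r" and \<psi> = psi and J = J and I = "UNIV :: nat set" and D = "3 * k1"
        and G = "\<lambda>i c. S * W i c" and g = g and M = M' and x = "\<lambda>c. fps_deriv (U c)" and 'o = gfield,
        OF comm_ring_hom_psi J(1) dgG dgg ordG] by auto
  have g0A: "dgY (Suc r) A g0" using g0(1) db(3) by (rule dgY.dg_mono)
  have ordg0: "\<not> ordge (Suc (N * M')) (psi g0)"
    using g0(2) J(2) ordge_mono[of "Suc (N * M')" "psi g0" "Suc (card J * M')"] by auto

  obtain H' where H': "dgY.dgp r (5 * A ^ 3) H'" "H' \<noteq> 0"
    "\<And>x. poly (map_poly emb H') x = 0 \<longleftrightarrow> poly (map_poly emb H) x = 0 \<and> poly (map_poly emb (up r g0)) x \<noteq> 0"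
  proof -
    from ge.bounded_root_selection[OF H(1,2) dgp_up[OF g0A]] obtain H' where
      "dgY.dgp r (b * ((2 * b + A) * b + A) + b) H'" "H' \<noteq> 0"
      "\<And>x. poly (map_poly emb H') x = 0 \<longleftrightarrow> poly (map_poly emb H) x = 0 \<and> poly (map_poly emb (up r g0)) x \<noteq> 0"
      by metis
    then show ?thesis using that[of H'] dgY.dgp_mono[OF _ step_selection_bound(1)[OF db(2) order_refl A1]] by blast
  qed
  \<comment> \<open>\<open>H\<close> divides a power of \<open>H' * up r g0\<close> up to a leading
    coefficient; as \<open>g0\<close> has low order, the high order of \<open>H\<close> must come
    from \<open>H'\<close>.\<close>
  have ordH': "ordge M' (psi (poly H' (Yv r)))"
  proof -
    let ?t = "degree H"
    have "map_poly emb H dvd map_poly emb (H' * up r g0) ^ degree (map_poly emb H)"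
      using H'(3) H(2) by (intro dvd_power_if_roots_subset) (auto simp: mp.hom_mult)
    then have "map_poly emb H dvd map_poly emb (H' ^ ?t * up r g0 ^ ?t)"
      by (simp add: mp.hom_power mp.hom_mult power_mult_distrib)
    then obtain B where B: "smult (lead_coeff H ^ (Suc (degree (H' ^ ?t * up r g0 ^ ?t)) - degree H)) (H' ^ ?t * up r g0 ^ ?t) = H * B"
      using ge.pseudo_division_exact[OF H(2)] by metis
    define k where "k = Suc (degree (H' ^ ?t * up r g0 ^ ?t)) - degree H"
    have t: "?t \<le> A" using degH db(2) by linarith
    have "degree (H' ^ ?t * up r g0 ^ ?t) \<le> degree H' * ?t + degree (up r g0) * ?t"
      using degree_mult_le[of "H' ^ ?t" "up r g0 ^ ?t"] degree_power_le[of H' ?t] degree_power_le[of "up r g0" ?t] by linarith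
    also have "\<dots> = ?t * (degree H' + degree (up r g0))" by (simp add: algebra_simps)
    also have "\<dots> \<le> A * (5 * A ^ 3 + A)"
      using t H'(1) dgp_up[OF g0A] by (intro mult_le_mono add_mono) (auto simp: dgY.dgp_def)
    finally have k: "k \<le> Suc (A * (5 * A ^ 3 + A))" by (simp add: k_def)
    show ?thesis
    proof (rule psi_power_relation[OF B[folded k_def]])
      show "ordge (13 * A ^ 4 * M') (psi (poly H (Yv r)))" using ordQ by (simp add: Q_def)
      show "\<not> ordge (Suc (?t * Suc (N * M')) + Suc (k * M')) (psi (poly (up r g0 ^ ?t) (Yv r) * lead_coeff H ^ k))"
        using not_ordge_mult[OF not_ordge_power[OF ordg0, of ?t] not_ordge_power[OF lead[OF H(1) db(2) H(2)], of k]]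
        by (simp add: psi.hom_mult psi.hom_power poly_up)
      show "Suc (?t * M') + (Suc (?t * Suc (N * M')) + Suc (k * M')) \<le> 13 * A ^ 4 * M'"
        by (rule ob(2)[OF t k])
    qed
  qed

  define Z where "Z = {z. dgY (Suc r) A z \<and> ordge M' (psi z)}"
  have "\<exists>\<alpha>. poly (map_poly emb H') \<alpha> = 0 \<and> (\<forall>z\<in>Z. ev r \<alpha> z = 0)"
  proof (rule ccontr)
    assume no: "\<not> ?thesis"
    \<comment> \<open>A constant \<open>H'\<close> would itself be a relation excluded by
      \<open>indep\<close>.\<close>
    have "degree H' > 0"
    proof (rule ccontr)
      assume "\<not> degree H' > 0"
      then obtain c where c: "H' = [:c:]" by (metis degree_eq_zeroE not_gr_zero)
      have le: "5 * A ^ 3 \<le> 50 * A ^ 6" using power_increasing[of 3 6 A] A1 by simp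
      have "dgY r (5 * A ^ 3) (coeff H' 0)" using H'(1) by (simp add: dgY.dgp_def)
      then have "dgY r (5 * A ^ 3) c" by (simp add: c)
      then have "dgY r (50 * A ^ 6) c" using le by (rule dgY.dg_mono)
      moreover have "c \<noteq> 0" using H'(2) c by simp
      ultimately show False using indep ordH' c by auto
    qed
    define R where "R = {x. poly (map_poly emb H') x = 0}"
    have "finite R" unfolding R_def using H'(2) by (intro poly_roots_finite) simp
    then have "\<exists>z\<in>Z. \<forall>x\<in>R. ev r x z \<noteq> 0"
    proof (rule exists_nonvanishing_combination)
      show "comm_ring_hom (ev r x)" for x by (rule comm_ring_hom_ev)
      show "0 \<in> Z" by (simp add: Z_def dgY.dg_zero)
      show "z + mconst c * z' \<in> Z" if "z \<in> Z" "z' \<in> Z" for z z' c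
        using that by (auto simp: Z_def psi.hom_add psi.hom_mult intro!: dgY.dg_add dgY.dg_mult_0 ordge_add ordge_mult)
      show "\<exists>z\<in>Z. ev r x z \<noteq> 0" if "x \<in> R" for x using no that by (auto simp: R_def)
    qed
    then obtain z where z: "z \<in> Z" "\<And>x. poly (map_poly emb H') x = 0 \<Longrightarrow> poly (map_poly emb (up r z)) x \<noteq> 0"
      by (auto simp: R_def ev_eq_poly_up)
    have dgz: "dgY.dgp r (5 * A ^ 3) (up r z)"
      using z(1) by (intro dgY.dgp_mono[OF dgp_up step_selection_bound(2)[OF db(2) order_refl A1]]) (simp add: Z_def)
    \<comment> \<open>The resultant of \<open>H'\<close> and \<open>z\<close> is free of
      \<open>Yv r\<close> and inherits their high order. Its degree
      \<open>2 * (5 * A ^ 3) * (5 * A ^ 3)\<close> is the origin of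
      \<open>50 * A ^ 6\<close>.\<close>
    obtain q B B' where q: "q \<noteq> 0" "dgY r (2 * (5 * A ^ 3) * (5 * A ^ 3)) q" "[:q:] = B * H' + B' * up r z"
      using ge.bounded_elimination[OF \<open>degree H' > 0\<close> H'(1) dgz z(2)] by metis
    have "2 * (5 * A ^ 3) * (5 * A ^ 3) = 50 * A ^ 6" by (simp flip: power_add)
    with q(2) have "dgY r (50 * A ^ 6) q" by simp
    moreover have "ordge M' (psi q)"
    proof -
      from arg_cong[OF q(3), of "\<lambda>q. poly q (Yv r)"]
      have "q = poly B (Yv r) * poly H' (Yv r) + poly B' (Yv r) * z" by (simp add: poly_up)
      then have "psi q = psi (poly B (Yv r)) * psi (poly H' (Yv r)) + psi (poly B' (Yv r)) * psi z"
        by (simp add: psi.hom_add psi.hom_mult)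
      then show ?thesis using ordH' z(1) by (auto simp: Z_def intro!: ordge_add ordge_mult)
    qed
    ultimately show False using indep q(1) by blast
  qed
  then obtain \<alpha> where \<alpha>: "poly (map_poly emb H') \<alpha> = 0" "\<And>z. z \<in> Z \<Longrightarrow> ev r \<alpha> z = 0" by blast
  have \<alpha>H: "poly (map_poly emb H) \<alpha> = 0" and \<alpha>g0: "ev r \<alpha> g0 \<noteq> 0"
    using \<alpha>(1) H'(3) by (auto simp: ev_eq_poly_up)
  have \<alpha>S: "ev r \<alpha> S \<noteq> 0" using H(4)[OF \<alpha>H] by (simp add: ev_eq_poly_up S_def up_dY upQ)
  have "\<forall>z. dgY (Suc r) (3 * k1 * 3 ^ card J) z \<longrightarrow> ordge M' (psi z) \<longrightarrow> ev r \<alpha> z = 0"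
    using \<alpha>(2) dgY.dg_mono[OF _ db(3)] by (auto simp: Z_def)
  from g0(3)[OF comm_ring_hom_ev this \<alpha>g0] obtain \<beta> where
    \<beta>: "\<forall>c\<in>J. \<beta> c \<in> dgY.fracs (Suc r) (ev r \<alpha>)" "\<And>i. (\<Sum>c\<in>J. ev r \<alpha> (S * W i c) * \<beta> c) = ev r \<alpha> (g i)" by auto
  define a where "a c = (if c \<in> J then \<beta> c else ev r \<alpha> (p (Suc c)) / ev r \<alpha> S)" for c
  have aW: "(\<Sum>c<N. ev r \<alpha> (W i c) * a c) = 0" for i
  proof -
    have "ev r \<alpha> S * (\<Sum>c<N. ev r \<alpha> (W i c) * a c) =
        (\<Sum>c\<in>J. ev r \<alpha> (S * W i c) * \<beta> c) + (\<Sum>c\<in>{..<N} - J. ev r \<alpha> (W i c) * ev r \<alpha> (p (Suc c)))"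
      unfolding split_sum distrib_left sum_distrib_left
      using \<alpha>S by (intro arg_cong2[of _ _ _ _ "(+)"] sum.cong refl) (auto simp: a_def ev.hom_mult)
    also have "\<dots> = 0" unfolding \<beta>(2) by (simp add: g_def ev.hom_uminus ev.hom_sum ev.hom_mult)
    finally show ?thesis using \<alpha>S by simp
  qed
  have "1 \<notin> diff_ideal s f"
  proof (rule not_unit_diff_ideal_if_point[OF r H(1,2) \<alpha>H H(4) dgp dgS \<alpha>S, where a = a])
    show "a c \<in> dgY.fracs (Suc r) (ev r \<alpha>)" for c
      using \<beta>(1) dgY.ev_in_fracs[OF comm_ring_hom_ev dgp] dgY.ev_in_fracs[OF comm_ring_hom_ev dgS]
      by (auto simp: a_def intro!: dgY.fracs_closed(4)[OF comm_ring_hom_ev])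
    show "a c = ev r \<alpha> (p (Suc c)) / ev r \<alpha> S" if "\<not> top e c" for c
      using that by (simp add: a_def J_def)
    show "(\<Sum>c<N. ev r \<alpha> (grad c (poly H (Yv r))) * a c) = 0"
      using aW[of N] by (simp add: W_def Q_def)
    show "(\<Sum>c<N. ev r \<alpha> (S * grad c (p i) - p i * grad c S - (if c = i then S * S else 0)) * a c) = 0" if "i < N" for i
      using aW[of i] that by (simp add: W_def)
    \<comment> \<open>The curve satisfies the cleared equations to order \<open>M'\<close>, so they
      belong to \<open>Z\<close> and hold exactly at \<alpha>.\<close>
    show "ev r \<alpha> (homog d S (\<lambda>v. p (ix e v)) (f i)) = 0" if i: "i < s" for i
    proof (rule \<alpha>(2))
      have "dgY (Suc r) (d * k1) (homog d S (\<lambda>v. p (ix e v)) (f i))"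
        using dgS dgp deg_f[OF i] by (intro dgY_homog)
      then have "dgY (Suc r) A (homog d S (\<lambda>v. p (ix e v)) (f i))" using db(4) by (rule dgY.dg_mono)
      moreover have "ordge M' (psi (homog d S (\<lambda>v. p (ix e v)) (f i)))"
      proof -
        have le_L: "M' \<le> L" using M(1,2) ob(3,4) by linarith
        have 1: "ordge M' (psi S ^ d * msubst (\<lambda>c. psi (mconst c)) (\<lambda>v. U (ix e v)) (f i))"
          by (rule ordge_mult[OF ordge_mono[OF f_U[OF i] le_L]])
        have 2: "ordge M' (psi S ^ d * msubst (\<lambda>c. psi (mconst c)) (\<lambda>v. U (ix e v)) (f i) - psi (homog d S (\<lambda>v. p (ix e v)) (f i)))"
        proof (rule homog_approx[OF comm_ring_hom_psi deg_f[OF i]])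
          fix v assume "v \<in> vars (f i)"
          then have "ix e v < N" using vars_f[OF i] ix_less[of v n e] N_eq by auto
          from psi_pcoord[OF r ordQ' this]
          show "ordge M' (psi S * U (ix e v) - psi (p (ix e v)))" unfolding S_def p_def by (rule ordge_mono) simp
        qed
        from ordge_diff[OF 1 2] show ?thesis by simp
      qed
      ultimately show "homog d S (\<lambda>v. p (ix e v)) (f i) \<in> Z" by (simp add: Z_def)
    qed
  qed
  with unit show False by contradiction
qed

end

subsection \<open>The iteration\<close>

lemma dgY_ucoord: "i < N \<Longrightarrow> dgY N 1 (ucoord N i)"
proof (induction "N - i" arbitrary: i rule: less_induct)
  case less
  have "dgY N 1 (ucoord N c)" if "c \<in> {i<..<N}" for c using that less.prems by (intro less.hyps) auto
  then show ?case
    using less.prems dgY_Yv[of i N] by (subst ucoord.simps) (auto intro!: dgY.dg_diff dgY.dg_sum dgY.dg_mult_0)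
qed

lemma (in curve) psi_eq_const: "dgY 0 k p \<Longrightarrow> psi p = fps_const p"
proof -
  assume p: "dgY 0 k p"
  have nz: "fst v \<noteq> 0" if v: "v \<in> vars p" for v
  proof
    assume "fst v = 0"
    then have "v = (0, snd v)" by (simp add: prod_eq_iff)
    moreover obtain m where "m \<in> keys p" "v \<in> keys m" using v by (auto simp: vars_def)
    ultimately show False using p unfolding dgY_def by (metis in_keys_iff zero_le)
  qed
  have "psi p = msubst (\<lambda>c. fps_const (mconst c)) (\<lambda>v. fps_const (mvar v)) p"
    unfolding psi_def by (intro msubst_cong) (simp add: nz)
  also have "\<dots> = fps_const (msubst mconst mvar p)"
    using hom_msubst[OF comm_ring_hom_mconst comm_ring_hom_fps_const, of mvar p] by (simp add: comp_def)
  finally show ?thesis by (simp add: msubst_mconst_mvar)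
qed

text \<open>Constants are absorbed into powers of \<open>b \<ge> 2\<close>: 21 and 17 into the 5th,
  50 into the 6th, \<open>3 ^ N\<close> into the power 2N. With \<open>1 \<le> N \<le> x\<close>,
  the exponents 36 + 12N + 24x and 30 + 10N + 20x are at most 72x and 60x.\<close>

lemma iteration_exponents:
  fixes b x y N :: nat
  assumes b: "2 \<le> b" and N: "1 \<le> N" "N \<le> x" and A: "A = 21 * 3 ^ N * (b ^ x) ^ 4"
  shows "50 * A ^ 6 \<le> b ^ (72 * x)" "17 * A ^ 5 * b ^ y \<le> b ^ (60 * x + y)"
proof -
  have pb: "m \<le> b ^ k" if "m \<le> 2 ^ k" for m k :: nat using that power_mono[OF b, of k] by linarith
  have "(3::nat) ^ N \<le> 4 ^ N" by (rule power_mono) auto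
  also have "(4::nat) ^ N = 2 ^ (2 * N)" by (simp add: power_mult)
  finally have 3: "3 ^ N \<le> b ^ (2 * N)" by (rule pb)
  have 21: "21 \<le> b ^ 5" by (rule pb) simp
  have "A \<le> b ^ 5 * b ^ (2 * N) * b ^ (4 * x)"
    unfolding A using 3 21 by (intro mult_le_mono) (auto simp: mult.commute simp flip: power_mult)
  also have "\<dots> = b ^ (5 + 2 * N + 4 * x)" by (simp add: power_add)
  finally have A': "A \<le> b ^ (5 + 2 * N + 4 * x)" .
  have "50 * A ^ 6 \<le> b ^ 6 * (b ^ (5 + 2 * N + 4 * x)) ^ 6"
    using A' by (intro mult_le_mono pb[of 50 6] power_mono) auto
  also have "\<dots> = b ^ (6 + (5 + 2 * N + 4 * x) * 6)" by (simp only: power_add[symmetric] power_mult[symmetric])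
  also have "\<dots> \<le> b ^ (72 * x)" using b N by (intro power_increasing) auto
  finally show "50 * A ^ 6 \<le> b ^ (72 * x)" .
  have "17 * A ^ 5 * b ^ y \<le> b ^ 5 * (b ^ (5 + 2 * N + 4 * x)) ^ 5 * b ^ y"
    using A' by (intro mult_le_mono pb[of 17 5] power_mono) auto
  also have "\<dots> = b ^ (5 + (5 + 2 * N + 4 * x) * 5 + y)" by (simp only: power_add[symmetric] power_mult[symmetric])
  also have "\<dots> \<le> b ^ (60 * x + y)" using b N by (intro power_increasing) auto
  finally show "17 * A ^ 5 * b ^ y \<le> b ^ (60 * x + y)" .
qed

context approx_system
begin

text \<open>One nonzero equation, rewritten in the \<open>N\<close> forms by \<open>ucoord\<close>,
  starts the descent; its degree is unchanged because the substitution is linear in the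
  forms.\<close>

lemma initial_relation:
  assumes i: "i < s" and f0: "f i \<noteq> 0"
  shows "\<exists>Q. Q \<noteq> 0 \<and> dgY N d Q \<and> ordge L (psi Q)"
proof -
  define Q where "Q = msubst mconst (\<lambda>v. ucoord N (ix e v)) (f i)"
  have ixN: "ix e v < N" if "v \<in> vars (f i)" for v using ix_less[of v n e] vars_f[OF i] that N_eq by auto
  have "psi Q = msubst (\<lambda>c. psi (mconst c)) (\<lambda>v. psi (ucoord N (ix e v))) (f i)"
    unfolding Q_def
    using hom_msubst[OF comm_ring_hom_mconst comm_ring_hom_psi, of "\<lambda>v. ucoord N (ix e v)" "f i"]
    by (simp only: comp_def)
  also have "\<dots> = msubst (\<lambda>c. psi (mconst c)) (\<lambda>v. U (ix e v)) (f i)"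
    using ixN by (intro msubst_cong) (simp add: psi_ucoord)
  finally have "ordge L (psi Q)" using f_U[OF i] by simp
  moreover have "dgY N d Q"
    unfolding Q_def msubst_def
  proof (intro dgY.dg_sum)
    fix m assume m: "m \<in> keys (f i)"
    have "dgY N (\<Sum>v\<in>keys m. lookup m v * 1) (mon_val (\<lambda>v. ucoord N (ix e v)) m)"
      unfolding mon_val_def using m ixN by (intro dgY.dg_prod dgY.dg_power dgY_ucoord) (auto simp: vars_def)
    moreover have "(\<Sum>v\<in>keys m. lookup m v * 1) \<le> d"
      using mon_deg_le_total_degree[OF m] deg_f[OF i] by (simp add: mon_deg_def)
    ultimately have "dgY N d (mon_val (\<lambda>v. ucoord N (ix e v)) m)" by (rule dgY.dg_mono)
    then show "dgY N d (mconst (lookup (f i) m) * mon_val (\<lambda>v. ucoord N (ix e v)) m)"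
      by (intro dgY.dg_mult_0) auto
  qed
  moreover have "Q \<noteq> 0"
  proof
    assume "Q = 0"
    \<comment> \<open>Setting all parameters to 0 turns the form \<open>Y_c\<close> into the
      coordinate \<open>c\<close>, which recovers \<open>f i\<close>. Pairs on the left index forms
      and parameters, on the right differential variables.\<close>
    define \<chi> where "\<chi> = msubst mconst (\<lambda>v :: nat \<times> nat. if fst v = 0 then mvar (snd v div (e + 1), snd v mod (e + 1)) else (0 :: gpoly))"
    interpret \<chi>: comm_ring_hom \<chi> unfolding \<chi>_def by (rule comm_ring_hom_msubst[OF comm_ring_hom_mconst])
    have \<chi>c: "\<chi> (mconst c) = mconst c" for c by (simp add: \<chi>_def msubst_mconst comm_ring_hom_mconst)
    have "\<chi> (ucoord N c) = mvar (c div (e + 1), c mod (e + 1))" for c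
      by (subst ucoord.simps) (simp add: \<chi>.hom_minus \<chi>.hom_sum \<chi>.hom_mult,
          simp add: \<chi>_def msubst_mvar comm_ring_hom_mconst)
    then have "\<chi> Q = msubst mconst (\<lambda>v. mvar (ix e v div (e + 1), ix e v mod (e + 1))) (f i)"
      unfolding Q_def
      using hom_msubst[OF comm_ring_hom_mconst \<chi>.comm_ring_hom_axioms, of "\<lambda>v. ucoord N (ix e v)" "f i"]
      by (simp add: comp_def \<chi>c)
    also have "\<dots> = msubst mconst mvar (f i)"
    proof (rule msubst_cong)
      fix v assume "v \<in> vars (f i)"
      then have "snd v < e + 1" using vars_f[OF i] by (auto simp: dvars_def)
      then have "ix e v div (e + 1) = fst v" "ix e v mod (e + 1) = snd v"
        unfolding ix_def by (simp_all only: div_mult_self3 mod_mult_self3 div_less mod_less)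
      then show "mvar (ix e v div (e + 1), ix e v mod (e + 1)) = mvar v" by simp
    qed
    finally show False using f0 \<open>Q = 0\<close> by (simp add: msubst_mconst_mvar)
  qed
  ultimately show ?thesis by blast
qed

lemma no_long_approximate_solution:
  assumes unit: "1 \<in> diff_ideal s f" and i: "i < s" "f i \<noteq> 0"
    and b: "2 \<le> b" "d \<le> b" and N: "1 \<le> N"
  shows "L < b ^ (60 * N * 72 ^ N)"
proof (rule ccontr)
  assume L: "\<not> L < b ^ (60 * N * 72 ^ N)"
  \<comment> \<open>Order exponents for the descent: \<open>y N = 0\<close>, and \<open>y j\<close>
    exceeds \<open>y (Suc j)\<close> by at least the cost \<open>60 * N * 72 ^ j\<close> of the step
    at degree exponent \<open>N * 72 ^ j\<close>.\<close>
  define y where "y j = 60 * N * (72 ^ N - 72 ^ j)" for j :: nat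
  have yL: "b ^ y j \<le> L" for j
  proof -
    have "y j \<le> 60 * N * 72 ^ N" unfolding y_def by (intro mult_le_mono) auto
    then have "b ^ y j \<le> b ^ (60 * N * 72 ^ N)" using b by (intro power_increasing) auto
    with L show ?thesis by linarith
  qed
  have "\<exists>Q. Q \<noteq> 0 \<and> dgY (N - j) (b ^ (N * 72 ^ j)) Q \<and> ordge (b ^ y j) (psi Q)" if "j \<le> N" for j
    using that
  proof (induction j)
    case 0
    obtain Q where Q: "Q \<noteq> 0" "dgY N d Q" "ordge L (psi Q)" using initial_relation[OF i] by blast
    have "d \<le> b ^ N" using b(2) self_le_power[of b N] b N by linarith
    then show ?case using Q dgY.dg_mono[OF Q(2)] ordge_mono[OF Q(3) yL[of 0]] by auto
  next
    case (Suc j)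
    define x where "x = N * 72 ^ j"
    define r where "r = N - Suc j"
    have r: "r < N" "Suc r = N - j" using Suc.prems by (auto simp: r_def)
    have xN: "N \<le> x" "1 \<le> x" using N by (auto simp: x_def)
    obtain Q where Q: "Q \<noteq> 0" "dgY (Suc r) (b ^ x) Q" "ordge (b ^ y j) (psi Q)"
      using Suc unfolding r(2) x_def by auto
    define A where "A = 21 * 3 ^ N * (b ^ x) ^ 4"
    note ie = iteration_exponents[OF b(1) N xN(1) A_def]
    have yj: "60 * x + y (Suc j) \<le> y j"
    proof -
      have le: "(72::nat) ^ Suc j \<le> 72 ^ N" using Suc.prems by (intro power_increasing) auto
      have "60 * x + y (Suc j) = 60 * N * (72 ^ j + (72 ^ N - 72 ^ Suc j))"
        by (simp add: x_def y_def algebra_simps)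
      also have "72 ^ j + (72 ^ N - 72 ^ Suc j) \<le> (72::nat) ^ N - 72 ^ j" using le by simp
      finally show ?thesis by (simp add: y_def)
    qed
    have bx: "b \<le> b ^ x" using self_le_power[of b x] b xN by simp
    have "\<exists>q. q \<noteq> 0 \<and> dgY r (50 * A ^ 6) q \<and> ordge (b ^ y (Suc j)) (psi q)"
    proof (rule dimension_drop[OF unit r(1) _ _ A_def Q])
      show "1 \<le> b ^ x" "d \<le> b ^ x" using bx b by auto
      show "17 * A ^ 5 * b ^ y (Suc j) \<le> b ^ y j"
        using ie(2)[of "y (Suc j)"] power_increasing[OF yj, of b] b by linarith
      show "b ^ y j \<le> L" by (rule yL)
      show "1 \<le> b ^ y (Suc j)" using b by simp
    qed
    moreover have "72 * x = N * 72 ^ Suc j" by (simp add: x_def)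
    ultimately obtain q where q: "q \<noteq> 0" "dgY r (50 * A ^ 6) q" "ordge (b ^ y (Suc j)) (psi q)"
      and x72: "72 * x = N * 72 ^ Suc j" by blast
    have "dgY r (b ^ (N * 72 ^ Suc j)) q" using dgY.dg_mono[OF q(2) ie(1)] by (simp only: x72)
    then show ?case using q unfolding r_def by blast
  qed
  \<comment> \<open>With no form left, \<open>Q\<close> is a polynomial in the parameters and
    \<open>psi Q\<close> a constant series; order at least 1 then forces
    \<open>Q = 0\<close>.\<close>
  from this[of N] obtain Q where Q: "Q \<noteq> 0" "dgY 0 (b ^ (N * 72 ^ N)) Q" "ordge 1 (psi Q)"
    by (auto simp: y_def)
  have "fps_nth (psi Q) 0 = Q" by (simp add: psi_eq_const[OF Q(2)])
  moreover have "fps_nth (psi Q) 0 = 0" using Q(3) by (simp add: ordge_def)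
  ultimately show False using Q(1) by simp
qed

end

subsection \<open>From points of the truncated system to power series\<close>

lemma finite_dvars: "finite (dvars n N)"
  by (rule finite_subset[of _ "{..<n} \<times> {..N}"]) (auto simp: dvars_def)

text \<open>The Taylor series with derivatives \<open>a (i, j + k)\<close> at 0 represents x_i^(j).
  The k-th derivative of \<open>f\<close> along it has value \<open>dderivs k (f i)\<close> at
  \<open>a\<close>, so derivatives up to and including \<open>L\<close> give order
  \<open>Suc L\<close>.\<close>

lemma approx_system_of_point:
  assumes vars: "\<And>i. i < s \<Longrightarrow> vars (f i) \<subseteq> dvars n e"
    and deg: "\<And>i. i < s \<Longrightarrow> total_degree (f i) \<le> d"
    and a: "\<And>i k. i < s \<Longrightarrow> k \<le> L \<Longrightarrow> Defs.eval (dderivs k (f i)) a = 0"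
  shows "\<exists>u. approx_system (n * (e + 1)) u n e s f d (Suc L)"
proof -
  define w where "w v = Abs_fps (\<lambda>k. a (fst v, snd v + k) / fact k)" for v
  define u where "u c = (if c < n * (e + 1) then w (c div (e + 1), c mod (e + 1)) else 0)" for c
  have w_deriv: "fps_deriv (w v) = w (dshift v)" for v
  proof (rule fps_ext)
    fix k
    have "of_nat (k + 1) * (x / fact (k + 1)) = x / fact k" for x :: complex
      by (simp add: field_simps del: of_nat_Suc)
    then show "fps_nth (fps_deriv (w v)) k = fps_nth (w (dshift v)) k"
      by (simp add: w_def dshift_def del: of_nat_add fact_Suc)
  qed
  have hom: "comm_ring_hom (msubst fps_const w)" by (rule comm_ring_hom_msubst[OF comm_ring_hom_fps_const])
  interpret ms: comm_ring_hom "msubst fps_const w" by (rule hom)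
  have ms_deriv: "fps_deriv (msubst fps_const w p) = msubst fps_const w (dderiv p)" for p
    by (induction p rule: mpoly_induct)
      (simp_all add: ms.hom_add ms.hom_mult msubst_mconst msubst_mvar comm_ring_hom_fps_const w_deriv
        dderiv_add dderiv_mult)
  have ms_0: "fps_nth (msubst fps_const w p) 0 = Defs.eval p a" for p
    unfolding eval_eq_msubst
    by (induction p rule: mpoly_induct)
      (simp_all add: ms.hom_add ms.hom_mult msubst_add msubst_mult msubst_mconst msubst_mvar
        comm_ring_hom_fps_const comm_ring_hom_ident w_def)
  have ms_nth: "fact k * fps_nth (msubst fps_const w p) k = Defs.eval (dderivs k p) a" for k p
  proof (induction k arbitrary: p)
    case (Suc k)
    have "fact (Suc k) * fps_nth (msubst fps_const w p) (Suc k) = fact k * fps_nth (fps_deriv (msubst fps_const w p)) k"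
      by (simp add: algebra_simps)
    then show ?case using Suc.IH[of "dderiv p"] by (simp add: ms_deriv dderivs_Suc)
  qed (simp add: ms_0)
  show ?thesis
  proof (intro exI[of _ u], unfold_locales)
    show "u c = 0" if "n * (e + 1) \<le> c" for c using that by (simp add: u_def)
    show "fps_deriv (u c) = u (Suc c)" if "c < n * (e + 1)" "\<not> top e c" for c
    proof -
      have "Suc c mod (e + 1) = Suc (c mod (e + 1))" "Suc c div (e + 1) = c div (e + 1)"
        using that(2) unfolding top_def by (metis mod_Suc, metis div_Suc)
      then show ?thesis
        using that not_top_less[OF that] by (simp add: u_def w_deriv dshift_def del: add_Suc_right Suc_eq_plus1 Suc_eq_plus1_left)
    qed
    fix i assume i: "i < s"
    have "u (ix e v) = w v" if "v \<in> vars (f i)" for v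
    proof -
      have v: "v \<in> dvars n e" using vars[OF i] that by blast
      then have "snd v < e + 1" by (auto simp: dvars_def)
      then have "ix e v div (e + 1) = fst v" "ix e v mod (e + 1) = snd v"
        unfolding ix_def by (simp_all only: div_mult_self3 mod_mult_self3 div_less mod_less)
      then show ?thesis using ix_less[OF v] by (simp add: u_def)
    qed
    then have "msubst fps_const (\<lambda>v. u (ix e v)) (f i) = msubst fps_const w (f i)" by (rule msubst_cong)
    moreover have "ordge (Suc L) (msubst fps_const w (f i))"
      unfolding ordge_def using ms_nth[of _ "f i"] a[OF i] by (metis fact_nonzero less_Suc_eq_le mult_eq_0_iff)
    ultimately show "ordge (Suc L) (msubst fps_const (\<lambda>v. u (ix e v)) (f i))" by simp
  qed (use vars deg in auto)
qed

lemma unit_in_trunc_ideal: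
  assumes unit: "1 \<in> diff_ideal s f"
    and vars: "\<And>i. i < s \<Longrightarrow> vars (f i) \<subseteq> dvars n e"
    and deg: "\<And>i. i < s \<Longrightarrow> total_degree (f i) \<le> d"
    and i: "i < s" "f i \<noteq> 0" and b: "2 \<le> b" "d \<le> b" and N: "1 \<le> n * (e + 1)"
  shows "1 \<in> trunc_ideal n e s f (b ^ (60 * (n * (e + 1)) * 72 ^ (n * (e + 1))))"
proof (rule ccontr)
  define L where "L = b ^ (60 * (n * (e + 1)) * 72 ^ (n * (e + 1)))"
  let ?S = "{dderivs k (f i) | i k. i < s \<and> k \<le> L}"
  assume "1 \<notin> trunc_ideal n e s f (b ^ (60 * (n * (e + 1)) * 72 ^ (n * (e + 1))))"
  then have "1 \<notin> ideal_in (dvars n (e + L)) ?S" by (simp add: trunc_ideal_def L_def)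
  moreover have "vars p \<subseteq> dvars n (e + L)" if p: "p \<in> ?S" for p
  proof -
    obtain i k where "p = dderivs k (f i)" "i < s" "k \<le> L" using p by blast
    then have "vars p \<subseteq> dvars n (e + k)" using vars_dderivs[OF vars[of i], of k] by simp
    also have "\<dots> \<subseteq> dvars n (e + L)" using \<open>k \<le> L\<close> by (auto simp: dvars_def)
    finally show ?thesis .
  qed
  ultimately obtain a where a: "\<And>p. p \<in> ?S \<Longrightarrow> Defs.eval p a = 0"
    using weak_nullstellensatz[OF finite_dvars, of ?S n "e + L"] by blast
  then have "Defs.eval (dderivs k (f i)) a = 0" if "i < s" "k \<le> L" for i k using that by blast
  from approx_system_of_point[OF vars deg this] obtain u where "approx_system (n * (e + 1)) u n e s f d (Suc L)" ..
  then interpret approx_system "n * (e + 1)" u n e s f d "Suc L" .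
  show False using no_long_approximate_solution[OF unit i b N] by (simp add: L_def)
qed

lemma trunc_ideal_subset_diff_ideal: "trunc_ideal n e s f L \<subseteq> diff_ideal s f"
proof
  fix p assume "p \<in> trunc_ideal n e s f L"
  then obtain T g where T: "finite T" "T \<subseteq> {dderivs k (f i) | i k. i < s \<and> k \<le> L}" "p = (\<Sum>t\<in>T. g t * t)"
    unfolding trunc_ideal_def ideal_in_def by blast
  have "T \<subseteq> {dderivs k (f i) | i k. i < s}" using T(2) by blast
  with T(1,3) show "p \<in> diff_ideal s f"
    unfolding diff_ideal_def ideal_gen_def ideal_in_def mem_Collect_eq by (intro exI[of _ T] exI[of _ g]) simp
qed

section \<open>Degenerate systems and the final estimate\<close>

lemma diff_ideal_zero:
  assumes "\<And>i. i < s \<Longrightarrow> f i = 0"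
  shows "1 \<notin> diff_ideal s f"
proof
  have "dderivs k 0 = 0" for k by (induction k) (simp_all add: dderivs_Suc dderiv_def)
  then have gen: "t = 0" if "t \<in> {dderivs k (f i) | i k. i < s}" for t using that assms by auto
  assume "1 \<in> diff_ideal s f"
  then obtain T g where T: "T \<subseteq> {dderivs k (f i) | i k. i < s}" "1 = (\<Sum>t\<in>T. g t * t)"
    by (auto simp: diff_ideal_def ideal_gen_def ideal_in_def)
  have "(\<Sum>t\<in>T. g t * t) = 0" using T(1) gen by (intro sum.neutral) auto
  with T(2) show False by simp
qed

lemma constant_in_trunc_ideal:
  assumes "i < s" "f i \<noteq> 0" "total_degree (f i) = 0"
  shows "1 \<in> trunc_ideal n e s f 0"
proof -
  define c where "c = lookup (f i) 0"
  have "m = 0" if "m \<in> keys (f i)" for m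
    using mon_deg_le_total_degree[OF that] assms(3) by (auto simp: mon_deg_def in_keys_iff intro!: poly_mapping_eqI)
  then have fi: "f i = mconst c"
    unfolding c_def mconst_def by (intro poly_mapping_eqI) (metis in_keys_iff lookup_single_eq lookup_single_not_eq)
  then have "c \<noteq> 0" using assms(2) by auto
  then have "1 = mconst (1 / c) * f i" by (simp add: fi flip: mconst_mult)
  moreover have "f i \<in> {dderivs k (f i) | i k. i < s \<and> k \<le> 0}"
    using assms(1) by (auto intro!: exI[of _ i])
  ultimately show ?thesis
    unfolding trunc_ideal_def ideal_in_def mem_Collect_eq
    by (intro exI[of _ "{f i}"] exI[of _ "\<lambda>_. mconst (1 / c)"]) simp
qed

lemma total_degree_eq_0:
  assumes "vars p = {}"
  shows "total_degree p = 0"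
proof (cases "p = 0")
  case False
  have "(\<Sum>v\<in>keys m. lookup m v) = 0" if "m \<in> keys p" for m
  proof -
    have "keys m = {}" using assms that by (auto simp: vars_def)
    then show ?thesis by simp
  qed
  then have "(\<lambda>m. \<Sum>v\<in>keys m. lookup m v) ` keys p =
      (\<lambda>_. 0) ` keys p" by (intro image_cong) auto
  also have "\<dots> = {0}" using False by (simp add: image_constant_conv)
  finally show ?thesis by (simp add: total_degree_def)
qed (simp add: total_degree_def)

text \<open>From 60 \<le> 2^6, N \<le> 2^N and 72 \<le> 2^7 the exponent is at most 2^(6 + 8N), and
  6 + 8N \<le> 14N; this is the constant 14.\<close>

lemma double_exponential_bound:
  assumes "1 \<le> N" "2 \<le> b" "\<nu> \<ge> 1"
  shows "real (b ^ (60 * N * 72 ^ N)) \<le> real b powr (2 powr (14 * real_of_int \<nu> ^ 2 * real N))"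
proof -
  have "60 * N * 72 ^ N \<le> 2 ^ 6 * 2 ^ N * (2 ^ 7) ^ N"
    using less_exp[of N] by (intro mult_le_mono power_mono) auto
  also have "\<dots> = 2 ^ (6 + N + 7 * N)" by (simp only: power_add[symmetric] power_mult[symmetric])
  also have "\<dots> \<le> 2 ^ (14 * N)" using assms by (intro power_increasing) auto
  finally have "real (60 * N * 72 ^ N) \<le> 2 powr real (14 * N)"
    by (metis numeral_power_le_of_nat_cancel_iff of_nat_le_iff of_nat_numeral of_nat_power powr_realpow zero_less_numeral)
  also have "\<dots> \<le> 2 powr (14 * real_of_int \<nu> ^ 2 * real N)"
  proof (rule powr_mono)
    have "1 \<le> real_of_int \<nu> ^ 2" using assms(3) by (simp add: one_le_power)
    then have "14 * 1 * real N \<le> 14 * real_of_int \<nu> ^ 2 * real N" by (intro mult_right_mono mult_left_mono) auto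
    then show "real (14 * N) \<le> 14 * real_of_int \<nu> ^ 2 * real N" by simp
  qed simp
  finally have "real b powr real (60 * N * 72 ^ N) \<le> real b powr (2 powr (14 * real_of_int \<nu> ^ 2 * real N))"
    using assms(2) by (intro powr_mono) auto
  moreover have "real b powr real (60 * N * 72 ^ N) = real (b ^ (60 * N * 72 ^ N))"
    using assms(2) by (subst powr_realpow) auto
  ultimately show ?thesis by simp
qed

theorem theorem5p1:
  "\<exists>c::real. c > 0 \<and>
    (\<forall>(n::nat) (e::nat) (s::nat) (f :: nat \<Rightarrow> (nat \<times> nat) mpoly).
       e \<ge> 1 \<longrightarrow> (\<forall>i<s. vars (f i) \<subseteq> dvars n e) \<longrightarrow>
       (let X = dvars n e;
            V = zero_set X {f i | i. i < s};
            \<nu> = max 1 (zdim X V);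
            D = max (Max (insert 0 (total_degree ` f ` {..<s}))) (zdegree X V)
        in \<exists>L::nat. real L \<le> (real (n * (e + 1) * D)) powr (2 powr (c * real_of_int \<nu> ^ 2 * real (n * (e + 1))))
              \<and> ((1 \<in> diff_ideal s f) \<longleftrightarrow> (1 \<in> trunc_ideal n e s f L))))"
proof (intro exI[of _ 14] conjI allI impI)
  show "(14::real) > 0" by simp
  fix n e s :: nat and f :: "nat \<Rightarrow> (nat \<times> nat) mpoly"
  assume e: "e \<ge> 1" and "\<forall>i<s. vars (f i) \<subseteq> dvars n e"
  then have vars: "\<And>i. i < s \<Longrightarrow> vars (f i) \<subseteq> dvars n e" by blast
  define X where "X = dvars n e"
  define \<nu> where "\<nu> = max 1 (zdim X (zero_set X {f i | i. i < s}))"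
  define d where "d = Max (insert 0 (total_degree ` f ` {..<s}))"
  define D where "D = max d (zdegree X (zero_set X {f i | i. i < s}))"
  have deg: "total_degree (f i) \<le> d" if "i < s" for i
    unfolding d_def using that by (intro Max_ge) auto
  have sub: "1 \<in> diff_ideal s f" if "1 \<in> trunc_ideal n e s f L" for L
    using that trunc_ideal_subset_diff_ideal by blast
  have "\<exists>L::nat. real L \<le> real (n * (e + 1) * D) powr (2 powr (14 * real_of_int \<nu> ^ 2 * real (n * (e + 1))))
      \<and> (1 \<in> diff_ideal s f \<longleftrightarrow> 1 \<in> trunc_ideal n e s f L)"
  proof (cases "1 \<in> diff_ideal s f")
    case False
    \<comment> \<open>Truncated ideals lie in the differential ideal, so both sides are false
      already for \<open>L = 0\<close>.\<close>
    then show ?thesis using sub by (intro exI[of _ 0]) auto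
  next
    case unit: True
    then obtain i where i: "i < s" "f i \<noteq> 0" using diff_ideal_zero by blast
    show ?thesis
    proof (cases "d = 0")
      case True
      then have "1 \<in> trunc_ideal n e s f 0" using constant_in_trunc_ideal[of i s f n e] i deg[OF i(1)] by simp
      then show ?thesis using unit by (intro exI[of _ 0]) auto
    next
      case False
      \<comment> \<open>Without variables all equations are constants, contrary to
        \<open>d \<noteq> 0\<close>.\<close>
      have "n \<noteq> 0"
      proof
        assume "n = 0"
        then have "dvars n e = {}" by (simp add: dvars_def)
        then have "total_degree (f i) = 0" if "i < s" for i
          using vars[OF that] by (intro total_degree_eq_0) simp
        then have "total_degree ` f ` {..<s} \<subseteq> {0}" by auto
        then have ins: "insert 0 (total_degree ` f ` {..<s}) = {0}" by blast
        show False using False unfolding d_def ins by simp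
      qed
      define N where "N = n * (e + 1)"
      \<comment> \<open>Here \<open>e \<ge> 1\<close> gives \<open>N \<ge> 2\<close>, so that
        \<open>N * D\<close> can serve as the base: it is at least 2 and at least
        \<open>d\<close>.\<close>
      have "1 * (1 + 1) \<le> N" unfolding N_def using e \<open>n \<noteq> 0\<close> by (intro mult_le_mono) auto
      moreover have D: "1 \<le> D" "d \<le> D" using False by (auto simp: D_def)
      ultimately have b: "2 \<le> N * D" "d \<le> N * D" and N1: "1 \<le> N"
        using mult_le_mono[of 2 N 1 D] mult_le_mono[of 1 N d D] by auto
      have "1 \<in> trunc_ideal n e s f ((N * D) ^ (60 * N * 72 ^ N))"
        using unit_in_trunc_ideal[OF unit vars deg i b N1[unfolded N_def]] by (simp add: N_def)
      moreover have "real ((N * D) ^ (60 * N * 72 ^ N)) \<le> real (N * D) powr (2 powr (14 * real_of_int \<nu> ^ 2 * real N))"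
        by (rule double_exponential_bound[OF N1 b(1)]) (simp add: \<nu>_def)
      ultimately show ?thesis using unit unfolding N_def by blast
    qed
  qed
  then show "let X = dvars n e; V = zero_set X {f i | i. i < s}; \<nu> = max 1 (zdim X V);
      D = max (Max (insert 0 (total_degree ` f ` {..<s}))) (zdegree X V)
    in \<exists>L::nat. real L \<le> (real (n * (e + 1) * D)) powr (2 powr (14 * real_of_int \<nu> ^ 2 * real (n * (e + 1))))
      \<and> ((1 \<in> diff_ideal s f) \<longleftrightarrow> (1 \<in> trunc_ideal n e s f L))"
    unfolding Let_def X_def \<nu>_def D_def d_def .
qed

end
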